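(* Let $l\ge3$ and $-l\le m\le l$ with $(l,m)\neq(3,0)$. The sectional curvature of $\mathrm{SDiff}(\mathbb S^2)$ in the direction of $e^0_3$ and $e^m_l$ is $$C(e^0_3,e^m_l)=-\frac{525m^2}{32\pi}\Big(3\gamma^m_l-2\Big(\frac{12}{l(l+1)}+1\Big)\varrho^m_l-\Big(\frac{12}{l(l+1)}-1\Big)^2\vartheta^m_l\Big),$$ where, writing $A=\frac{((l+2)^2-m^2)((l+1)^2-m^2)}{(2l+1)(2l+3)^2(2l+5)}$, $B=\frac{((l-1)^2-m^2)(l^2-m^2)}{(2l-3)(2l-1)^2(2l+1)}$, $D=\Big(\frac{l^2-m^2}{(2l+1)(2l-1)}+\frac{(l+1)^2-m^2}{(2l+3)(2l+1)}-\frac15\Big)^2$, $r_1=\frac{l(l+1)}{(l+2)(l+3)}$, $r_2=\frac{l(l+1)}{(l-2)(l-1)}$: $$\vartheta^m_l=\tfrac18(Ar_1+Br_2+D),\quad\varrho^m_l=\tfrac18(A+B+D),\quad\gamma^m_l=\tfrac18\big(A/r_1+B/r_2+D\big).$$ For odd $l$ this is also the sectional curvature of $\mathrm{SDiff}(\mathbb{RP}^2)$ in the corresponding direction (with the isometric normalization).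
   Context: $\mathbb S^2$ with spherical coordinates $(\theta,\phi)$, metric $d\theta^2+\sin^2\theta d\phi^2$, area form $\mu=\sin\theta\,d\theta\wedge d\phi$; $\mathrm{SDiff}(\mathbb S^2)$ carries the right-invariant $L^2$ metric $\langle u,v\rangle=\int_{\mathbb S^2}g(u,v)\mu$ on divergence-free fields. Spherical harmonics $Y^m_l=\big[\frac{(l-m)!}{(l+m)!}\frac{2l+1}{4\pi}\big]^{1/2}e^{im\phi}P^m_l(\cos\theta)$ with $P^m_l(z)=(1-z^2)^{m/2}\frac1{2^ll!}\frac{d^{l+m}}{dz^{l+m}}(z^2-1)^l$ (no Condon–Shortley phase). $e^m_l=\mathrm{sgrad}\big(Y^m_l/\sqrt{l(l+1)}\big)$ with $\mathrm{sgrad}f=\frac1{\sin\theta}(\partial_\phi f\partial_\theta-\partial_\theta f\partial_\phi)$; these form an orthonormal basis of complexified divergence-free fields for the Hermitian product $\langle u,v\rangle=\int(u,\bar v)\mu$. In particular $e^0_3=\frac18\sqrt{21/\pi}(5\cos^2\theta-1)\partial_\phi$. Curvature: $\nabla_uv=\frac12([u,v]-B(u,v)-B(v,u))$, $\langle B(u,v),w\rangle=\langle u,[v,w]\rangle$, $R(u,v)w=-\nabla_u\nabla_vw+\nabla_v\nabla_uw+\nabla_{[u,v]}w$, extended complex-linearly; for complex directions $C(u,v)=\langle R(u,v)u,v\rangle/(\|u\|^2\|v\|^2-|\langle u,v\rangle|^2)$ with the Hermitian product. $\mathbb{RP}^2=\mathbb S^2/I$, $I(\theta,\phi)=(\pi-\theta,\pi+\phi)$;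 $\mathrm{SDiff}(\mathbb{RP}^2)$ is identified with the $I$-commuting subgroup of $\mathrm{SDiff}(\mathbb S^2)$ with the induced metric (isometric normalization). *)

theory Defs
  imports "HOL-Analysis.Analysis"
begin

type_synonym vec = "real^3"
type_synonym vf = "vec \<Rightarrow> vec"

text \<open>C-infinity on an open set U: F lies in a family of functions, each differentiable
  on U, that is closed under taking directional derivatives.\<close>
definition smooth_on :: "vec set \<Rightarrow> vf \<Rightarrow> bool" where
  "smooth_on U F \<longleftrightarrow> (\<exists>S. F \<in> S \<and> (\<forall>g\<in>S. g differentiable_on U \<and>
      (\<forall>v. (\<lambda>x. frechet_derivative g (at x) v) \<in> S)))"

definition S2 :: "vec set" where "S2 = sphere 0 1"

text \<open>A field on the sphere (only its values on S2 matter) is smooth if it is the restriction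
  of a map that is smooth on an open neighbourhood of S2.\<close>
definition smooth_ext :: "vf \<Rightarrow> vf \<Rightarrow> bool" where
  "smooth_ext X F \<longleftrightarrow> (\<exists>U. open U \<and> S2 \<subseteq> U \<and> smooth_on U F) \<and> (\<forall>p\<in>S2. F p = X p)"

definition ext :: "vf \<Rightarrow> vf" where "ext X = (SOME F. smooth_ext X F)"

definition Dv :: "vf \<Rightarrow> vec \<Rightarrow> vec \<Rightarrow> vec" where
  "Dv X p v = frechet_derivative (ext X) (at p) v"

text \<open>surface divergence of a tangent field on S2: tr((I - p p^T) DX(p))\<close>
definition sdiv :: "vf \<Rightarrow> vec \<Rightarrow> real" where
  "sdiv X p = (\<Sum>i\<in>UNIV. Dv X p (axis i 1) $ i) - p \<bullet> Dv X p p"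

definition sdiff_S2 :: "vf set" where
  "sdiff_S2 = {X. (\<exists>F. smooth_ext X F) \<and> (\<forall>p\<in>S2. X p \<bullet> p = 0) \<and> (\<forall>p\<in>S2. sdiv X p = 0)}"

text \<open>Lie algebra of SDiff(RP2): fields commuting with the antipodal map I(p) = -p,
  i.e. X(I p) = dI (X p) = - X p.\<close>
definition sdiff_RP2 :: "vf set" where
  "sdiff_RP2 = {X \<in> sdiff_S2. \<forall>p\<in>S2. X (- p) = - X p}"

text \<open>Lie bracket of vector fields (the curvature below is invariant under a global sign
  change of the bracket)\<close>
definition br :: "vf \<Rightarrow> vf \<Rightarrow> vf" where
  "br X Y = (\<lambda>p. Dv Y p (X p) - Dv X p (Y p))"

definition sph :: "real \<Rightarrow> real \<Rightarrow> vec" where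
  "sph \<theta> \<phi> = vector [sin \<theta> * cos \<phi>, sin \<theta> * sin \<phi>, cos \<theta>]"

definition ip :: "vf \<Rightarrow> vf \<Rightarrow> real" where
  "ip X Y = integral (cbox (0,0) (pi, 2*pi))
      (\<lambda>(\<theta>,\<phi>). (X (sph \<theta> \<phi>) \<bullet> Y (sph \<theta> \<phi>)) * sin \<theta>)"

definition Bop :: "vf set \<Rightarrow> vf \<Rightarrow> vf \<Rightarrow> vf" where
  "Bop g u v = (SOME b. b \<in> g \<and> (\<forall>w\<in>g. ip b w = ip u (br v w)))"

section \<open>Complexification (pairs (real part, imaginary part))\<close>

type_synonym cvf = "vf \<times> vf"

definition fadd :: "vf \<Rightarrow> vf \<Rightarrow> vf" where "fadd X Y = (\<lambda>p. X p + Y p)"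
definition fsub :: "vf \<Rightarrow> vf \<Rightarrow> vf" where "fsub X Y = (\<lambda>p. X p - Y p)"
definition fscale :: "real \<Rightarrow> vf \<Rightarrow> vf" where "fscale r X = (\<lambda>p. r *\<^sub>R X p)"

definition cadd :: "cvf \<Rightarrow> cvf \<Rightarrow> cvf" where
  "cadd u v = (fadd (fst u) (fst v), fadd (snd u) (snd v))"
definition csub :: "cvf \<Rightarrow> cvf \<Rightarrow> cvf" where
  "csub u v = (fsub (fst u) (fst v), fsub (snd u) (snd v))"
definition cneg :: "cvf \<Rightarrow> cvf" where
  "cneg u = (fscale (-1) (fst u), fscale (-1) (snd u))"
definition cscale :: "real \<Rightarrow> cvf \<Rightarrow> cvf" where
  "cscale r u = (fscale r (fst u), fscale r (snd u))"

definition cbil :: "(vf \<Rightarrow> vf \<Rightarrow> vf) \<Rightarrow> cvf \<Rightarrow> cvf \<Rightarrow> cvf" where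
  "cbil f u v = (fsub (f (fst u) (fst v)) (f (snd u) (snd v)),
                 fadd (f (fst u) (snd v)) (f (snd u) (fst v)))"

definition cbr :: "cvf \<Rightarrow> cvf \<Rightarrow> cvf" where "cbr = cbil br"
definition cB :: "vf set \<Rightarrow> cvf \<Rightarrow> cvf \<Rightarrow> cvf" where "cB g = cbil (Bop g)"

definition cnabla :: "vf set \<Rightarrow> cvf \<Rightarrow> cvf \<Rightarrow> cvf" where
  "cnabla g u v = cscale (1/2) (csub (csub (cbr u v) (cB g u v)) (cB g v u))"

definition cR :: "vf set \<Rightarrow> cvf \<Rightarrow> cvf \<Rightarrow> cvf \<Rightarrow> cvf" where
  "cR g u v w = cadd (cadd (cneg (cnabla g u (cnabla g v w))) (cnabla g v (cnabla g u w)))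
                     (cnabla g (cbr u v) w)"

definition herm :: "cvf \<Rightarrow> cvf \<Rightarrow> complex" where
  "herm u v = Complex (ip (fst u) (fst v) + ip (snd u) (snd v))
                      (ip (snd u) (fst v) - ip (fst u) (snd v))"

definition sec_curv :: "vf set \<Rightarrow> cvf \<Rightarrow> cvf \<Rightarrow> complex" where
  "sec_curv g u v = herm (cR g u v u) v /
     complex_of_real (Re (herm u u) * Re (herm v v) - (cmod (herm u v))^2)"

definition assocP :: "nat \<Rightarrow> int \<Rightarrow> real \<Rightarrow> real" where
  "assocP l m z = (1 - z^2) powr (of_int m / 2) * (1 / (2^l * fact l)) *
      (deriv ^^ nat (int l + m)) (\<lambda>t. (t^2 - 1)^l) z"

definition Ylm :: "nat \<Rightarrow> int \<Rightarrow> real \<Rightarrow> real \<Rightarrow> complex" where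
  "Ylm l m \<theta> \<phi> = complex_of_real (sqrt (fact (nat (int l - m)) / fact (nat (int l + m))
        * (2 * real l + 1) / (4 * pi))) * cis (of_int m * \<phi>) * complex_of_real (assocP l m (cos \<theta>))"

definition dth :: "real \<Rightarrow> real \<Rightarrow> vec" where
  "dth \<theta> \<phi> = vector [cos \<theta> * cos \<phi>, cos \<theta> * sin \<phi>, - sin \<theta>]"
definition dph :: "real \<Rightarrow> real \<Rightarrow> vec" where
  "dph \<theta> \<phi> = vector [- sin \<theta> * sin \<phi>, sin \<theta> * cos \<phi>, 0]"

definition sgrad_sph :: "(real \<Rightarrow> real \<Rightarrow> real) \<Rightarrow> real \<Rightarrow> real \<Rightarrow> vec" where
  "sgrad_sph h \<theta> \<phi> = (1 / sin \<theta>) *\<^sub>R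
     (deriv (\<lambda>t. h \<theta> t) \<phi> *\<^sub>R dth \<theta> \<phi> - deriv (\<lambda>t. h t \<phi>) \<theta> *\<^sub>R dph \<theta> \<phi>)"

definition poles :: "vec set" where "poles = {p \<in> S2. p $ 3 = 1 \<or> p $ 3 = -1}"

definition field_of_sph :: "(real \<Rightarrow> real \<Rightarrow> vec) \<Rightarrow> vf" where
  "field_of_sph W p =
     (if p \<in> poles then Lim (at p within (S2 - poles)) (\<lambda>q. W (arccos (q $ 3)) (Arg (Complex (q $ 1) (q $ 2))))
      else W (arccos (p $ 3)) (Arg (Complex (p $ 1) (p $ 2))))"

definition e :: "nat \<Rightarrow> int \<Rightarrow> cvf" where
  "e l m = (field_of_sph (sgrad_sph (\<lambda>\<theta> \<phi>. Re (Ylm l m \<theta> \<phi>) / sqrt (real l * (real l + 1)))),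
            field_of_sph (sgrad_sph (\<lambda>\<theta> \<phi>. Im (Ylm l m \<theta> \<phi>) / sqrt (real l * (real l + 1)))))"

definition cA :: "nat \<Rightarrow> int \<Rightarrow> real" where
  "cA l m = (((real l + 2)^2 - (of_int m)^2) * ((real l + 1)^2 - (of_int m)^2)) /
            ((2 * real l + 1) * (2 * real l + 3)^2 * (2 * real l + 5))"
definition cBc :: "nat \<Rightarrow> int \<Rightarrow> real" where
  "cBc l m = (((real l - 1)^2 - (of_int m)^2) * ((real l)^2 - (of_int m)^2)) /
            ((2 * real l - 3) * (2 * real l - 1)^2 * (2 * real l + 1))"
definition cD :: "nat \<Rightarrow> int \<Rightarrow> real" where
  "cD l m = (((real l)^2 - (of_int m)^2) / ((2 * real l + 1) * (2 * real l - 1))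
            + ((real l + 1)^2 - (of_int m)^2) / ((2 * real l + 3) * (2 * real l + 1)) - 1/5)^2"
definition r1 :: "nat \<Rightarrow> real" where
  "r1 l = (real l * (real l + 1)) / ((real l + 2) * (real l + 3))"
definition r2 :: "nat \<Rightarrow> real" where
  "r2 l = (real l * (real l + 1)) / ((real l - 2) * (real l - 1))"

definition vartheta :: "nat \<Rightarrow> int \<Rightarrow> real" where
  "vartheta l m = (cA l m * r1 l + cBc l m * r2 l + cD l m) / 8"
definition varrho :: "nat \<Rightarrow> int \<Rightarrow> real" where
  "varrho l m = (cA l m + cBc l m + cD l m) / 8"
definition gamma_lm :: "nat \<Rightarrow> int \<Rightarrow> real" where
  "gamma_lm l m = (cA l m / r1 l + cBc l m / r2 l + cD l m) / 8"

definition curv_formula :: "nat \<Rightarrow> int \<Rightarrow> real" where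
  "curv_formula l m = - (525 * (of_int m)^2 / (32 * pi)) *
     (3 * gamma_lm l m - 2 * (12 / (real l * (real l + 1)) + 1) * varrho l m
      - (12 / (real l * (real l + 1)) - 1)^2 * vartheta l m)"

end

theory Submission
  imports Defs "HOL-Computational_Algebra.Polynomial"
begin

text \<open>Every field involved is the symplectic gradient \<open>sgrad f = grad f \<times> p\<close> of a polynomial stream function f.
  For such fields \<open>[sgrad f, sgrad g] = sgrad {f, g}\<close>, and the exterior derivative of the one-form dual to
  \<open>sgrad f\<close> is L f times the area form, where L is minus the Laplacian of the sphere. By the divergence theorem
  \<open>ip (sgrad f) [sgrad g, w]\<close> is then minus the integral of \<open>L f * dg(w)\<close>.

  The field of degree 3 and order 0 is U = f'(z) times the rotation D about the polar axis, where f' is a multiple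
  of 5 z^2 - 1 and L f = 12 f. For v = sgrad g this gives \<open>[U, v] = sgrad (f' D g)\<close>, \<open>B(U, v) = 12 sgrad (D r)\<close> and
  \<open>B(v, U) = - sgrad (D s)\<close> with \<open>L r = f' g\<close> and \<open>L s = f' L g\<close>; the gradient part that has to be removed is
  explicit by Cartan's formula for the rotation.

  Multiplication by 5 z^2 - 1 sends the Legendre function of degree k to degrees k + 2, k, k - 2, and
  L acts by k (k + 1). Hence the curvature operator applied to degree l has, besides terms of other
  degrees, which are orthogonal, a component along degree l itself, and only the products of opposite
  matrix coefficients enter it, so no normalisation of the harmonics is needed.\<close>

section \<open>Calculus in coordinates\<close>

lemma sum_axis_expansion: "(\<Sum>i\<in>UNIV. v $ i *\<^sub>R axis i 1) = (v :: real^'n)"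
  using basis_expansion[of v] by (simp add: scalar_mult_eq_scaleR)

lemma linear_axis_expansion:
  fixes f :: "real^'n \<Rightarrow> 'a::real_vector"
  assumes "linear f"
  shows "f v = (\<Sum>i\<in>UNIV. v $ i *\<^sub>R f (axis i 1))"
proof -
  have "f v = f (\<Sum>i\<in>UNIV. v $ i *\<^sub>R axis i 1)"
    by (simp only: sum_axis_expansion)
  then show ?thesis
    by (simp only: linear_sum[OF assms] linear_scale[OF assms] o_def)
qed

lemma has_derivative_vec_nth [derivative_intros]:
  "((\<lambda>x::real^'n. x $ i) has_derivative (\<lambda>v. v $ i)) F"
  by (rule bounded_linear_imp_has_derivative) (rule bounded_linear_vec_nth)

lemma has_derivative_vecI:
  fixes f :: "'a::real_normed_vector \<Rightarrow> real^'n"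
  assumes "\<And>i. ((\<lambda>x. f x $ i) has_derivative (\<lambda>v. f' v $ i)) F"
  shows "(f has_derivative f') F"
proof -
  have "((\<lambda>x. \<Sum>i\<in>UNIV. f x $ i *\<^sub>R axis i 1 :: real^'n) has_derivative (\<lambda>v. \<Sum>i\<in>UNIV. f' v $ i *\<^sub>R axis i 1)) F"
    by (intro has_derivative_sum has_derivative_scaleR_left assms)
  then show ?thesis
    by (simp only: sum_axis_expansion)
qed

lemma continuous_on_vec_iff:
  fixes f :: "'a::topological_space \<Rightarrow> real^'n"
  shows "continuous_on S f \<longleftrightarrow> (\<forall>i. continuous_on S (\<lambda>x. f x $ i))"
proof
  assume "\<forall>i. continuous_on S (\<lambda>x. f x $ i)"
  then have "continuous_on S (\<lambda>x. \<chi> i. f x $ i)"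
    by (intro continuous_on_vec_lambda) simp
  then show "continuous_on S f"
    by simp
qed (auto intro: continuous_intros)

lemma inner_vec3: "(v::vec) \<bullet> w = v$1 * w$1 + v$2 * w$2 + v$3 * w$3"
  by (simp add: inner_vec_def sum_3)

lemma vec3_eq_iff: "(v::vec) = w \<longleftrightarrow> v$1 = w$1 \<and> v$2 = w$2 \<and> v$3 = w$3"
  by (simp add: vec_eq_iff forall_3)

section \<open>Integration over the sphere\<close>

definition sphere_integral :: "(vec \<Rightarrow> real) \<Rightarrow> real" where
  "sphere_integral f = integral (cbox (0,0) (pi, 2*pi)) (\<lambda>(\<theta>,\<phi>). f (sph \<theta> \<phi>) * sin \<theta>)"

lemma ip_eq_sphere_integral: "ip X Y = sphere_integral (\<lambda>p. X p \<bullet> Y p)"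
  by (simp add: ip_def sphere_integral_def)

lemma S2_iff_inner: "p \<in> S2 \<longleftrightarrow> p \<bullet> p = 1"
  by (simp add: S2_def norm_eq_1)

lemma S2_iff_coords: "p \<in> S2 \<longleftrightarrow> p$1 * p$1 + p$2 * p$2 + p$3 * p$3 = 1"
  by (simp add: S2_iff_inner inner_vec3)

lemma S2_coord_bounds:
  assumes "p \<in> S2"
  shows "-1 \<le> p $ i" "p $ i \<le> 1"
  using assms component_le_norm_cart[of p i] by (simp_all add: S2_def)

lemma sph_in_S2 [simp]: "sph \<theta> \<phi> \<in> S2"
proof -
  have "sin \<theta> * cos \<phi> * (sin \<theta> * cos \<phi>) + sin \<theta> * sin \<phi> * (sin \<theta> * sin \<phi>) + cos \<theta> * cos \<theta>
      = (sin \<theta>)\<^sup>2 * ((sin \<phi>)\<^sup>2 + (cos \<phi>)\<^sup>2) + (cos \<theta>)\<^sup>2"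
    by algebra
  then show ?thesis
    by (simp add: S2_iff_coords sph_def)
qed

lemma S2_eq_sph:
  assumes "p \<in> S2"
  shows "p = sph (arccos (p$3)) (Arg (Complex (p$1) (p$2)))"
proof -
  let ?z = "Complex (p$1) (p$2)"
  have norm: "(p$1)\<^sup>2 + (p$2)\<^sup>2 + (p$3)\<^sup>2 = 1"
    using assms by (simp add: S2_iff_coords power2_eq_square)
  have "sin (arccos (p$3)) = sqrt (1 - (p$3)\<^sup>2)"
    by (rule sin_arccos) (use S2_coord_bounds[OF assms] in auto)
  also have "\<dots> = cmod ?z"
    using norm by (simp add: cmod_def algebra_simps)
  finally have sin: "sin (arccos (p$3)) = cmod ?z" .
  have "?z = rcis (cmod ?z) (Arg ?z)"
    by (simp add: rcis_cmod_Arg)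
  then have "p$1 = cmod ?z * cos (Arg ?z)" "p$2 = cmod ?z * sin (Arg ?z)"
    by (metis Re_rcis complex.sel(1), metis Im_rcis complex.sel(2))
  then show ?thesis
    using sin S2_coord_bounds[OF assms] by (simp add: vec3_eq_iff sph_def)
qed

lemma S2_sphE:
  assumes "p \<in> S2"
  obtains \<theta> \<phi> where "\<theta> \<in> {0..pi}" "\<phi> \<in> {0..2*pi}" "p = sph \<theta> \<phi>"
proof -
  let ?\<theta> = "arccos (p$3)" and ?arg = "Arg (Complex (p$1) (p$2))"
  define \<phi> where "\<phi> = (if ?arg < 0 then ?arg + 2*pi else ?arg)"
  have "?\<theta> \<in> {0..pi}"
    using S2_coord_bounds[OF assms] by (simp add: arccos_lbound arccos_ubound)
  moreover have "\<phi> \<in> {0..2*pi}"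
    using Arg_bounded[of "Complex (p$1) (p$2)"] by (auto simp: \<phi>_def)
  moreover have "sph ?\<theta> \<phi> = sph ?\<theta> ?arg"
    by (simp add: \<phi>_def sph_def)
  ultimately show ?thesis
    using that S2_eq_sph[OF assms] by metis
qed

lemma continuous_on_sph:
  fixes f g :: "'a::t2_space \<Rightarrow> real"
  assumes "continuous_on A f" "continuous_on A g"
  shows "continuous_on A (\<lambda>x. sph (f x) (g x))"
  by (simp add: continuous_on_vec_iff forall_3 sph_def) (auto intro!: continuous_intros assms)

lemma continuous_on_compose_sph:
  fixes f g :: "'a::t2_space \<Rightarrow> real"
  assumes "continuous_on S2 F" "continuous_on A f" "continuous_on A g"
  shows "continuous_on A (\<lambda>x. F (sph (f x) (g x)))"
  by (rule continuous_on_compose2[OF assms(1) continuous_on_sph[OF assms(2,3)]]) auto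

lemma continuous_on_sphere_integrand:
  fixes f :: "vec \<Rightarrow> real"
  assumes "continuous_on S2 f"
  shows "continuous_on A (\<lambda>(\<theta>,\<phi>). f (sph \<theta> \<phi>) * sin \<theta>)"
  unfolding case_prod_unfold by (intro continuous_intros continuous_on_compose_sph[OF assms])

lemma sphere_integral_cong:
  assumes "\<And>p. p \<in> S2 \<Longrightarrow> f p = g p"
  shows "sphere_integral f = sphere_integral g"
  by (simp add: sphere_integral_def assms)

lemma sphere_integral_add:
  assumes "continuous_on S2 f" "continuous_on S2 g"
  shows "sphere_integral (\<lambda>p. f p + g p) = sphere_integral f + sphere_integral g"
  unfolding sphere_integral_def
  by (subst integral_add[symmetric])
     (auto simp: case_prod_unfold distrib_right
       intro!: integrable_continuous continuous_on_sphere_integrand[unfolded case_prod_unfold] assms)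

lemma sphere_integral_cmult: "sphere_integral (\<lambda>p. a * f p) = a * sphere_integral f"
  unfolding sphere_integral_def integral_mult_right[symmetric]
  by (intro arg_cong[where f = "integral _"]) (auto simp: fun_eq_iff)

lemma sphere_integral_uminus: "sphere_integral (\<lambda>p. - f p) = - sphere_integral f"
  using sphere_integral_cmult[of "-1" f] by simp

lemma sphere_integral_diff:
  assumes "continuous_on S2 f" "continuous_on S2 g"
  shows "sphere_integral (\<lambda>p. f p - g p) = sphere_integral f - sphere_integral g"
  using sphere_integral_add[OF assms(1), of "\<lambda>p. - g p"] assms
  by (simp add: sphere_integral_uminus continuous_on_minus)

lemma sphere_integral_nonneg:
  assumes "continuous_on S2 f" "\<And>p. p \<in> S2 \<Longrightarrow> 0 \<le> f p"
  shows "0 \<le> sphere_integral f"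
  unfolding sphere_integral_def
  by (rule integral_nonneg[OF integrable_continuous[OF continuous_on_sphere_integrand[OF assms(1)]]])
     (auto simp: cbox_Pair_eq intro!: mult_nonneg_nonneg assms(2) sin_ge_zero)

text \<open>The area density vanishes at the poles, so there the conclusion needs continuity along a meridian.\<close>

lemma sphere_integral_eq_0_imp:
  assumes cont: "continuous_on S2 f" and nonneg: "\<And>p. p \<in> S2 \<Longrightarrow> 0 \<le> f p"
    and zero: "sphere_integral f = 0" and "p \<in> S2"
  shows "f p = (0::real)"
proof -
  let ?I = "\<lambda>(\<theta>,\<phi>). f (sph \<theta> \<phi>) * sin \<theta>" and ?C = "cbox (0::real,0::real) (pi, 2*pi)"
  have contI: "continuous_on ?C ?I"
    by (rule continuous_on_sphere_integrand[OF cont])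
  have integral: "(?I has_integral 0) ?C"
    using integrable_integral[OF integrable_continuous[OF contI]] zero by (simp add: sphere_integral_def)
  have "0 \<le> ?I x" if "x \<in> box (0,0) (pi, 2*pi)" for x
    using that by (cases x) (auto simp: mem_box Basis_prod_def intro!: mult_nonneg_nonneg nonneg sin_ge_zero)
  moreover have "box (0::real,0::real) (pi, 2*pi) \<noteq> {}"
    by (auto simp: box_ne_empty Basis_prod_def)
  ultimately have vanish: "?I x = 0" if "x \<in> ?C" for x
    using has_integral_0_cbox_imp_0[OF contI _ integral] that by blast
  obtain \<theta> \<phi> where angles: "\<theta> \<in> {0..pi}" "\<phi> \<in> {0..2*pi}" "p = sph \<theta> \<phi>"
    using S2_sphE[OF \<open>p \<in> S2\<close>] .
  have "f (sph t \<phi>) = 0" if "t \<in> {0<..<pi}" for t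
    using vanish[of "(t,\<phi>)"] that angles sin_gt_zero[of t] by (auto simp: cbox_Pair_eq)
  moreover have "continuous_on (closure {0<..<pi}) (\<lambda>t. f (sph t \<phi>))"
    by (intro continuous_on_compose_sph[OF cont] continuous_intros)
  moreover have "\<theta> \<in> closure {0<..<pi}"
    using angles by simp
  ultimately show ?thesis
    using continuous_constant_on_closure[of "{0<..<pi}" "\<lambda>t. f (sph t \<phi>)" 0 \<theta>] angles by auto
qed

lemma pderiv_sum: "pderiv (\<Sum>i\<in>A. f i) = (\<Sum>i\<in>A. pderiv (f i))"
  by (induction A rule: infinite_finite_induct) (auto simp: pderiv_add)

lemma ex_pderiv_eq:
  fixes q :: "'a::{field_char_0} poly"
  shows "\<exists>Q. pderiv Q = q"
proof
  have "pderiv (\<Sum>i\<le>degree q. monom (coeff q i / of_nat (Suc i)) (Suc i)) = (\<Sum>i\<le>degree q. monom (coeff q i) i)"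
    by (simp add: pderiv_sum pderiv_monom del: of_nat_Suc)
  then show "pderiv (\<Sum>i\<le>degree q. monom (coeff q i / of_nat (Suc i)) (Suc i)) = q"
    by (simp only: poly_as_sum_of_monoms)
qed

lemma sphere_integral_poly_height:
  "sphere_integral (\<lambda>p. poly (pderiv Q) (p$3)) = 2 * pi * (poly Q 1 - poly Q (-1))"
proof -
  let ?f = "\<lambda>\<theta>. poly (pderiv Q) (cos \<theta>) * sin \<theta>"
  have "((\<lambda>t. - poly Q (cos t)) has_vector_derivative ?f t) (at t within {0..pi})" for t
    unfolding has_real_derivative_iff_has_vector_derivative[symmetric]
    by (auto intro!: derivative_eq_intros)
  then have "(?f has_integral (- poly Q (cos pi) - - poly Q (cos 0))) {0..pi}"
    by (intro fundamental_theorem_of_calculus) auto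
  then have meridian: "integral {0..pi} ?f = poly Q 1 - poly Q (-1)"
    by (auto dest!: integral_unique)
  have "sphere_integral (\<lambda>p. poly (pderiv Q) (p$3)) = integral (cbox (0,0) (pi, 2*pi)) (\<lambda>(\<theta>,\<phi>). ?f \<theta>)"
    by (simp add: sphere_integral_def sph_def)
  also have "\<dots> = integral (cbox 0 pi) (\<lambda>\<theta>. integral (cbox 0 (2*pi)) (\<lambda>\<phi>. ?f \<theta>))"
    by (subst integral_prod_continuous) (auto intro!: continuous_intros simp: case_prod_unfold)
  also have "\<dots> = integral {0..pi} (\<lambda>\<theta>. 2 * pi * ?f \<theta>)"
    unfolding cbox_interval by (rule integral_cong) simp
  also have "\<dots> = 2 * pi * (poly Q 1 - poly Q (-1))"
    unfolding integral_mult_right meridian ..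
  finally show ?thesis .
qed

section \<open>The divergence theorem on the sphere\<close>

definition C1_on_S2 :: "(vec \<Rightarrow> 'a::real_normed_vector) \<Rightarrow> (vec \<Rightarrow> vec \<Rightarrow> 'a) \<Rightarrow> bool" where
  "C1_on_S2 F F' \<longleftrightarrow> (\<forall>p\<in>S2. (F has_derivative F' p) (at p)) \<and> (\<forall>v. continuous_on S2 (\<lambda>p. F' p v))"

lemma C1_on_S2_has_derivative: "C1_on_S2 F F' \<Longrightarrow> p \<in> S2 \<Longrightarrow> (F has_derivative F' p) (at p)"
  by (simp add: C1_on_S2_def)

lemma C1_on_S2_linear: "C1_on_S2 F F' \<Longrightarrow> p \<in> S2 \<Longrightarrow> linear (F' p)"
  by (rule has_derivative_linear[OF C1_on_S2_has_derivative])

lemma C1_on_S2_continuous_on: "C1_on_S2 F F' \<Longrightarrow> continuous_on S2 F"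
  by (meson C1_on_S2_def continuous_at_imp_continuous_on has_derivative_continuous)

lemma C1_on_S2_continuous_on_derivative: "C1_on_S2 F F' \<Longrightarrow> continuous_on S2 (\<lambda>p. F' p v)"
  by (simp add: C1_on_S2_def)

lemma C1_on_S2_continuous_on_apply:
  assumes "C1_on_S2 F F'" "continuous_on S2 X"
  shows "continuous_on S2 (\<lambda>p. F' p (X p))"
proof -
  have "continuous_on S2 (\<lambda>p. \<Sum>i\<in>UNIV. X p $ i *\<^sub>R F' p (axis i 1))"
    by (intro continuous_intros assms(2) C1_on_S2_continuous_on_derivative[OF assms(1)])
  moreover have "F' p (X p) = (\<Sum>i\<in>UNIV. X p $ i *\<^sub>R F' p (axis i 1))" if "p \<in> S2" for p
    by (rule linear_axis_expansion[OF C1_on_S2_linear[OF assms(1) that]])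
  ultimately show ?thesis
    using continuous_on_cong[OF refl, of S2 "\<lambda>p. F' p (X p)"] by simp
qed

lemma C1_on_S2_scaleR:
  assumes "C1_on_S2 f f'" "C1_on_S2 F F'"
  shows "C1_on_S2 (\<lambda>p. f p *\<^sub>R F p) (\<lambda>p v. f p *\<^sub>R F' p v + f' p v *\<^sub>R F p)"
  using C1_on_S2_continuous_on[OF assms(1)] C1_on_S2_continuous_on[OF assms(2)] assms
  by (auto simp: C1_on_S2_def intro!: has_derivative_scaleR continuous_intros)

lemma C1_on_S2_inner:
  fixes F G :: "vec \<Rightarrow> vec"
  assumes "C1_on_S2 F F'" "C1_on_S2 G G'"
  shows "C1_on_S2 (\<lambda>p. F p \<bullet> G p) (\<lambda>p v. F p \<bullet> G' p v + F' p v \<bullet> G p)"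
  using C1_on_S2_continuous_on[OF assms(1)] C1_on_S2_continuous_on[OF assms(2)] assms
  by (auto simp: C1_on_S2_def intro!: has_derivative_inner continuous_intros)

definition ephi :: "real \<Rightarrow> vec" where
  "ephi \<phi> = vector [- sin \<phi>, cos \<phi>, 0]"

lemma dph_eq_ephi: "dph \<theta> \<phi> = sin \<theta> *\<^sub>R ephi \<phi>"
  by (simp add: dph_def ephi_def vec3_eq_iff)

lemma continuous_on_dth:
  fixes f g :: "'a::t2_space \<Rightarrow> real"
  assumes "continuous_on A f" "continuous_on A g"
  shows "continuous_on A (\<lambda>x. dth (f x) (g x))"
  by (simp add: continuous_on_vec_iff forall_3 dth_def) (auto intro!: continuous_intros assms)

lemma continuous_on_ephi:
  fixes f :: "'a::t2_space \<Rightarrow> real"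
  assumes "continuous_on A f"
  shows "continuous_on A (\<lambda>x. ephi (f x))"
  by (simp add: continuous_on_vec_iff forall_3 ephi_def) (auto intro!: continuous_intros assms)

lemma has_vector_derivative_vec3I:
  fixes f :: "real \<Rightarrow> vec"
  assumes "((\<lambda>t. f t $ 1) has_real_derivative f' $ 1) F" "((\<lambda>t. f t $ 2) has_real_derivative f' $ 2) F"
    "((\<lambda>t. f t $ 3) has_real_derivative f' $ 3) F"
  shows "(f has_vector_derivative f') F"
  unfolding has_vector_derivative_def
proof (rule has_derivative_vecI)
  fix i :: 3
  show "((\<lambda>t. f t $ i) has_derivative (\<lambda>v. (v *\<^sub>R f') $ i)) F"
    using assms exhaust_3[of i] by (auto simp: has_field_derivative_def mult.commute[of _ "f' $ _"])
qed

lemma has_vector_derivative_sph_theta: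
  "((\<lambda>t. sph t \<phi>) has_vector_derivative dth \<theta> \<phi>) (at \<theta>)"
  by (rule has_vector_derivative_vec3I) (auto simp: sph_def dth_def intro!: derivative_eq_intros)

lemma has_vector_derivative_sph_phi:
  "((\<lambda>t. sph \<theta> t) has_vector_derivative dph \<theta> \<phi>) (at \<phi>)"
  by (rule has_vector_derivative_vec3I) (auto simp: sph_def dph_def intro!: derivative_eq_intros)

lemma has_vector_derivative_dth_theta:
  "((\<lambda>t. dth t \<phi>) has_vector_derivative - sph \<theta> \<phi>) (at \<theta>)"
  by (rule has_vector_derivative_vec3I) (auto simp: sph_def dth_def intro!: derivative_eq_intros)

lemma has_vector_derivative_ephi:
  "(ephi has_vector_derivative - (cos \<theta> *\<^sub>R dth \<theta> \<phi> + sin \<theta> *\<^sub>R sph \<theta> \<phi>)) (at \<phi>)"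
proof -
  have pythagoras: "cos \<theta> * (cos \<theta> * x) + sin \<theta> * (sin \<theta> * x) = x" for x
    using sin_cos_squared_add[of \<theta>] by algebra
  show ?thesis
    using pythagoras[of "cos \<phi>"] pythagoras[of "sin \<phi>"]
    by (intro has_vector_derivative_vec3I)
       (auto simp: ephi_def sph_def dth_def algebra_simps intro!: derivative_eq_intros)
qed

lemma has_vector_derivative_compose_sph:
  assumes "\<And>p. p \<in> S2 \<Longrightarrow> (F has_derivative F' p) (at p)"
  shows "((\<lambda>t. F (sph t \<phi>)) has_vector_derivative F' (sph \<theta> \<phi>) (dth \<theta> \<phi>)) (at \<theta>)"
    and "((\<lambda>t. F (sph \<theta> t)) has_vector_derivative F' (sph \<theta> \<phi>) (dph \<theta> \<phi>)) (at \<phi>)"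
proof -
  note F = has_derivative_at_withinI[OF assms[OF sph_in_S2]]
  show "((\<lambda>t. F (sph t \<phi>)) has_vector_derivative F' (sph \<theta> \<phi>) (dth \<theta> \<phi>)) (at \<theta>)"
    using vector_derivative_diff_chain_within[OF has_vector_derivative_sph_theta F] by (simp add: o_def)
  show "((\<lambda>t. F (sph \<theta> t)) has_vector_derivative F' (sph \<theta> \<phi>) (dph \<theta> \<phi>)) (at \<phi>)"
    using vector_derivative_diff_chain_within[OF has_vector_derivative_sph_phi F] by (simp add: o_def)
qed

definition tangential_trace :: "vec \<Rightarrow> (vec \<Rightarrow> vec) \<Rightarrow> real" where
  "tangential_trace p f = (\<Sum>i\<in>UNIV. f (axis i 1) $ i) - p \<bullet> f p"

lemma sdiv_eq_tangential_trace: "sdiv X p = tangential_trace p (Dv X p)"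
  by (simp add: sdiv_def tangential_trace_def)

lemma tangential_trace_spherical_frame:
  assumes "linear f"
  shows "tangential_trace (sph \<theta> \<phi>) f = f (dth \<theta> \<phi>) \<bullet> dth \<theta> \<phi> + f (ephi \<phi>) \<bullet> ephi \<phi>"
proof -
  have \<theta>: "sin \<theta> * sin \<theta> = 1 - cos \<theta> * cos \<theta>" and \<phi>: "sin \<phi> * sin \<phi> = 1 - cos \<phi> * cos \<phi>"
    using sin_cos_squared_add[of \<theta>] sin_cos_squared_add[of \<phi>] by (simp_all add: power2_eq_square)
  have \<theta>': "sin \<theta> * (sin \<theta> * a) = a - cos \<theta> * cos \<theta> * a"
    and \<phi>': "sin \<phi> * (sin \<phi> * a) = a - cos \<phi> * cos \<phi> * a" for a
    using \<theta> \<phi> by (simp_all add: mult.assoc[symmetric] left_diff_distrib)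
  show ?thesis
    unfolding tangential_trace_def linear_axis_expansion[OF assms, of "sph \<theta> \<phi>"]
      linear_axis_expansion[OF assms, of "dth \<theta> \<phi>"]
      linear_axis_expansion[OF assms, of "ephi \<phi>"]
    by (simp add: sph_def dth_def ephi_def inner_vec3 sum_3 algebra_simps \<theta> \<phi> \<theta>' \<phi>')
qed

lemma has_integral_theta_derivative:
  fixes a a' :: "real \<Rightarrow> real \<Rightarrow> real"
  assumes deriv: "\<And>\<theta> \<phi>. ((\<lambda>t. a t \<phi>) has_vector_derivative a' \<theta> \<phi>) (at \<theta>)"
    and cont: "continuous_on (cbox (0,0) (pi,2*pi)) (\<lambda>(\<theta>,\<phi>). a' \<theta> \<phi>)"
    and ends: "\<And>\<phi>. a pi \<phi> = a 0 \<phi>"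
  shows "((\<lambda>(\<theta>,\<phi>). a' \<theta> \<phi>) has_integral 0) (cbox (0,0) (pi,2*pi))"
proof -
  have "((\<lambda>t. a' t \<phi>) has_integral (a pi \<phi> - a 0 \<phi>)) {0..pi}" for \<phi>
    by (rule fundamental_theorem_of_calculus) (auto intro: deriv has_vector_derivative_at_within)
  then have "integral (cbox 0 pi) (\<lambda>t. a' t \<phi>) = 0" for \<phi>
    using ends by (metis cbox_interval diff_self integral_unique)
  then show ?thesis
    using integral_prod_continuous[OF cont] integral_swap_continuous[OF cont]
      integrable_integral[OF integrable_continuous[OF cont]] by simp
qed

lemma has_integral_phi_derivative:
  fixes b b' :: "real \<Rightarrow> real \<Rightarrow> real"
  assumes deriv: "\<And>\<theta> \<phi>. ((\<lambda>t. b \<theta> t) has_vector_derivative b' \<theta> \<phi>) (at \<phi>)"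
    and cont: "continuous_on (cbox (0,0) (pi,2*pi)) (\<lambda>(\<theta>,\<phi>). b' \<theta> \<phi>)"
    and ends: "\<And>\<theta>. b \<theta> (2*pi) = b \<theta> 0"
  shows "((\<lambda>(\<theta>,\<phi>). b' \<theta> \<phi>) has_integral 0) (cbox (0,0) (pi,2*pi))"
proof -
  have "((\<lambda>t. b' \<theta> t) has_integral (b \<theta> (2*pi) - b \<theta> 0)) {0..2*pi}" for \<theta>
    by (rule fundamental_theorem_of_calculus) (auto intro: deriv has_vector_derivative_at_within)
  then have "integral (cbox 0 (2*pi)) (\<lambda>t. b' \<theta> t) = 0" for \<theta>
    using ends by (metis cbox_interval diff_self integral_unique)
  then show ?thesis
    using integral_prod_continuous[OF cont] integrable_integral[OF integrable_continuous[OF cont]] by simp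
qed

lemma has_integral_theta_flux:
  fixes F :: "vec \<Rightarrow> vec"
  assumes C1: "C1_on_S2 F F'"
  shows "((\<lambda>(\<theta>,\<phi>). cos \<theta> * (F (sph \<theta> \<phi>) \<bullet> dth \<theta> \<phi>)
      + sin \<theta> * (F' (sph \<theta> \<phi>) (dth \<theta> \<phi>) \<bullet> dth \<theta> \<phi> - F (sph \<theta> \<phi>) \<bullet> sph \<theta> \<phi>)) has_integral 0)
    (cbox (0,0) (pi, 2*pi))"
proof (rule has_integral_theta_derivative)
  show "((\<lambda>t. sin t * (F (sph t \<phi>) \<bullet> dth t \<phi>)) has_vector_derivative cos \<theta> * (F (sph \<theta> \<phi>) \<bullet> dth \<theta> \<phi>)
      + sin \<theta> * (F' (sph \<theta> \<phi>) (dth \<theta> \<phi>) \<bullet> dth \<theta> \<phi> - F (sph \<theta> \<phi>) \<bullet> sph \<theta> \<phi>)) (at \<theta>)" for \<theta> \<phi>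
    using has_vector_derivative_compose_sph(1)[OF C1_on_S2_has_derivative[OF C1], of \<phi> \<theta>]
      has_vector_derivative_dth_theta[of \<phi> \<theta>]
    unfolding has_vector_derivative_def
    by (auto intro!: derivative_eq_intros simp: algebra_simps inner_commute)
  show "continuous_on (cbox (0,0) (pi,2*pi)) (\<lambda>(\<theta>,\<phi>). cos \<theta> * (F (sph \<theta> \<phi>) \<bullet> dth \<theta> \<phi>)
      + sin \<theta> * (F' (sph \<theta> \<phi>) (dth \<theta> \<phi>) \<bullet> dth \<theta> \<phi> - F (sph \<theta> \<phi>) \<bullet> sph \<theta> \<phi>))"
    unfolding linear_axis_expansion[OF C1_on_S2_linear[OF C1 sph_in_S2], of _ _ "dth _ _"] case_prod_unfold
    by (intro continuous_intros continuous_on_sph continuous_on_dth continuous_on_compose_sph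
        C1_on_S2_continuous_on[OF C1] C1_on_S2_continuous_on_derivative[OF C1])
qed simp

lemma has_integral_phi_flux:
  fixes F :: "vec \<Rightarrow> vec"
  assumes C1: "C1_on_S2 F F'"
  shows "((\<lambda>(\<theta>,\<phi>). sin \<theta> * (F' (sph \<theta> \<phi>) (ephi \<phi>) \<bullet> ephi \<phi>)
      - F (sph \<theta> \<phi>) \<bullet> (cos \<theta> *\<^sub>R dth \<theta> \<phi> + sin \<theta> *\<^sub>R sph \<theta> \<phi>)) has_integral 0) (cbox (0,0) (pi, 2*pi))"
proof (rule has_integral_phi_derivative)
  show "((\<lambda>t. F (sph \<theta> t) \<bullet> ephi t) has_vector_derivative sin \<theta> * (F' (sph \<theta> \<phi>) (ephi \<phi>) \<bullet> ephi \<phi>)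
      - F (sph \<theta> \<phi>) \<bullet> (cos \<theta> *\<^sub>R dth \<theta> \<phi> + sin \<theta> *\<^sub>R sph \<theta> \<phi>)) (at \<phi>)" for \<theta> \<phi>
    using has_vector_derivative_compose_sph(2)[OF C1_on_S2_has_derivative[OF C1], of \<theta> \<phi>]
      has_vector_derivative_ephi[of \<theta> \<phi>]
    unfolding has_vector_derivative_def dph_eq_ephi linear_scale[OF C1_on_S2_linear[OF C1 sph_in_S2]]
    by (auto intro!: derivative_eq_intros simp: algebra_simps)
  show "continuous_on (cbox (0,0) (pi,2*pi)) (\<lambda>(\<theta>,\<phi>). sin \<theta> * (F' (sph \<theta> \<phi>) (ephi \<phi>) \<bullet> ephi \<phi>)
      - F (sph \<theta> \<phi>) \<bullet> (cos \<theta> *\<^sub>R dth \<theta> \<phi> + sin \<theta> *\<^sub>R sph \<theta> \<phi>))"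
    unfolding linear_axis_expansion[OF C1_on_S2_linear[OF C1 sph_in_S2], of _ _ "ephi _"] case_prod_unfold
    by (intro continuous_intros continuous_on_sph continuous_on_dth continuous_on_ephi continuous_on_compose_sph
        C1_on_S2_continuous_on[OF C1] C1_on_S2_continuous_on_derivative[OF C1])
qed (simp add: sph_def ephi_def)

theorem sphere_divergence:
  fixes F :: "vec \<Rightarrow> vec"
  assumes C1: "C1_on_S2 F F'" and tangent: "\<And>p. p \<in> S2 \<Longrightarrow> F p \<bullet> p = 0"
  shows "sphere_integral (\<lambda>p. tangential_trace p (F' p)) = 0"
proof -
  have "tangential_trace (sph \<theta> \<phi>) (F' (sph \<theta> \<phi>)) * sin \<theta>
      = (cos \<theta> * (F (sph \<theta> \<phi>) \<bullet> dth \<theta> \<phi>)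
          + sin \<theta> * (F' (sph \<theta> \<phi>) (dth \<theta> \<phi>) \<bullet> dth \<theta> \<phi> - F (sph \<theta> \<phi>) \<bullet> sph \<theta> \<phi>))
        + (sin \<theta> * (F' (sph \<theta> \<phi>) (ephi \<phi>) \<bullet> ephi \<phi>)
          - F (sph \<theta> \<phi>) \<bullet> (cos \<theta> *\<^sub>R dth \<theta> \<phi> + sin \<theta> *\<^sub>R sph \<theta> \<phi>))" for \<theta> \<phi>
    by (simp add: tangential_trace_spherical_frame[OF C1_on_S2_linear[OF C1]] tangent inner_add_right
        algebra_simps)
  then show ?thesis
    using has_integral_add[OF has_integral_theta_flux[OF C1] has_integral_phi_flux[OF C1]]
    by (simp add: sphere_integral_def case_prod_unfold integral_unique)
qed

section \<open>Vector fields on the sphere\<close>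

definition eq_S2 :: "vf \<Rightarrow> vf \<Rightarrow> bool"  (infix \<open>\<simeq>\<close> 50) where
  "X \<simeq> Y \<longleftrightarrow> (\<forall>p\<in>S2. X p = Y p)"

lemma eq_S2_refl [simp]: "X \<simeq> X"
  by (simp add: eq_S2_def)

lemma eq_S2_trans [trans]: "X \<simeq> Y \<Longrightarrow> Y \<simeq> Z \<Longrightarrow> X \<simeq> Z"
  by (simp add: eq_S2_def)

lemma eq_S2_ext: "X \<simeq> Y \<Longrightarrow> ext X = ext Y"
  by (simp add: ext_def smooth_ext_def eq_S2_def)

lemma eq_S2_Dv: "X \<simeq> Y \<Longrightarrow> Dv X = Dv Y"
  by (simp add: Dv_def[abs_def] eq_S2_ext)

lemma eq_S2_br: "X \<simeq> X' \<Longrightarrow> Y \<simeq> Y' \<Longrightarrow> br X Y \<simeq> br X' Y'"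
  using eq_S2_Dv[of X X'] eq_S2_Dv[of Y Y'] by (auto simp: br_def eq_S2_def)

lemma eq_S2_ip: "X \<simeq> X' \<Longrightarrow> Y \<simeq> Y' \<Longrightarrow> ip X Y = ip X' Y'"
  unfolding ip_eq_sphere_integral by (rule sphere_integral_cong) (simp add: eq_S2_def)

lemma eq_S2_Bop:
  assumes "X \<simeq> X'" "Y \<simeq> Y'"
  shows "Bop g X Y = Bop g X' Y'"
proof -
  have "ip X (br Y w) = ip X' (br Y' w)" for w
    by (intro eq_S2_ip eq_S2_br assms eq_S2_refl)
  then show ?thesis
    by (simp add: Bop_def)
qed

lemma ip_commute: "ip X Y = ip Y X"
  by (simp add: ip_def inner_commute)

lemma ip_add_left:
  assumes "continuous_on S2 X" "continuous_on S2 Y" "continuous_on S2 Z"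
  shows "ip (\<lambda>p. X p + Y p) Z = ip X Z + ip Y Z"
  unfolding ip_eq_sphere_integral inner_add_left
  by (intro sphere_integral_add continuous_intros assms)

lemma ip_scaleR_left: "ip (\<lambda>p. a *\<^sub>R X p) Z = a * ip X Z"
  unfolding ip_eq_sphere_integral by (simp add: sphere_integral_cmult)

lemma ip_diff_left:
  assumes "continuous_on S2 X" "continuous_on S2 Y" "continuous_on S2 Z"
  shows "ip (\<lambda>p. X p - Y p) Z = ip X Z - ip Y Z"
  unfolding ip_eq_sphere_integral inner_diff_left
  by (intro sphere_integral_diff continuous_intros assms)

lemma ip_zero_left [simp]: "ip (\<lambda>p. 0) Y = 0"
  using ip_scaleR_left[of 0 "\<lambda>p. 0" Y] by simp

lemma ip_self_nonneg: "continuous_on S2 X \<Longrightarrow> 0 \<le> ip X X"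
  unfolding ip_eq_sphere_integral by (rule sphere_integral_nonneg) (auto intro!: continuous_intros)

lemma ip_self_eq_0_imp:
  assumes "continuous_on S2 X" "ip X X = 0"
  shows "X \<simeq> (\<lambda>p. 0)"
  unfolding eq_S2_def
proof
  fix p assume p: "p \<in> S2"
  have "X p \<bullet> X p = 0"
    by (rule sphere_integral_eq_0_imp[OF _ _ _ p])
       (use assms in \<open>auto simp: ip_eq_sphere_integral intro!: continuous_intros\<close>)
  then show "X p = 0" by simp
qed

text \<open>Every tangent vector is the velocity of a great circle, on which the two extensions agree.\<close>

lemma tangential_derivative_unique:
  fixes F G :: vf
  assumes F: "(F has_derivative F') (at p)" and G: "(G has_derivative G') (at p)"
    and "F \<simeq> G" "p \<in> S2" "t \<bullet> p = 0"
  shows "F' t = G' t"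
proof (cases "t = 0")
  case True
  then show ?thesis
    using linear_0[OF has_derivative_linear[OF F]] linear_0[OF has_derivative_linear[OF G]] by simp
next
  case False
  define s where "s = t /\<^sub>R norm t"
  define circle where "circle r = cos r *\<^sub>R p + sin r *\<^sub>R s" for r :: real
  have frame: "s \<bullet> s = 1" "s \<bullet> p = 0" "p \<bullet> s = 0" "p \<bullet> p = 1"
    using False assms(4,5) inner_commute[of p t]
    by (simp_all add: s_def dot_square_norm power2_eq_square S2_iff_inner)
  have "circle r \<in> S2" for r
    using frame sin_cos_squared_add[of r]
    by (simp add: S2_iff_inner circle_def inner_add_left inner_add_right power2_eq_square)
  then have agree: "(\<lambda>r. F (circle r)) = (\<lambda>r. G (circle r))"
    using assms(3) by (auto simp: eq_S2_def)
  have velocity: "(circle has_vector_derivative s) (at 0)" and start: "circle 0 = p"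
    unfolding circle_def[abs_def] has_vector_derivative_def by (auto intro!: derivative_eq_intros)
  have "((\<lambda>r. F (circle r)) has_vector_derivative F' s) (at 0)"
    "((\<lambda>r. G (circle r)) has_vector_derivative G' s) (at 0)"
    using vector_derivative_diff_chain_within[OF velocity, of F F'] F
      vector_derivative_diff_chain_within[OF velocity, of G G'] G
    by (simp_all add: o_def has_derivative_at_withinI start)
  then have "F' s = G' s"
    unfolding agree by (rule vector_derivative_unique_at)
  moreover have "t = norm t *\<^sub>R s"
    using False by (simp add: s_def)
  ultimately show ?thesis
    using linear_scale[OF has_derivative_linear[OF F]] linear_scale[OF has_derivative_linear[OF G]] by metis
qed

lemma tangential_trace_eq_sum_projections:
  assumes "linear f" "p \<in> S2"
  shows "tangential_trace p f = (\<Sum>i\<in>UNIV. (axis i 1 - p $ i *\<^sub>R p) \<bullet> f (axis i 1 - p $ i *\<^sub>R p))"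
proof -
  have expand: "p \<bullet> f p = (\<Sum>i\<in>UNIV. p $ i * (p \<bullet> f (axis i 1)))"
    by (subst linear_axis_expansion[OF assms(1), of p]) (simp add: inner_sum_right)
  have dot_eq_sum: "p \<bullet> v = (\<Sum>i\<in>UNIV. p $ i * v $ i)" for v
    by (simp add: inner_vec_def)
  have "(axis i 1 - p $ i *\<^sub>R p) \<bullet> f (axis i 1 - p $ i *\<^sub>R p)
      = f (axis i 1) $ i - p $ i * f p $ i - p $ i * (p \<bullet> f (axis i 1)) + p $ i * p $ i * (p \<bullet> f p)" for i
    by (simp add: linear_diff[OF assms(1)] linear_scale[OF assms(1)] inner_diff_left inner_diff_right
        inner_axis' algebra_simps)
  then have "(\<Sum>i\<in>UNIV. (axis i 1 - p $ i *\<^sub>R p) \<bullet> f (axis i 1 - p $ i *\<^sub>R p))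
      = (\<Sum>i\<in>UNIV. f (axis i 1) $ i) - p \<bullet> f p - p \<bullet> f p + p \<bullet> p * (p \<bullet> f p)"
    by (simp add: sum.distrib sum_subtractf expand[symmetric] dot_eq_sum[symmetric] sum_distrib_right[symmetric])
  then show ?thesis
    using assms(2) by (simp add: tangential_trace_def S2_iff_inner)
qed

lemma tangential_projection: "p \<in> S2 \<Longrightarrow> (axis i 1 - p $ i *\<^sub>R p) \<bullet> p = 0"
  by (simp add: inner_diff_left inner_axis' S2_iff_inner)

lemma tangential_trace_leibniz:
  assumes "linear d"
  shows "tangential_trace p (\<lambda>v. a *\<^sub>R f v + d v *\<^sub>R x) = a * tangential_trace p f + d x - d p * (p \<bullet> x)"
proof -
  have "d x = (\<Sum>i\<in>UNIV. x $ i * d (axis i 1))"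
    by (subst linear_axis_expansion[OF assms]) simp
  then show ?thesis
    by (simp add: tangential_trace_def sum.distrib sum_distrib_left inner_add_right algebra_simps)
qed

lemma smooth_ext_C1:
  assumes "smooth_ext X F"
  shows "C1_on_S2 (ext X) (Dv X)" "ext X \<simeq> X"
proof -
  have "smooth_ext X (ext X)"
    using someI[of "smooth_ext X", OF assms] by (simp add: ext_def)
  then obtain U where U: "open U" "S2 \<subseteq> U" "smooth_on U (ext X)" and eq: "\<forall>p\<in>S2. ext X p = X p"
    by (auto simp: smooth_ext_def)
  from U(3) obtain S where S: "ext X \<in> S"
    "\<And>g. g \<in> S \<Longrightarrow> g differentiable_on U \<and> (\<forall>v. (\<lambda>x. frechet_derivative g (at x) v) \<in> S)"
    unfolding smooth_on_def by blast
  have "(ext X has_derivative Dv X p) (at p)" if "p \<in> S2" for p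
  proof -
    have "ext X differentiable (at p)"
      using S U that by (meson differentiable_on_eq_differentiable_at subsetD)
    then show ?thesis
      by (simp add: Dv_def[abs_def] frechet_derivative_works)
  qed
  moreover have "continuous_on S2 (\<lambda>p. Dv X p v)" for v
  proof -
    have "(\<lambda>p. Dv X p v) differentiable_on U"
      unfolding Dv_def using S by blast
    then show ?thesis
      using U(2) continuous_on_subset differentiable_imp_continuous_on by blast
  qed
  ultimately show "C1_on_S2 (ext X) (Dv X)"
    by (simp add: C1_on_S2_def)
  show "ext X \<simeq> X"
    using eq by (simp add: eq_S2_def)
qed

lemma Dv_eq:
  assumes "smooth_ext X F" "C1_on_S2 F F'" "p \<in> S2" "t \<bullet> p = 0"
  shows "Dv X p t = F' p t"
proof -
  have "ext X \<simeq> F"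
    using smooth_ext_C1(2)[OF assms(1)] assms(1) by (auto simp: smooth_ext_def eq_S2_def)
  then show ?thesis
    by (rule tangential_derivative_unique[OF C1_on_S2_has_derivative[OF smooth_ext_C1(1)[OF assms(1)] assms(3)]
          C1_on_S2_has_derivative[OF assms(2,3)] _ assms(3,4)])
qed

lemma sdiv_eq:
  assumes "smooth_ext X F" "C1_on_S2 F F'" "p \<in> S2"
  shows "sdiv X p = tangential_trace p (F' p)"
  unfolding sdiv_eq_tangential_trace
    tangential_trace_eq_sum_projections[OF C1_on_S2_linear[OF smooth_ext_C1(1)[OF assms(1)] assms(3)] assms(3)]
    tangential_trace_eq_sum_projections[OF C1_on_S2_linear[OF assms(2,3)] assms(3)]
  by (simp add: Dv_eq[OF assms] tangential_projection[OF assms(3)])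

lemma sdiff_S2_C1:
  assumes "X \<in> sdiff_S2"
  shows "C1_on_S2 (ext X) (Dv X)" "ext X \<simeq> X"
  using assms smooth_ext_C1 by (auto simp: sdiff_S2_def)

lemma sdiff_S2_tangent: "X \<in> sdiff_S2 \<Longrightarrow> p \<in> S2 \<Longrightarrow> X p \<bullet> p = 0"
  by (simp add: sdiff_S2_def)

lemma sdiff_S2_continuous_on:
  assumes "X \<in> sdiff_S2"
  shows "continuous_on S2 X"
  using C1_on_S2_continuous_on[OF sdiff_S2_C1(1)[OF assms]] sdiff_S2_C1(2)[OF assms]
    continuous_on_cong[of S2 S2 "ext X" X] by (simp add: eq_S2_def)

lemma sphere_integral_derivative_along:
  fixes f :: "vec \<Rightarrow> real"
  assumes f: "C1_on_S2 f f'" and w: "w \<in> sdiff_S2"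
  shows "sphere_integral (\<lambda>p. f' p (w p)) = 0"
proof -
  have w_S2: "ext w p = w p" "w p \<bullet> p = 0" "tangential_trace p (Dv w p) = 0" if "p \<in> S2" for p
    using that w sdiff_S2_C1(2)[OF w]
    by (auto simp: eq_S2_def sdiff_S2_def sdiv_eq_tangential_trace)
  have "sphere_integral (\<lambda>p. tangential_trace p (\<lambda>v. f p *\<^sub>R Dv w p v + f' p v *\<^sub>R ext w p)) = 0"
    by (rule sphere_divergence[OF C1_on_S2_scaleR[OF f sdiff_S2_C1(1)[OF w]]]) (simp add: w_S2)
  moreover have "tangential_trace p (\<lambda>v. f p *\<^sub>R Dv w p v + f' p v *\<^sub>R ext w p) = f' p (w p)" if "p \<in> S2" for p
    using w_S2[OF that]
    by (simp add: tangential_trace_leibniz[OF C1_on_S2_linear[OF f that]] inner_commute)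
  ultimately show ?thesis
    by (simp cong: sphere_integral_cong)
qed

text \<open>Exterior derivative of the one-form dual to u, evaluated on v and w; the terms v(u, w) and w(u, v)
  of the invariant formula integrate to zero.\<close>

lemma ip_br:
  assumes u: "u \<in> sdiff_S2" and v: "v \<in> sdiff_S2" and w: "w \<in> sdiff_S2"
  shows "ip u (br v w) = - sphere_integral (\<lambda>p. Dv u p (v p) \<bullet> w p - Dv u p (w p) \<bullet> v p)"
proof -
  note C1 = sdiff_S2_C1(1)[OF u] sdiff_S2_C1(1)[OF v] sdiff_S2_C1(1)[OF w]
  note cont = sdiff_S2_continuous_on[OF u] sdiff_S2_continuous_on[OF v] sdiff_S2_continuous_on[OF w]
    C1[THEN C1_on_S2_continuous_on] C1[THEN C1_on_S2_continuous_on_apply]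
  let ?vuw = "\<lambda>p. ext u p \<bullet> Dv w p (v p) + Dv u p (v p) \<bullet> ext w p"
  let ?wuv = "\<lambda>p. ext u p \<bullet> Dv v p (w p) + Dv u p (w p) \<bullet> ext v p"
  let ?du = "\<lambda>p. Dv u p (v p) \<bullet> w p - Dv u p (w p) \<bullet> v p"
  have "ip u (br v w) = sphere_integral (\<lambda>p. (?vuw p - ?wuv p) - ?du p)"
    unfolding ip_eq_sphere_integral
    by (rule sphere_integral_cong)
       (use C1 sdiff_S2_C1(2)[OF u] sdiff_S2_C1(2)[OF v] sdiff_S2_C1(2)[OF w]
        in \<open>simp add: eq_S2_def br_def inner_diff_right\<close>)
  also have "\<dots> = sphere_integral ?vuw - sphere_integral ?wuv - sphere_integral ?du"
    by (simp add: sphere_integral_diff continuous_intros cont)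
  also have "sphere_integral ?vuw = 0"
    by (rule sphere_integral_derivative_along[OF C1_on_S2_inner[OF C1(1,3)] v])
  also have "sphere_integral ?wuv = 0"
    by (rule sphere_integral_derivative_along[OF C1_on_S2_inner[OF C1(1,2)] w])
  finally show ?thesis by simp
qed

definition is_B :: "vf set \<Rightarrow> vf \<Rightarrow> vf \<Rightarrow> vf \<Rightarrow> bool" where
  "is_B g u v b \<longleftrightarrow> b \<in> g \<and> (\<forall>w\<in>g. ip b w = ip u (br v w))"

lemma Bop_eq:
  assumes g: "g \<subseteq> sdiff_S2" and b: "is_B g u v b"
  shows "Bop g u v \<simeq> b"
proof -
  let ?b = "Bop g u v" and ?d = "\<lambda>p. Bop g u v p - b p"
  have B: "is_B g u v ?b"
    unfolding Bop_def is_B_def[symmetric] by (rule someI[of "is_B g u v", OF b])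
  have cont: "continuous_on S2 b" "continuous_on S2 ?b"
    using b B g by (auto simp: is_B_def intro: sdiff_S2_continuous_on)
  then have "ip ?d w = ip ?b w - ip b w" if "continuous_on S2 w" for w
    by (intro ip_diff_left that)
  moreover have "ip ?b b = ip b b" "ip ?b ?b = ip b ?b"
    using b B by (auto simp: is_B_def)
  ultimately have "ip ?d b = 0" "ip ?d ?b = 0"
    using cont by simp_all
  then have "ip ?d ?d = 0"
    using ip_diff_left[of ?b b ?d] cont by (simp add: ip_commute[of ?b ?d] ip_commute[of b ?d] continuous_intros)
  then have "?d \<simeq> (\<lambda>p. 0)"
    by (intro ip_self_eq_0_imp continuous_intros cont)
  then show ?thesis
    by (simp add: eq_S2_def)
qed

section \<open>Gradients and Hessians of polynomial functions\<close>

lemma real_polynomial_function_vec_nth [simp]: "real_polynomial_function (\<lambda>p::real^'n. p $ i)"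
  by (intro real_polynomial_function.intros(1) bounded_linear_vec_nth)

lemma real_polynomial_function_inner_right [simp]:
  "real_polynomial_function (\<lambda>p::'a::real_inner. a \<bullet> p)"
  by (intro real_polynomial_function.intros(1) bounded_linear_inner_right)

declare real_polynomial_function.intros(2) [simp] real_polynomial_function.intros(3) [simp]
  real_polynomial_function.intros(4) [simp] real_polynomial_function_minus [simp]
  real_polynomial_function_diff [simp]

lemma real_polynomial_function_poly [simp]:
  assumes "real_polynomial_function f"
  shows "real_polynomial_function (\<lambda>p. poly q (f p))"
  by (induction q) (simp_all add: assms)

lemma real_polynomial_function_has_derivative:
  "real_polynomial_function f \<Longrightarrow> (f has_derivative frechet_derivative f (at p)) (at p)"
  by (simp add: differentiable_at_real_polynomial_function frechet_derivative_works[symmetric])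

lemma real_polynomial_function_frechet_derivative [simp]:
  assumes "real_polynomial_function f"
  shows "real_polynomial_function (\<lambda>p. frechet_derivative f (at p) v)"
  using assms
proof induction
  case (linear f)
  then have "frechet_derivative f (at p) = f" for p
    by (intro frechet_derivative_at[symmetric] bounded_linear_imp_has_derivative)
  then show ?case by simp
next
  case (add f g)
  then have "frechet_derivative (\<lambda>p. f p + g p) (at p)
      = (\<lambda>v. frechet_derivative f (at p) v + frechet_derivative g (at p) v)" for p
    by (intro frechet_derivative_at[symmetric] has_derivative_add real_polynomial_function_has_derivative)
  with add.IH show ?case by simp
next
  case (mult f g)
  then have "frechet_derivative (\<lambda>p. f p * g p) (at p)
      = (\<lambda>v. f p * frechet_derivative g (at p) v + frechet_derivative f (at p) v * g p)" for p
    by (intro frechet_derivative_at[symmetric] has_derivative_mult real_polynomial_function_has_derivative)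
  with mult show ?case by simp
qed simp

lemma continuous_on_real_polynomial_function:
  fixes f :: "'a::euclidean_space \<Rightarrow> real"
  shows "real_polynomial_function f \<Longrightarrow> continuous_on A f"
  by (simp add: continuous_on_polymonial_function real_polynomial_function_eq)

lemma smooth_on_polynomial_function:
  assumes "polynomial_function F"
  shows "smooth_on U F"
  unfolding smooth_on_def
proof (intro exI[of _ "Collect polynomial_function"] conjI ballI allI CollectI)
  fix g :: vf and v :: vec
  assume "g \<in> Collect polynomial_function"
  then have g: "polynomial_function g" by simp
  then show "g differentiable_on U"
    by (rule differentiable_on_polynomial_function)
  have "(g has_derivative frechet_derivative g (at p)) (at p)" for p
    using differentiable_at_polynomial_function[OF g] by (simp add: frechet_derivative_works)
  then have "((\<lambda>p. g p \<bullet> b) has_derivative (\<lambda>v. frechet_derivative g (at p) v \<bullet> b)) (at p)" for p b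
    by (rule has_derivative_inner_left)
  then have "frechet_derivative (\<lambda>p. g p \<bullet> b) (at p) v = frechet_derivative g (at p) v \<bullet> b" for p b
    by (metis frechet_derivative_at)
  then show "polynomial_function (\<lambda>p. frechet_derivative g (at p) v)"
    using g unfolding polynomial_function_iff_Basis_inner
    by (metis (no_types, lifting) ext real_polynomial_function_frechet_derivative)
qed (rule assms)

definition gradient :: "(real^'n \<Rightarrow> real) \<Rightarrow> real^'n \<Rightarrow> real^'n" where
  "gradient f p = (\<chi> i. frechet_derivative f (at p) (axis i 1))"

lemma real_polynomial_function_gradient [simp]:
  "real_polynomial_function f \<Longrightarrow> real_polynomial_function (\<lambda>p. gradient f p $ i)"
  by (simp add: gradient_def)

lemma has_derivative_gradient:
  assumes "real_polynomial_function f"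
  shows "(f has_derivative (\<lambda>v. gradient f p \<bullet> v)) (at p)"
proof -
  have "frechet_derivative f (at p) v = gradient f p \<bullet> v" for v
    using linear_axis_expansion[OF has_derivative_linear[OF real_polynomial_function_has_derivative[OF assms]],
        of p v]
    by (simp add: gradient_def inner_vec_def mult.commute)
  then show ?thesis
    using real_polynomial_function_has_derivative[OF assms, of p] by (simp add: has_derivative_eq_rhs ext)
qed

lemma gradient_eqI:
  assumes "(f has_derivative (\<lambda>v. g \<bullet> v)) (at p)"
  shows "gradient f p = g"
  by (simp add: gradient_def vec_eq_iff frechet_derivative_at[OF assms, symmetric] inner_axis)

lemma gradient_inner_right [simp]: "gradient (\<lambda>p. a \<bullet> p) = (\<lambda>p. a)"
  by (intro ext gradient_eqI) (auto intro!: derivative_eq_intros)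

lemma gradient_const [simp]: "gradient (\<lambda>p. a) = (\<lambda>p. 0)"
  by (intro ext gradient_eqI) simp

lemma gradient_add:
  assumes "real_polynomial_function f" "real_polynomial_function g"
  shows "gradient (\<lambda>p. f p + g p) p = gradient f p + gradient g p"
  by (rule gradient_eqI) (use assms[THEN has_derivative_gradient] in
      \<open>auto intro!: derivative_eq_intros simp: inner_add_left\<close>)

lemma gradient_mult:
  assumes "real_polynomial_function f" "real_polynomial_function g"
  shows "gradient (\<lambda>p. f p * g p) p = f p *\<^sub>R gradient g p + g p *\<^sub>R gradient f p"
  by (rule gradient_eqI) (use assms[THEN has_derivative_gradient] in
      \<open>auto intro!: derivative_eq_intros simp: inner_add_left mult.commute\<close>)

lemma gradient_cmult:
  assumes "real_polynomial_function f"
  shows "gradient (\<lambda>p. a * f p) p = a *\<^sub>R gradient f p"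
  using gradient_mult[OF real_polynomial_function.intros(2)[of a] assms] by simp

lemma gradient_poly_compose:
  assumes "real_polynomial_function f"
  shows "gradient (\<lambda>p. poly q (f p)) p = poly (pderiv q) (f p) *\<^sub>R gradient f p"
  by (rule gradient_eqI) (auto intro!: DERIV_compose_FDERIV[OF poly_DERIV, THEN has_derivative_eq_rhs]
      has_derivative_gradient assms)

definition hessian :: "(real^'n \<Rightarrow> real) \<Rightarrow> real^'n \<Rightarrow> real^'n \<Rightarrow> real^'n" where
  "hessian f p v = (\<chi> i. gradient (\<lambda>x. gradient f x $ i) p \<bullet> v)"

lemma has_derivative_gradient_hessian:
  assumes "real_polynomial_function f"
  shows "(gradient f has_derivative hessian f p) (at p)"
  by (rule has_derivative_vecI) (simp add: hessian_def has_derivative_gradient assms)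

lemma linear_hessian: "real_polynomial_function f \<Longrightarrow> linear (hessian f p)"
  by (rule has_derivative_linear[OF has_derivative_gradient_hessian])

lemma continuous_on_gradient:
  "real_polynomial_function f \<Longrightarrow> continuous_on A (gradient f)"
  by (simp add: continuous_on_vec_iff continuous_on_real_polynomial_function)

lemma continuous_on_hessian:
  assumes "real_polynomial_function f"
  shows "continuous_on A (\<lambda>p. hessian f p v)"
  using continuous_on_gradient[of "\<lambda>x. gradient f x $ _"] assms
  by (auto simp: continuous_on_vec_iff[of _ "\<lambda>p. hessian f p v"] hessian_def intro!: continuous_intros)

lemma gradient_gradient_commute:
  assumes "real_polynomial_function f"
  shows "gradient (\<lambda>x. gradient f x $ i) p $ j = gradient (\<lambda>x. gradient f x $ j) p $ i"
  using assms
proof induction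
  case (linear f)
  then have "gradient f x = gradient f 0" for x
    by (simp add: gradient_def frechet_derivative_at[symmetric, OF bounded_linear_imp_has_derivative])
  then have "(\<lambda>x. gradient f x $ k) = (\<lambda>x. gradient f 0 $ k)" for k
    by (metis ext)
  then show ?case
    by (metis gradient_const zero_index)
next
  case (mult f g)
  then show ?case
    by (simp add: gradient_mult gradient_add)
qed (simp_all add: gradient_add)

lemma hessian_symmetric:
  assumes "real_polynomial_function f"
  shows "hessian f p v \<bullet> w = v \<bullet> hessian f p w"
proof -
  have "hessian f p v \<bullet> w = (\<Sum>i\<in>UNIV. \<Sum>j\<in>UNIV. gradient (\<lambda>x. gradient f x $ i) p $ j * v $ j * w $ i)"
    by (simp add: hessian_def inner_vec_def sum_distrib_right)
  also have "\<dots> = (\<Sum>j\<in>UNIV. \<Sum>i\<in>UNIV. gradient (\<lambda>x. gradient f x $ i) p $ j * v $ j * w $ i)"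
    by (rule sum.swap)
  also have "\<dots> = (\<Sum>j\<in>UNIV. \<Sum>i\<in>UNIV. gradient (\<lambda>x. gradient f x $ j) p $ i * v $ j * w $ i)"
    by (simp only: gradient_gradient_commute[OF assms])
  also have "\<dots> = v \<bullet> hessian f p w"
    by (simp add: hessian_def inner_vec_def sum_distrib_left mult_ac)
  finally show ?thesis .
qed

section \<open>Symplectic gradients\<close>

unbundle cross3_syntax

definition sgrad :: "(vec \<Rightarrow> real) \<Rightarrow> vf" where
  "sgrad f p = gradient f p \<times> p"

definition dsgrad :: "(vec \<Rightarrow> real) \<Rightarrow> vec \<Rightarrow> vec \<Rightarrow> vec" where
  "dsgrad f p v = hessian f p v \<times> p + gradient f p \<times> v"

text \<open>Minus the Laplace--Beltrami operator of the sphere applied to the restriction of f.\<close>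

definition laplace_S2 :: "(vec \<Rightarrow> real) \<Rightarrow> vec \<Rightarrow> real" where
  "laplace_S2 f p = p \<bullet> hessian f p p + 2 * (p \<bullet> gradient f p) - (\<Sum>i\<in>UNIV. hessian f p (axis i 1) $ i)"

definition poisson :: "(vec \<Rightarrow> real) \<Rightarrow> (vec \<Rightarrow> real) \<Rightarrow> vec \<Rightarrow> real" where
  "poisson f g p = gradient g p \<bullet> sgrad f p"

abbreviation angular_deriv :: "vec \<Rightarrow> (vec \<Rightarrow> real) \<Rightarrow> vec \<Rightarrow> real" where
  "angular_deriv a \<equiv> poisson (\<lambda>p. a \<bullet> p)"

lemma bounded_bilinear_cross: "bounded_bilinear cross3"
  using bilinear_cross by (simp add: bilinear_conv_bounded_bilinear)

lemma cross_inner_swap: "(x \<times> y) \<bullet> z = - (y \<bullet> (x \<times> z))" for x :: vec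
  by (simp add: cross3_simps)

lemma sgrad_tangent [simp]: "sgrad f p \<bullet> p = 0"
  by (simp add: sgrad_def dot_cross_self)

lemma sgrad_inner_right: "sgrad (\<lambda>p. a \<bullet> p) p = a \<times> p"
  by (simp add: sgrad_def)

lemma dsgrad_inner_right: "dsgrad (\<lambda>p. a \<bullet> p) p v = a \<times> v"
  by (simp add: dsgrad_def hessian_def zero_vec_def[symmetric])

lemma sgrad_add:
  assumes "real_polynomial_function f" "real_polynomial_function g"
  shows "sgrad (\<lambda>p. f p + g p) = (\<lambda>p. sgrad f p + sgrad g p)"
  by (simp add: fun_eq_iff sgrad_def gradient_add[OF assms] cross_add_left)

lemma sgrad_cmult:
  "real_polynomial_function f \<Longrightarrow> sgrad (\<lambda>p. a * f p) = (\<lambda>p. a *\<^sub>R sgrad f p)"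
  by (simp add: fun_eq_iff sgrad_def gradient_cmult cross_mult_left)

lemma sgrad_uminus:
  "real_polynomial_function f \<Longrightarrow> sgrad (\<lambda>p. - f p) = (\<lambda>p. - sgrad f p)"
  using sgrad_cmult[of f "-1"] by simp

lemma sgrad_const [simp]: "sgrad (\<lambda>p. a) = (\<lambda>p. 0)"
  by (simp add: sgrad_def fun_eq_iff)

lemma sgrad_has_derivative:
  assumes "real_polynomial_function f"
  shows "(sgrad f has_derivative dsgrad f p) (at p)"
  unfolding sgrad_def[abs_def] dsgrad_def[abs_def]
  by (rule bounded_bilinear.FDERIV[OF bounded_bilinear_cross has_derivative_gradient_hessian[OF assms]
        has_derivative_ident, THEN has_derivative_eq_rhs]) (simp add: add.commute)

lemma C1_on_S2_sgrad:
  assumes "real_polynomial_function f"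
  shows "C1_on_S2 (sgrad f) (dsgrad f)"
  unfolding C1_on_S2_def dsgrad_def
  by (intro conjI ballI allI sgrad_has_derivative[unfolded dsgrad_def[abs_def]] assms
      continuous_intros continuous_on_cross continuous_on_hessian continuous_on_gradient)

lemma C1_on_S2_polynomial:
  assumes "real_polynomial_function f"
  shows "C1_on_S2 f (\<lambda>p v. gradient f p \<bullet> v)"
  unfolding C1_on_S2_def
  by (intro conjI ballI allI has_derivative_gradient assms continuous_intros continuous_on_gradient)

lemma polynomial_function_sgrad:
  assumes "real_polynomial_function f"
  shows "polynomial_function (sgrad f)"
proof -
  have "real_polynomial_function (\<lambda>p. sgrad f p $ i)" for i
    using exhaust_3[of i] assms by (auto simp: sgrad_def cross_components)
  then show ?thesis
    by (auto simp: polynomial_function_iff_Basis_inner Basis_vec_def inner_axis)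
qed

lemma real_polynomial_function_poisson [simp]:
  assumes "real_polynomial_function f" "real_polynomial_function g"
  shows "real_polynomial_function (poisson f g)"
  using assms by (simp add: poisson_def[abs_def] sgrad_def inner_vec3 cross_components)

lemma real_polynomial_function_laplace_S2 [simp]:
  "real_polynomial_function f \<Longrightarrow> real_polynomial_function (laplace_S2 f)"
  by (simp add: laplace_S2_def[abs_def] hessian_def inner_vec3 sum_3)

lemma smooth_ext_sgrad:
  "real_polynomial_function f \<Longrightarrow> smooth_ext (sgrad f) (sgrad f)"
  by (auto simp: smooth_ext_def intro!: exI[of _ UNIV] smooth_on_polynomial_function polynomial_function_sgrad)

lemma Dv_sgrad:
  assumes "real_polynomial_function f" "p \<in> S2" "t \<bullet> p = 0"
  shows "Dv (sgrad f) p t = dsgrad f p t"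
  by (rule Dv_eq[OF smooth_ext_sgrad C1_on_S2_sgrad assms(2,3)]) (rule assms(1))+

lemma tangential_trace_dsgrad:
  assumes "real_polynomial_function f"
  shows "tangential_trace p (dsgrad f p) = 0"
proof -
  have "hessian f p (axis i 1) $ j = hessian f p (axis j 1) $ i" for i j
    using hessian_symmetric[OF assms, of p "axis i 1" "axis j 1"] by (simp add: inner_axis inner_axis')
  from this[of 1 2] this[of 1 3] this[of 2 3] show ?thesis
    by (simp add: tangential_trace_def dsgrad_def sum_3 cross_components inner_add_right dot_cross_self axis_def)
qed

lemma sgrad_in_sdiff_S2:
  assumes "real_polynomial_function f"
  shows "sgrad f \<in> sdiff_S2"
  using sdiv_eq[OF smooth_ext_sgrad C1_on_S2_sgrad, OF assms assms] smooth_ext_sgrad[OF assms]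
  by (auto simp: sdiff_S2_def tangential_trace_dsgrad[OF assms])

lemma gradient_antipodal_odd:
  assumes f: "real_polynomial_function f" and odd: "\<And>p. f (- p) = - f p"
  shows "gradient f (- p) = gradient f p"
proof -
  have "((\<lambda>x. f (- x)) has_derivative (\<lambda>v. gradient f (- p) \<bullet> (- v))) (at p)"
    using has_derivative_compose[OF _ has_derivative_gradient[OF f], of uminus uminus p UNIV]
    by (auto intro!: derivative_eq_intros)
  then have "((\<lambda>x. - f x) has_derivative (\<lambda>v. - gradient f (- p) \<bullet> v)) (at p)"
    by (simp add: odd)
  from has_derivative_minus[OF this] have "(f has_derivative (\<lambda>v. gradient f (- p) \<bullet> v)) (at p)"
    by simp
  then show ?thesis
    by (rule gradient_eqI[symmetric])
qed

lemma sgrad_in_sdiff_RP2: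
  assumes "real_polynomial_function f" "\<And>p. f (- p) = - f p"
  shows "sgrad f \<in> sdiff_RP2"
  using sgrad_in_sdiff_S2[OF assms(1)] gradient_antipodal_odd[OF assms]
  by (simp add: sdiff_RP2_def sgrad_def)

lemma sgrad_continuous_on: "real_polynomial_function f \<Longrightarrow> continuous_on S2 (sgrad f)"
  by (rule sdiff_S2_continuous_on[OF sgrad_in_sdiff_S2])

definition curl_sgrad :: "(vec \<Rightarrow> real) \<Rightarrow> vec \<Rightarrow> vec" where
  "curl_sgrad f p = 2 *\<^sub>R gradient f p + hessian f p p - (\<Sum>i\<in>UNIV. hessian f p (axis i 1) $ i) *\<^sub>R p"

lemma curl_sgrad_radial: "p \<in> S2 \<Longrightarrow> p \<bullet> curl_sgrad f p = laplace_S2 f p"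
  by (simp add: curl_sgrad_def laplace_S2_def S2_iff_inner inner_diff_right inner_add_right)

lemma dsgrad_antisymmetric_part:
  assumes f: "real_polynomial_function f"
  shows "dsgrad f p v \<bullet> w - dsgrad f p w \<bullet> v = curl_sgrad f p \<bullet> (v \<times> w)"
proof -
  have sym: "hessian f p (axis i 1) $ j = hessian f p (axis j 1) $ i" for i j
    using hessian_symmetric[OF f, of p "axis i 1" "axis j 1"] by (simp add: inner_axis inner_axis')
  note expand = linear_axis_expansion[OF linear_hessian[OF f, of p]]
  show ?thesis
    unfolding dsgrad_def curl_sgrad_def expand[of v] expand[of w] expand[of p] sum_3
    using sym[of 2 1] sym[of 3 1] sym[of 3 2]
    by (simp add: inner_vec3 cross_components algebra_simps)
qed

lemma cross_tangent_eq:
  assumes "p \<in> S2" "v \<bullet> p = 0" "w \<bullet> p = 0"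
  shows "v \<times> w = (p \<bullet> (v \<times> w)) *\<^sub>R p"
proof -
  have "p \<times> (v \<times> w) = 0"
    using assms(2,3) by (simp add: Lagrange inner_commute)
  then have "p \<times> (p \<times> (v \<times> w)) = 0"
    by simp
  then show ?thesis
    using assms(1) by (simp add: Lagrange[of p p] S2_iff_inner)
qed

lemma triple_cross_tangent:
  assumes "p \<in> S2" "w \<bullet> p = 0"
  shows "p \<bullet> ((a \<times> p) \<times> w) = a \<bullet> w"
proof -
  have "p \<bullet> ((a \<times> p) \<times> w) = (p \<times> (a \<times> p)) \<bullet> w"
    by (metis cross_triple inner_commute)
  then show ?thesis
    using assms by (simp add: Lagrange S2_iff_inner inner_diff_left inner_diff_right inner_commute)
qed

lemma dsgrad_exterior_derivative:
  assumes "real_polynomial_function f" "p \<in> S2" "v \<bullet> p = 0" "w \<bullet> p = 0"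
  shows "dsgrad f p v \<bullet> w - dsgrad f p w \<bullet> v = laplace_S2 f p * (p \<bullet> (v \<times> w))"
  unfolding dsgrad_antisymmetric_part[OF assms(1)]
  by (subst cross_tangent_eq[OF assms(2-4)]) (simp add: curl_sgrad_radial[OF assms(2), symmetric] inner_commute)

lemma gradient_poisson:
  assumes f: "real_polynomial_function f" and g: "real_polynomial_function g"
  shows "gradient (poisson f g) p
    = hessian g p (sgrad f p) - hessian f p (sgrad g p) + gradient g p \<times> gradient f p"
proof (rule gradient_eqI)
  have "gradient g p \<bullet> dsgrad f p v + hessian g p v \<bullet> sgrad f p
      = (hessian g p (sgrad f p) - hessian f p (sgrad g p) + gradient g p \<times> gradient f p) \<bullet> v" for v
  proof -
    have "hessian f p v \<bullet> (p \<times> gradient g p) = - (hessian f p (sgrad g p) \<bullet> v)"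
      using hessian_symmetric[OF f, of p "sgrad g p" v] cross_skew[of p "gradient g p"]
      by (simp add: sgrad_def inner_commute)
    moreover have "gradient g p \<bullet> (hessian f p v \<times> p) = hessian f p v \<bullet> (p \<times> gradient g p)"
      "gradient g p \<bullet> (gradient f p \<times> v) = (gradient g p \<times> gradient f p) \<bullet> v"
      by (metis cross_triple inner_commute)+
    ultimately show ?thesis
      using hessian_symmetric[OF g, of p "sgrad f p" v]
      by (simp add: dsgrad_def inner_add_left inner_add_right inner_diff_left inner_diff_right inner_commute)
  qed
  then show "(poisson f g has_derivative (\<lambda>v. (hessian g p (sgrad f p) - hessian f p (sgrad g p)
      + gradient g p \<times> gradient f p) \<bullet> v)) (at p)"
    unfolding poisson_def[abs_def]
    by (intro has_derivative_inner[OF has_derivative_gradient_hessian[OF g] sgrad_has_derivative[OF f],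
          THEN has_derivative_eq_rhs]) (simp add: fun_eq_iff)
qed

lemma sgrad_poisson:
  assumes "real_polynomial_function f" "real_polynomial_function g"
  shows "sgrad (poisson f g) p = dsgrad g p (sgrad f p) - dsgrad f p (sgrad g p)"
proof -
  have "(gradient g p \<times> gradient f p) \<times> p
      = gradient g p \<times> (gradient f p \<times> p) - gradient f p \<times> (gradient g p \<times> p)"
    by (simp add: cross3_simps)
  then show ?thesis
    by (simp add: sgrad_def[of "poisson f g"] gradient_poisson[OF assms] dsgrad_def cross_add_left
        Cross3.left_diff_distrib) (simp add: sgrad_def)
qed

lemma br_sgrad:
  assumes "real_polynomial_function f" "real_polynomial_function g"
  shows "br (sgrad f) (sgrad g) \<simeq> sgrad (poisson f g)"
  by (simp add: eq_S2_def br_def Dv_sgrad assms sgrad_poisson)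

lemma ip_br_sgrad:
  assumes f: "real_polynomial_function f" and g: "real_polynomial_function g" and w: "w \<in> sdiff_S2"
  shows "ip (sgrad f) (br (sgrad g) w) = - sphere_integral (\<lambda>p. laplace_S2 f p * (gradient g p \<bullet> w p))"
proof -
  have "Dv (sgrad f) p (sgrad g p) \<bullet> w p - Dv (sgrad f) p (w p) \<bullet> sgrad g p
      = laplace_S2 f p * (gradient g p \<bullet> w p)" if "p \<in> S2" for p
    using dsgrad_exterior_derivative[OF f that sgrad_tangent[of g p]] triple_cross_tangent[OF that]
      sdiff_S2_tangent[OF w that]
    by (simp add: Dv_sgrad[OF f that]) (simp add: sgrad_def)
  then show ?thesis
    unfolding ip_br[OF sgrad_in_sdiff_S2[OF f] sgrad_in_sdiff_S2[OF g] w]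
    by (simp cong: sphere_integral_cong)
qed

text \<open>Cartan's formula for the rotation about the axis a, applied to the one-form dual to \<^term>\<open>sgrad r\<close>:
  contracting the area form with that rotation gives the one-form dual to a.\<close>

lemma sphere_integral_laplace_axis:
  assumes r: "real_polynomial_function r" and w: "w \<in> sdiff_S2"
  shows "sphere_integral (\<lambda>p. laplace_S2 r p * (a \<bullet> w p)) = ip (sgrad (angular_deriv a r)) w"
proof -
  let ?\<rho> = "angular_deriv a r"
  let ?d = "\<lambda>p v. sgrad r p \<bullet> dsgrad (\<lambda>p. a \<bullet> p) p v + dsgrad r p v \<bullet> sgrad (\<lambda>p. a \<bullet> p) p"
  have C1: "C1_on_S2 (\<lambda>p. sgrad r p \<bullet> sgrad (\<lambda>p. a \<bullet> p) p) ?d"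
    by (intro C1_on_S2_inner C1_on_S2_sgrad r) simp
  have cartan: "laplace_S2 r p * (a \<bullet> w p) = sgrad ?\<rho> p \<bullet> w p - ?d p (w p)" if "p \<in> S2" for p
  proof -
    have "laplace_S2 r p * (a \<bullet> w p) = dsgrad r p (a \<times> p) \<bullet> w p - dsgrad r p (w p) \<bullet> (a \<times> p)"
      using dsgrad_exterior_derivative[OF r that _ sdiff_S2_tangent[OF w that], of "a \<times> p"]
        triple_cross_tangent[OF that sdiff_S2_tangent[OF w that]]
      by (simp add: dot_cross_self)
    also have "dsgrad r p (a \<times> p) = sgrad ?\<rho> p + a \<times> sgrad r p"
      using sgrad_poisson[OF _ r, of "\<lambda>p. a \<bullet> p" p] by (simp add: sgrad_inner_right dsgrad_inner_right)
    finally show ?thesis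
      by (simp add: sgrad_inner_right dsgrad_inner_right inner_add_left cross_inner_swap)
  qed
  have cont: "continuous_on S2 (\<lambda>p. sgrad ?\<rho> p \<bullet> w p)" "continuous_on S2 (\<lambda>p. ?d p (w p))"
    using r by (intro continuous_intros sgrad_continuous_on sdiff_S2_continuous_on[OF w]
        C1_on_S2_continuous_on_apply[OF C1]; simp)+
  have "sphere_integral (\<lambda>p. laplace_S2 r p * (a \<bullet> w p))
      = sphere_integral (\<lambda>p. sgrad ?\<rho> p \<bullet> w p) - sphere_integral (\<lambda>p. ?d p (w p))"
    unfolding sphere_integral_diff[OF cont, symmetric] by (rule sphere_integral_cong) (rule cartan)
  then show ?thesis
    using sphere_integral_derivative_along[OF C1 w] by (simp add: ip_eq_sphere_integral)
qed

text \<open>The field \<open>p \<times> sgrad f\<close> is the tangential gradient of f.\<close>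

theorem ip_sgrad_sgrad:
  assumes f: "real_polynomial_function f" and g: "real_polynomial_function g"
  shows "ip (sgrad f) (sgrad g) = sphere_integral (\<lambda>p. laplace_S2 f p * g p)"
proof -
  let ?T = "\<lambda>p. p \<times> sgrad f p" and ?T' = "\<lambda>p v. p \<times> dsgrad f p v + v \<times> sgrad f p"
  have "(?T has_derivative ?T' p) (at p)" for p
    by (rule bounded_bilinear.FDERIV[OF bounded_bilinear_cross has_derivative_ident sgrad_has_derivative[OF f]])
  then have "C1_on_S2 ?T ?T'"
    using C1_on_S2_sgrad[OF f]
    by (auto simp: C1_on_S2_def intro!: continuous_intros continuous_on_cross sgrad_continuous_on f)
  note C1 = C1_on_S2_scaleR[OF C1_on_S2_polynomial[OF g] this]
  have curl: "dsgrad f p (axis 2 1) $ 3 - dsgrad f p (axis 3 1) $ 2 = curl_sgrad f p $ 1"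
    "dsgrad f p (axis 3 1) $ 1 - dsgrad f p (axis 1 1) $ 3 = curl_sgrad f p $ 2"
    "dsgrad f p (axis 1 1) $ 2 - dsgrad f p (axis 2 1) $ 1 = curl_sgrad f p $ 3" for p
    using dsgrad_antisymmetric_part[OF f, of p "axis 2 1" "axis 3 1"]
      dsgrad_antisymmetric_part[OF f, of p "axis 3 1" "axis 1 1"]
      dsgrad_antisymmetric_part[OF f, of p "axis 1 1" "axis 2 1"]
    by (simp_all add: cross_basis inner_axis)
  have "tangential_trace p (?T' p) = - (p \<bullet> curl_sgrad f p)" for p
    unfolding inner_vec3 curl[symmetric]
    by (simp add: tangential_trace_def sum_3 inner_add_right dot_cross_self cross_components axis_def
        algebra_simps)
  moreover have "gradient g p \<bullet> (p \<times> sgrad f p) = sgrad f p \<bullet> sgrad g p" for p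
    by (metis cross_triple inner_commute sgrad_def)
  ultimately have "tangential_trace p (\<lambda>v. g p *\<^sub>R ?T' p v + (gradient g p \<bullet> v) *\<^sub>R ?T p)
      = sgrad f p \<bullet> sgrad g p - laplace_S2 f p * g p" if "p \<in> S2" for p
    by (subst tangential_trace_leibniz)
       (auto simp: curl_sgrad_radial[OF that] dot_cross_self bounded_linear_inner_right bounded_linear.linear)
  then have "sphere_integral (\<lambda>p. sgrad f p \<bullet> sgrad g p - laplace_S2 f p * g p) = 0"
    using sphere_divergence[OF C1] by (simp add: dot_cross_self inner_commute cong: sphere_integral_cong)
  moreover have "continuous_on S2 (\<lambda>p. sgrad f p \<bullet> sgrad g p)"
    by (intro continuous_intros sgrad_continuous_on f g)
  moreover have "continuous_on S2 (\<lambda>p. laplace_S2 f p * g p)"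
    by (simp add: continuous_on_real_polynomial_function f g)
  ultimately show ?thesis
    by (simp add: sphere_integral_diff ip_eq_sphere_integral)
qed

section \<open>The covariant derivative along axially symmetric flows\<close>

definition nabla :: "vf set \<Rightarrow> vf \<Rightarrow> vf \<Rightarrow> vf" where
  "nabla \<gg> X Y = (\<lambda>p. (1/2) *\<^sub>R (br X Y p - Bop \<gg> X Y p - Bop \<gg> Y X p))"

lemma eq_S2_nabla: "X \<simeq> X' \<Longrightarrow> Y \<simeq> Y' \<Longrightarrow> nabla \<gg> X Y \<simeq> nabla \<gg> X' Y'"
  using eq_S2_br[of X X' Y Y'] eq_S2_Bop[of X X' Y Y' \<gg>] eq_S2_Bop[of Y Y' X X' \<gg>]
  by (simp add: nabla_def eq_S2_def)

text \<open>The gradient of a function that is odd under the antipodal map is even, so its symplectic gradient is odd.\<close>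

definition stream_functions :: "vf set \<Rightarrow> (vec \<Rightarrow> real) set" where
  "stream_functions \<gg> = {f. real_polynomial_function f \<and>
     (\<gg> = sdiff_S2 \<or> \<gg> = sdiff_RP2 \<and> (\<forall>p. f (- p) = - f p))}"

lemma sgrad_stream_functions: "f \<in> stream_functions \<gg> \<Longrightarrow> sgrad f \<in> \<gg>"
  by (auto simp: stream_functions_def sgrad_in_sdiff_S2 sgrad_in_sdiff_RP2)

lemma stream_functions_subset: "f \<in> stream_functions \<gg> \<Longrightarrow> \<gg> \<subseteq> sdiff_S2"
  by (auto simp: stream_functions_def sdiff_RP2_def)

lemma stream_functions_cmult: "f \<in> stream_functions \<gg> \<Longrightarrow> (\<lambda>p. a * f p) \<in> stream_functions \<gg>"
  by (auto simp: stream_functions_def)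

lemma poisson_poly_axis:
  "poisson (\<lambda>p. poly f (a \<bullet> p)) g p = poly (pderiv f) (a \<bullet> p) * angular_deriv a g p"
  by (simp add: poisson_def sgrad_def gradient_poly_compose cross_mult_left)

lemma sphere_integral_gradient_along:
  assumes "real_polynomial_function f" "w \<in> sdiff_S2"
  shows "sphere_integral (\<lambda>p. gradient f p \<bullet> w p) = 0"
  by (rule sphere_integral_derivative_along[OF C1_on_S2_polynomial[OF assms(1)] assms(2)])

lemma sphere_integral_axis_decomposition:
  assumes r: "real_polynomial_function r" and w: "w \<in> sdiff_S2"
    and h: "\<And>p. p \<in> S2 \<Longrightarrow> h p = laplace_S2 r p + poly t (a \<bullet> p)"
  shows "sphere_integral (\<lambda>p. h p * (a \<bullet> w p)) = ip (sgrad (angular_deriv a r)) w"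
proof -
  obtain T where T: "pderiv T = t"
    using ex_pderiv_eq by blast
  have "sphere_integral (\<lambda>p. gradient (\<lambda>p. poly T (a \<bullet> p)) p \<bullet> w p) = 0"
    by (rule sphere_integral_gradient_along[OF _ w]) simp
  then have exact: "sphere_integral (\<lambda>p. poly t (a \<bullet> p) * (a \<bullet> w p)) = 0"
    by (simp add: gradient_poly_compose T)
  have "continuous_on S2 (\<lambda>p. laplace_S2 r p * (a \<bullet> w p))" "continuous_on S2 (\<lambda>p. poly t (a \<bullet> p) * (a \<bullet> w p))"
    by (intro continuous_intros sdiff_S2_continuous_on[OF w] continuous_on_real_polynomial_function; simp add: r)+
  then have "sphere_integral (\<lambda>p. laplace_S2 r p * (a \<bullet> w p) + poly t (a \<bullet> p) * (a \<bullet> w p))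
      = ip (sgrad (angular_deriv a r)) w"
    by (simp add: sphere_integral_add exact sphere_integral_laplace_axis[OF r w])
  moreover have "h p * (a \<bullet> w p) = laplace_S2 r p * (a \<bullet> w p) + poly t (a \<bullet> p) * (a \<bullet> w p)" if "p \<in> S2" for p
    by (simp add: h[OF that] distrib_right)
  ultimately show ?thesis
    by (simp cong: sphere_integral_cong)
qed

lemma is_B_axial_left:
  fixes a :: vec and f t :: "real poly"
  defines "F \<equiv> \<lambda>p. poly f (a \<bullet> p)"
  assumes eigen: "\<And>p. p \<in> S2 \<Longrightarrow> laplace_S2 F p = \<mu> * F p"
    and g: "real_polynomial_function g" and r: "real_polynomial_function r"
    and stream: "angular_deriv a r \<in> stream_functions \<gg>"
    and decomposition: "\<And>p. p \<in> S2 \<Longrightarrow> poly (pderiv f) (a \<bullet> p) * g p = laplace_S2 r p + poly t (a \<bullet> p)"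
  shows "is_B \<gg> (sgrad F) (sgrad g) (sgrad (\<lambda>p. \<mu> * angular_deriv a r p))"
  unfolding is_B_def
proof (intro conjI ballI)
  show "sgrad (\<lambda>p. \<mu> * angular_deriv a r p) \<in> \<gg>"
    by (intro sgrad_stream_functions stream_functions_cmult stream)
  fix w assume "w \<in> \<gg>"
  then have w: "w \<in> sdiff_S2"
    using stream_functions_subset[OF stream] by blast
  have F: "real_polynomial_function F"
    by (simp add: F_def)
  have dF: "gradient F p = poly (pderiv f) (a \<bullet> p) *\<^sub>R a" for p
    by (simp add: F_def gradient_poly_compose)
  let ?Fdg = "\<lambda>p. F p * (gradient g p \<bullet> w p)" and ?gdF = "\<lambda>p. g p * (gradient F p \<bullet> w p)"
  have "sphere_integral (\<lambda>p. gradient (\<lambda>p. F p * g p) p \<bullet> w p) = 0"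
    by (rule sphere_integral_gradient_along[OF _ w]) (simp add: F g)
  moreover have "continuous_on S2 ?Fdg" "continuous_on S2 ?gdF"
    by (intro continuous_intros continuous_on_gradient continuous_on_real_polynomial_function
        sdiff_S2_continuous_on[OF w] F g)+
  ultimately have by_parts: "sphere_integral ?Fdg = - sphere_integral ?gdF"
    by (simp add: gradient_mult[OF F g] inner_add_left sphere_integral_add)
  have "ip (sgrad F) (br (sgrad g) w) = - sphere_integral (\<lambda>p. \<mu> * ?Fdg p)"
    unfolding ip_br_sgrad[OF F g w] by (simp add: eigen mult.assoc cong: sphere_integral_cong)
  also have "\<dots> = \<mu> * sphere_integral ?gdF"
    by (simp add: sphere_integral_cmult by_parts)
  also have "?gdF = (\<lambda>p. poly (pderiv f) (a \<bullet> p) * g p * (a \<bullet> w p))"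
    by (simp add: dF mult_ac)
  also have "sphere_integral \<dots> = ip (sgrad (angular_deriv a r)) w"
    by (rule sphere_integral_axis_decomposition[OF r w decomposition])
  finally show "ip (sgrad (\<lambda>p. \<mu> * angular_deriv a r p)) w = ip (sgrad F) (br (sgrad g) w)"
    using r by (simp add: sgrad_cmult ip_scaleR_left)
qed

lemma is_B_axial_right:
  fixes a :: vec and f t :: "real poly"
  assumes g: "real_polynomial_function g" and s: "real_polynomial_function s"
    and stream: "angular_deriv a s \<in> stream_functions \<gg>"
    and decomposition: "\<And>p. p \<in> S2 \<Longrightarrow> poly (pderiv f) (a \<bullet> p) * laplace_S2 g p = laplace_S2 s p + poly t (a \<bullet> p)"
  shows "is_B \<gg> (sgrad g) (sgrad (\<lambda>p. poly f (a \<bullet> p))) (sgrad (\<lambda>p. - angular_deriv a s p))"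
  unfolding is_B_def
proof (intro conjI ballI)
  show "sgrad (\<lambda>p. - angular_deriv a s p) \<in> \<gg>"
    using stream_functions_cmult[OF stream, of "-1"] by (simp add: sgrad_stream_functions)
  fix w assume "w \<in> \<gg>"
  then have w: "w \<in> sdiff_S2"
    using stream_functions_subset[OF stream] by blast
  have "ip (sgrad g) (br (sgrad (\<lambda>p. poly f (a \<bullet> p))) w)
      = - sphere_integral (\<lambda>p. poly (pderiv f) (a \<bullet> p) * laplace_S2 g p * (a \<bullet> w p))"
    using ip_br_sgrad[OF g _ w, of "\<lambda>p. poly f (a \<bullet> p)"] by (simp add: gradient_poly_compose mult_ac)
  also have "\<dots> = - ip (sgrad (angular_deriv a s)) w"
    by (simp only: sphere_integral_axis_decomposition[OF s w decomposition])
  finally show "ip (sgrad (\<lambda>p. - angular_deriv a s p)) w = ip (sgrad g) (br (sgrad (\<lambda>p. poly f (a \<bullet> p))) w)"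
    using s ip_scaleR_left[of "-1"] by (simp add: sgrad_uminus)
qed

lemma nabla_axial:
  fixes a :: vec and f t t' :: "real poly"
  defines "F \<equiv> \<lambda>p. poly f (a \<bullet> p)"
  assumes eigen: "\<And>p. p \<in> S2 \<Longrightarrow> laplace_S2 F p = \<mu> * F p"
    and g: "real_polynomial_function g" and r: "real_polynomial_function r" and s: "real_polynomial_function s"
    and streams: "angular_deriv a r \<in> stream_functions \<gg>" "angular_deriv a s \<in> stream_functions \<gg>"
    and r_eq: "\<And>p. p \<in> S2 \<Longrightarrow> poly (pderiv f) (a \<bullet> p) * g p = laplace_S2 r p + poly t (a \<bullet> p)"
    and s_eq: "\<And>p. p \<in> S2 \<Longrightarrow> poly (pderiv f) (a \<bullet> p) * laplace_S2 g p = laplace_S2 s p + poly t' (a \<bullet> p)"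
  shows "nabla \<gg> (sgrad F) (sgrad g) \<simeq> (\<lambda>p. (1/2) *\<^sub>R
      (sgrad (poisson F g) p - \<mu> *\<^sub>R sgrad (angular_deriv a r) p + sgrad (angular_deriv a s) p))"
    and "nabla \<gg> (sgrad g) (sgrad F) \<simeq> (\<lambda>p. (1/2) *\<^sub>R
      (- sgrad (poisson F g) p - \<mu> *\<^sub>R sgrad (angular_deriv a r) p + sgrad (angular_deriv a s) p))"
proof -
  have "is_B \<gg> (sgrad F) (sgrad g) (sgrad (\<lambda>p. \<mu> * angular_deriv a r p))"
    using eigen g r streams(1) r_eq unfolding F_def by (rule is_B_axial_left)
  note B_left = Bop_eq[OF stream_functions_subset[OF streams(1)] this]
  have "is_B \<gg> (sgrad g) (sgrad F) (sgrad (\<lambda>p. - angular_deriv a s p))"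
    using g s streams(2) s_eq unfolding F_def by (rule is_B_axial_right)
  note B_right = Bop_eq[OF stream_functions_subset[OF streams(2)] this]
  have bracket: "br (sgrad F) (sgrad g) \<simeq> sgrad (poisson F g)"
    by (rule br_sgrad[OF _ g]) (simp add: F_def)
  have "br (sgrad g) (sgrad F) p = - br (sgrad F) (sgrad g) p" for p
    by (simp add: br_def)
  with bracket B_left B_right show
    "nabla \<gg> (sgrad F) (sgrad g) \<simeq> (\<lambda>p. (1/2) *\<^sub>R
      (sgrad (poisson F g) p - \<mu> *\<^sub>R sgrad (angular_deriv a r) p + sgrad (angular_deriv a s) p))"
    "nabla \<gg> (sgrad g) (sgrad F) \<simeq> (\<lambda>p. (1/2) *\<^sub>R
      (- sgrad (poisson F g) p - \<mu> *\<^sub>R sgrad (angular_deriv a r) p + sgrad (angular_deriv a s) p))"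
    by (simp_all add: nabla_def eq_S2_def sgrad_cmult sgrad_uminus r s)
qed

section \<open>Complexification\<close>

definition eq_C :: "cvf \<Rightarrow> cvf \<Rightarrow> bool"  (infix \<open>\<simeq>\<^sub>C\<close> 50) where
  "u \<simeq>\<^sub>C v \<longleftrightarrow> fst u \<simeq> fst v \<and> snd u \<simeq> snd v"

lemma eq_C_refl [simp]: "u \<simeq>\<^sub>C u"
  by (simp add: eq_C_def)

lemma eq_C_trans [trans]: "u \<simeq>\<^sub>C v \<Longrightarrow> v \<simeq>\<^sub>C w \<Longrightarrow> u \<simeq>\<^sub>C w"
  by (auto simp: eq_C_def intro: eq_S2_trans)

lemma eq_C_herm: "u \<simeq>\<^sub>C u' \<Longrightarrow> v \<simeq>\<^sub>C v' \<Longrightarrow> herm u v = herm u' v'"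
  using eq_S2_ip[of "fst u" "fst u'" "fst v" "fst v'"] eq_S2_ip[of "fst u" "fst u'" "snd v" "snd v'"]
    eq_S2_ip[of "snd u" "snd u'" "fst v" "fst v'"] eq_S2_ip[of "snd u" "snd u'" "snd v" "snd v'"]
  by (simp add: herm_def eq_C_def)

lemma eq_C_cbil:
  assumes "\<And>X X' Y Y'. X \<simeq> X' \<Longrightarrow> Y \<simeq> Y' \<Longrightarrow> f X Y \<simeq> f X' Y'" "u \<simeq>\<^sub>C u'" "v \<simeq>\<^sub>C v'"
  shows "cbil f u v \<simeq>\<^sub>C cbil f u' v'"
proof -
  have "f (fst u) (fst v) \<simeq> f (fst u') (fst v')" "f (snd u) (snd v) \<simeq> f (snd u') (snd v')"
    "f (fst u) (snd v) \<simeq> f (fst u') (snd v')" "f (snd u) (fst v) \<simeq> f (snd u') (fst v')"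
    using assms(2,3) by (auto simp: eq_C_def intro!: assms(1))
  then show ?thesis
    by (simp add: cbil_def eq_C_def eq_S2_def fsub_def fadd_def)
qed

lemma cbil_real_left:
  assumes "f (\<lambda>p. 0) X \<simeq> (\<lambda>p. 0)" "f (\<lambda>p. 0) Y \<simeq> (\<lambda>p. 0)"
  shows "cbil f (U, \<lambda>p. 0) (X, Y) \<simeq>\<^sub>C (f U X, f U Y)"
  using assms by (simp add: cbil_def eq_C_def eq_S2_def fsub_def fadd_def)

lemma cbil_real_right:
  assumes "f X (\<lambda>p. 0) \<simeq> (\<lambda>p. 0)" "f Y (\<lambda>p. 0) \<simeq> (\<lambda>p. 0)"
  shows "cbil f (X, Y) (U, \<lambda>p. 0) \<simeq>\<^sub>C (f X U, f Y U)"
  using assms by (simp add: cbil_def eq_C_def eq_S2_def fsub_def fadd_def)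

lemma cnabla_eq_cbil: "cnabla \<gg> u v = cbil (nabla \<gg>) u v"
  by (simp add: cnabla_def cbr_def cB_def cbil_def nabla_def cscale_def csub_def fscale_def fsub_def fadd_def
      fun_eq_iff algebra_simps)

lemma eq_C_cbr: "u \<simeq>\<^sub>C u' \<Longrightarrow> v \<simeq>\<^sub>C v' \<Longrightarrow> cbr u v \<simeq>\<^sub>C cbr u' v'"
  unfolding cbr_def by (rule eq_C_cbil[OF eq_S2_br])

lemma eq_C_cnabla: "u \<simeq>\<^sub>C u' \<Longrightarrow> v \<simeq>\<^sub>C v' \<Longrightarrow> cnabla \<gg> u v \<simeq>\<^sub>C cnabla \<gg> u' v'"
  unfolding cnabla_eq_cbil by (rule eq_C_cbil[OF eq_S2_nabla])

lemma eq_C_cR: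
  assumes "u \<simeq>\<^sub>C u'" "v \<simeq>\<^sub>C v'" "w \<simeq>\<^sub>C w'"
  shows "cR \<gg> u v w \<simeq>\<^sub>C cR \<gg> u' v' w'"
proof -
  have "cnabla \<gg> u (cnabla \<gg> v w) \<simeq>\<^sub>C cnabla \<gg> u' (cnabla \<gg> v' w')"
    "cnabla \<gg> v (cnabla \<gg> u w) \<simeq>\<^sub>C cnabla \<gg> v' (cnabla \<gg> u' w')"
    "cnabla \<gg> (cbr u v) w \<simeq>\<^sub>C cnabla \<gg> (cbr u' v') w'"
    by (intro eq_C_cnabla eq_C_cbr assms)+
  then show ?thesis
    by (simp add: cR_def eq_C_def eq_S2_def cadd_def cneg_def fadd_def fscale_def)
qed

section \<open>Stream functions of fixed azimuthal order\<close>

definition stream :: "complex \<Rightarrow> nat \<Rightarrow> real poly \<Rightarrow> vec \<Rightarrow> real" where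
  "stream c M q p = Re (c * Complex (p$1) (p$2) ^ M) * poly q (p$3)"

abbreviation sfield :: "complex \<Rightarrow> nat \<Rightarrow> real poly \<Rightarrow> vf" where
  "sfield c M q \<equiv> sgrad (stream c M q)"

abbreviation csfield :: "complex \<Rightarrow> complex \<Rightarrow> nat \<Rightarrow> real poly \<Rightarrow> cvf" where
  "csfield c d M q \<equiv> (sfield c M q, sfield d M q)"

abbreviation real_zonal :: "real poly \<Rightarrow> cvf" where
  "real_zonal f \<equiv> (sfield 1 0 f, \<lambda>p. 0)"

lemma stream_add: "stream c M (q + r) = (\<lambda>p. stream c M q p + stream c M r p)"
  by (simp add: fun_eq_iff stream_def algebra_simps)

lemma stream_smult: "stream c M (smult a q) = (\<lambda>p. a * stream c M q p)"
  by (simp add: fun_eq_iff stream_def)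

lemma stream_0 [simp]: "stream c M 0 = (\<lambda>p. 0)"
  by (simp add: fun_eq_iff stream_def)

lemma stream_phase_uminus: "stream (- c) M q = (\<lambda>p. - stream c M q p)"
  by (simp add: fun_eq_iff stream_def algebra_simps)

lemma stream_zonal: "stream 1 0 q = (\<lambda>p. poly q (axis 3 1 \<bullet> p))"
  by (simp add: fun_eq_iff stream_def inner_axis')

lemma stream_Suc: "stream c (Suc M) q p = p$1 * stream c M q p + p$2 * stream (\<i> * c) M q p"
  by (simp add: stream_def algebra_simps)

lemma real_polynomial_function_stream [simp]: "real_polynomial_function (stream c M q)"
proof (induction M arbitrary: c)
  case 0
  then show ?case by (simp add: stream_def[abs_def])
next
  case (Suc M)
  have "real_polynomial_function (\<lambda>p. p$1 * stream c M q p + p$2 * stream (\<i> * c) M q p)"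
    by (simp add: Suc)
  then show ?case
    by (simp add: stream_Suc[abs_def])
qed

lemma sfield_add: "sfield c M (q + r) p = sfield c M q p + sfield c M r p"
  by (simp add: stream_add sgrad_add)

lemma sfield_smult: "sfield c M (smult a q) p = a *\<^sub>R sfield c M q p"
  by (simp add: stream_smult sgrad_cmult)

lemma sfield_phase_uminus: "sfield (- c) M q p = - sfield c M q p"
  by (simp add: stream_phase_uminus sgrad_uminus)

lemma sfield_uminus: "sfield c M (- q) p = - sfield c M q p"
  using sfield_smult[of c M "-1" q p] by simp

lemma sfield_diff: "sfield c M (q - r) p = sfield c M q p - sfield c M r p"
  using sfield_add[of c M q "- r" p] by (simp add: sfield_uminus)

lemma gradient_vec_nth: "gradient (\<lambda>p. p $ i) p = axis i 1"
  by (rule gradient_eqI) (auto intro!: derivative_eq_intros simp: inner_axis')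

lemma stream_euler:
  "real M * (p$1 * stream c (M - 1) q p + p$2 * stream (\<i> * c) (M - 1) q p) = real M * stream c M q p"
  by (cases M) (simp_all add: stream_Suc)

lemma gradient_stream: "gradient (stream c M q) p = vector
  [real M * stream c (M - 1) q p, real M * stream (\<i> * c) (M - 1) q p, stream c M (pderiv q) p]"
proof (induction M arbitrary: c)
  case 0
  have "stream c 0 q = (\<lambda>p. Re c * poly q (p$3))" for q
    by (simp add: fun_eq_iff stream_def)
  then show ?case
    by (simp add: gradient_cmult gradient_poly_compose gradient_vec_nth vec3_eq_iff axis_def)
next
  case (Suc M)
  have "gradient (stream c (Suc M) q) p = p$1 *\<^sub>R gradient (stream c M q) p + stream c M q p *\<^sub>R axis 1 1
      + (p$2 *\<^sub>R gradient (stream (\<i> * c) M q) p + stream (\<i> * c) M q p *\<^sub>R axis 2 1)"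
    by (simp add: stream_Suc[abs_def] gradient_add gradient_mult gradient_vec_nth)
  then show ?case
    using stream_euler[of M p c q, unfolded distrib_left] stream_euler[of M p "\<i> * c" q, unfolded distrib_left]
    by (simp add: Suc vec3_eq_iff axis_def stream_Suc[of _ _ "pderiv q"] distrib_right mult.left_commute)
qed

definition euler_poly :: "nat \<Rightarrow> real poly \<Rightarrow> real poly" where
  "euler_poly M q = smult (real M) q + [:0, 1:] * pderiv q"

lemma inner_gradient_stream: "gradient (stream c M q) p \<bullet> p = stream c M (euler_poly M q) p"
  using stream_euler[of M p c q]
  by (simp add: inner_vec3 gradient_stream euler_poly_def stream_add stream_smult algebra_simps)
     (simp add: stream_def)

definition legendre_op :: "nat \<Rightarrow> real poly \<Rightarrow> real poly" where
  "legendre_op M q = [:-1, 0, 1:] * pderiv (pderiv q) + smult (2 * (real M + 1)) ([:0, 1:] * pderiv q)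
     + smult (real M * (real M + 1)) q"

lemma poly_legendre_op:
  "poly (legendre_op M q) z = (z * z - 1) * poly (pderiv (pderiv q)) z
    + 2 * (real M + 1) * z * poly (pderiv q) z + real M * (real M + 1) * poly q z"
  by (simp add: legendre_op_def algebra_simps)

lemma legendre_op_add: "legendre_op M (q + r) = legendre_op M q + legendre_op M r"
  by (rule poly_ext) (simp add: poly_legendre_op pderiv_add algebra_simps)

lemma legendre_op_smult: "legendre_op M (smult a q) = smult a (legendre_op M q)"
  by (rule poly_ext) (simp add: poly_legendre_op pderiv_smult algebra_simps)

lemma legendre_op_0 [simp]: "legendre_op M 0 = 0"
  by (simp add: legendre_op_def)

lemma legendre_op_sum: "legendre_op M (\<Sum>i\<in>A. q i) = (\<Sum>i\<in>A. legendre_op M (q i))"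
  by (induction A rule: infinite_finite_induct) (simp_all add: legendre_op_add)

lemma laplace_S2_stream: "laplace_S2 (stream c M q) = stream c M (legendre_op M q)"
proof
  fix p
  have partial: "(\<lambda>x. gradient (stream c M q) x $ 1) = (\<lambda>x. real M * stream c (M - 1) q x)"
    "(\<lambda>x. gradient (stream c M q) x $ 2) = (\<lambda>x. real M * stream (\<i> * c) (M - 1) q x)"
    "(\<lambda>x. gradient (stream c M q) x $ 3) = stream c M (pderiv q)"
    by (simp_all add: fun_eq_iff gradient_stream)
  have "p \<bullet> hessian (stream c M q) p p = real M * (p$1 * stream c (M - 1) (euler_poly (M - 1) q) p
        + p$2 * stream (\<i> * c) (M - 1) (euler_poly (M - 1) q) p) + p$3 * stream c M (euler_poly M (pderiv q)) p"
    by (simp add: inner_vec3[of p] hessian_def partial gradient_cmult inner_gradient_stream algebra_simps)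
  then have radial: "p \<bullet> hessian (stream c M q) p p
      = stream c M (smult (real M) (euler_poly (M - 1) q) + [:0, 1:] * euler_poly M (pderiv q)) p"
    unfolding stream_euler by (simp add: stream_def algebra_simps)
  have trace: "(\<Sum>i\<in>UNIV. hessian (stream c M q) p (axis i 1) $ i) = stream c M (pderiv (pderiv q)) p"
    by (simp add: sum_3 hessian_def inner_axis partial gradient_cmult gradient_stream stream_phase_uminus)
  have "smult (real M) (euler_poly (M - 1) q) = smult (real M) (smult (real M - 1) q + [:0, 1:] * pderiv q)"
    by (cases M) (simp_all add: euler_poly_def)
  then show "laplace_S2 (stream c M q) p = stream c M (legendre_op M q) p"
    unfolding laplace_S2_def radial trace inner_commute[of p "gradient _ _"] inner_gradient_stream
    by (simp add: stream_def poly_legendre_op euler_poly_def algebra_simps)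
qed

lemma angular_deriv_stream:
  "angular_deriv (axis 3 1) (stream c M q) = stream (\<i> * c) M (smult (real M) q)"
proof
  fix p
  have "angular_deriv (axis 3 1) (stream c M q) p
      = real M * (p$1 * stream (\<i> * c) (M - 1) q p + p$2 * stream (\<i> * (\<i> * c)) (M - 1) q p)"
    unfolding poisson_def sgrad_inner_right
    by (simp add: inner_vec3 cross_components axis_def gradient_stream stream_phase_uminus algebra_simps)
  then show "angular_deriv (axis 3 1) (stream c M q) p = stream (\<i> * c) M (smult (real M) q) p"
    unfolding stream_euler by (simp add: stream_smult)
qed

lemma poisson_zonal_stream:
  "poisson (stream 1 0 f) (stream c M q) = stream (\<i> * c) M (smult (real M) (pderiv f * q))"
  unfolding stream_zonal poisson_poly_axis[abs_def] angular_deriv_stream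
  by (simp add: fun_eq_iff stream_def inner_axis')

lemma br_zonal_sfield:
  "br (sfield 1 0 f) (sfield c M q) \<simeq> sfield (\<i> * c) M (smult (real M) (pderiv f * q))"
  using br_sgrad[of "stream 1 0 f" "stream c M q"] by (simp add: poisson_zonal_stream)

lemma sphere_integral_stream_eq_0:
  assumes "M \<noteq> 0"
  shows "sphere_integral (stream c M q) = 0"
proof -
  have "sphere_integral (angular_deriv (axis 3 1) (stream (- (\<i> * c)) M q)) = 0"
    unfolding poisson_def[abs_def] by (intro sphere_integral_gradient_along sgrad_in_sdiff_S2) simp_all
  then show ?thesis
    using assms by (simp add: angular_deriv_stream stream_smult sphere_integral_cmult)
qed

definition stream_polys :: "vf set \<Rightarrow> nat \<Rightarrow> real poly set" where
  "stream_polys \<gg> M = {q. \<forall>c. stream c M q \<in> stream_functions \<gg>}"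

lemma stream_polys_smult: "q \<in> stream_polys \<gg> M \<Longrightarrow> smult a q \<in> stream_polys \<gg> M"
  by (simp add: stream_polys_def stream_smult stream_functions_cmult)

lemma stream_polys_0: "q \<in> stream_polys \<gg> M \<Longrightarrow> 0 \<in> stream_polys \<gg> N"
  by (auto simp: stream_polys_def stream_functions_def)

lemma stream_polys_add:
  "q \<in> stream_polys \<gg> M \<Longrightarrow> r \<in> stream_polys \<gg> M \<Longrightarrow> q + r \<in> stream_polys \<gg> M"
  by (auto simp: stream_polys_def stream_add stream_functions_def)

lemma stream_polys_sum:
  assumes "finite A" "A \<noteq> {}" "\<And>i. i \<in> A \<Longrightarrow> q i \<in> stream_polys \<gg> M"
  shows "(\<Sum>i\<in>A. q i) \<in> stream_polys \<gg> M"
  using assms by (induction A rule: finite_ne_induct) (auto intro: stream_polys_add)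

lemma stream_antipodal:
  assumes "poly q (- (p$3)) = a * poly q (p$3)"
  shows "stream c M q (- p) = (-1) ^ M * a * stream c M q p"
proof (induction M arbitrary: c)
  case 0
  then show ?case
    using assms by (simp add: stream_def)
qed (simp add: stream_Suc algebra_simps)

text \<open>For M = 0 the polynomials r and s do not matter: the left-hand sides of the two equations then only
  depend on the height, and the corresponding one-forms are exact.\<close>

lemma nabla_zonal_stream:
  assumes eigen: "legendre_op 0 f = smult \<mu> f"
    and r: "M = 0 \<or> legendre_op M r = pderiv f * q" "r \<in> stream_polys \<gg> M"
    and s: "M = 0 \<or> legendre_op M s = pderiv f * legendre_op M q" "s \<in> stream_polys \<gg> M"
  shows "nabla \<gg> (sfield 1 0 f) (sfield c M q)
      \<simeq> sfield (\<i> * c) M (smult (real M / 2) (pderiv f * q - smult \<mu> r + s))"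
    and "nabla \<gg> (sfield c M q) (sfield 1 0 f)
      \<simeq> sfield (\<i> * c) M (smult (real M / 2) (- (pderiv f * q) - smult \<mu> r + s))"
proof -
  define t where "t h r = (if M = 0 then smult (Re c) (h - legendre_op M r) else 0)" for h r
  have decompose: "stream c M h p = laplace_S2 (stream c M r) p + poly (t h r) (axis 3 1 \<bullet> p)"
    if "M = 0 \<or> legendre_op M r = h" for h r p
    using that by (auto simp: t_def laplace_S2_stream stream_def inner_axis' algebra_simps)
  have streams: "angular_deriv (axis 3 1) (stream c M q) \<in> stream_functions \<gg>" if "q \<in> stream_polys \<gg> M" for q
    using stream_polys_smult[OF that] by (simp add: angular_deriv_stream stream_polys_def)
  have profile: "poly h (axis 3 1 \<bullet> p) * stream c M q p = stream c M (h * q) p" for h q p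
    by (simp add: stream_def inner_axis')
  have eigen_f: "laplace_S2 (\<lambda>p. poly f (axis 3 1 \<bullet> p)) p = \<mu> * poly f (axis 3 1 \<bullet> p)" for p
    using fun_cong[OF laplace_S2_stream[of 1 0 f]] by (simp add: eigen stream_smult stream_zonal)
  have r_eq: "poly (pderiv f) (axis 3 1 \<bullet> p) * stream c M q p
      = laplace_S2 (stream c M r) p + poly (t (pderiv f * q) r) (axis 3 1 \<bullet> p)" for p
    unfolding profile by (rule decompose[OF r(1)])
  have s_eq: "poly (pderiv f) (axis 3 1 \<bullet> p) * laplace_S2 (stream c M q) p
      = laplace_S2 (stream c M s) p + poly (t (pderiv f * legendre_op M q) s) (axis 3 1 \<bullet> p)" for p
    unfolding laplace_S2_stream[of c M q] profile by (rule decompose[OF s(1)])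
  note nabla = nabla_axial[OF eigen_f _ _ _ streams[OF r(2)] streams[OF s(2)] r_eq s_eq, folded stream_zonal]
  show "nabla \<gg> (sfield 1 0 f) (sfield c M q)
      \<simeq> sfield (\<i> * c) M (smult (real M / 2) (pderiv f * q - smult \<mu> r + s))"
    "nabla \<gg> (sfield c M q) (sfield 1 0 f)
      \<simeq> sfield (\<i> * c) M (smult (real M / 2) (- (pderiv f * q) - smult \<mu> r + s))"
    using nabla by (simp_all add: poisson_zonal_stream angular_deriv_stream eq_S2_def
        sfield_add sfield_diff sfield_smult sfield_uminus algebra_simps)
qed

section \<open>Associated Legendre functions\<close>

definition rodrigues :: "nat \<Rightarrow> real poly" where
  "rodrigues n = smult (1 / (2 ^ n * fact n)) ([:-1, 0, 1:] ^ n)"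

text \<open>The polynomial factor of the associated Legendre function of degree k and order M; the zero
  convention for k < 0 makes the three-term recurrence valid from k = 0 on.\<close>

definition leg :: "nat \<Rightarrow> int \<Rightarrow> real poly" where
  "leg M k = (if k < 0 then 0 else (pderiv ^^ (nat k + M)) (rodrigues (nat k)))"

lemma leg_int: "leg M (int n) = (pderiv ^^ (n + M)) (rodrigues n)"
  by (simp add: leg_def)

lemma pderiv_rodrigues_Suc: "pderiv (rodrigues (Suc n)) = [:0, 1:] * rodrigues n"
  by (simp add: rodrigues_def pderiv_smult pderiv_power_Suc pderiv_pCons smult_add_left[symmetric] field_simps
      del: power_Suc of_nat_Suc) simp

lemma rodrigues_Suc: "[:-1, 0, 1:] * rodrigues n = smult (2 * real n + 2) (rodrigues (Suc n))"
proof -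
  have "1 / (2 ^ n * fact n) = (2 * real n + 2) * (1 / (2 ^ Suc n * fact (Suc n)))"
    by (simp add: divide_simps)
  then show ?thesis
    by (simp only: rodrigues_def mult_smult_right smult_smult power_Suc)
qed

lemma rodrigues_ode: "[:-1, 0, 1:] * pderiv (rodrigues n) = smult (2 * real n) ([:0, 1:] * rodrigues n)"
proof (cases n)
  case 0
  then show ?thesis by (simp add: rodrigues_def)
next
  case (Suc j)
  have "[:-1, 0, 1:] * pderiv (rodrigues n) = [:0, 1:] * ([:-1, 0, 1:] * rodrigues j)"
    unfolding Suc pderiv_rodrigues_Suc by (rule mult.left_commute)
  also have "\<dots> = smult (2 * real n) ([:0, 1:] * rodrigues n)"
    unfolding rodrigues_Suc by (simp add: Suc add.commute)
  finally show ?thesis .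
qed

lemma pderiv_pderiv_rodrigues:
  "pderiv (pderiv (rodrigues (Suc n))) = smult (2 * real n + 1) (rodrigues n)
     + (if n = 0 then 0 else rodrigues (n - 1))"
proof (cases n)
  case 0
  then show ?thesis
    by (simp add: pderiv_rodrigues_Suc) (simp add: rodrigues_def pderiv_pCons)
next
  case (Suc j)
  have "[:0, 1:] * ([:0, 1:] * rodrigues j) = [:-1, 0, 1:] * rodrigues j + rodrigues j"
    by (rule poly_ext) (simp add: algebra_simps)
  also have "\<dots> = smult (2 * real j + 2) (rodrigues n) + rodrigues j"
    by (simp only: rodrigues_Suc Suc)
  finally have x_x_mult: "[:0, 1:] * ([:0, 1:] * rodrigues j)
      = smult (2 * real j + 2) (rodrigues n) + rodrigues j" .
  have "pderiv (pderiv (rodrigues (Suc n))) = rodrigues n + [:0, 1:] * ([:0, 1:] * rodrigues j)"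
    unfolding pderiv_rodrigues_Suc pderiv_mult by (simp add: pderiv_pCons Suc pderiv_rodrigues_Suc)
  also have "\<dots> = smult (2 * real n + 1) (rodrigues n) + rodrigues j"
    unfolding x_x_mult by (rule poly_ext) (simp add: Suc algebra_simps)
  finally show ?thesis
    by (simp add: Suc)
qed

lemma higher_pderiv_diff: "(pderiv ^^ n) (p - q) = (pderiv ^^ n) p - (pderiv ^^ n) q" for p q :: "'a::idom poly"
  by (induction n) (simp_all add: pderiv_diff)

lemma higher_pderiv_x_mult:
  "(pderiv ^^ n) ([:0, 1:] * f) = [:0, 1:] * (pderiv ^^ n) f + smult (of_nat n) ((pderiv ^^ (n - 1)) f)"
  for f :: "'a::idom poly"
proof (induction n)
  case (Suc n)
  have "pderiv ((pderiv ^^ n) ([:0, 1:] * f)) = [:0, 1:] * pderiv ((pderiv ^^ n) f) + (pderiv ^^ n) f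
      + smult (of_nat n) (pderiv ((pderiv ^^ (n - 1)) f))"
    unfolding Suc by (simp add: pderiv_add pderiv_smult pderiv_pCons)
  also have "smult (of_nat n) (pderiv ((pderiv ^^ (n - 1)) f)) = smult (of_nat n) ((pderiv ^^ n) f)"
    by (cases n) simp_all
  finally show ?case
    by (simp add: smult_add_left add.commute)
qed simp

lemma leg_succ:
  "leg M (int n + 1) = [:0, 1:] * leg M (int n) + smult (real (n + M)) ((pderiv ^^ (n + M - 1)) (rodrigues n))"
proof -
  have "leg M (int n + 1) = (pderiv ^^ (n + M)) (pderiv (rodrigues (Suc n)))"
    using leg_int[of M "Suc n"] by (simp add: funpow_swap1 add.commute)
  then show ?thesis
    by (simp only: pderiv_rodrigues_Suc higher_pderiv_x_mult leg_int)
qed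

lemma leg_succ_diff_pred:
  assumes "n + M \<noteq> 0"
  shows "leg M (int n + 1) - leg M (int n - 1) = smult (2 * real n + 1) ((pderiv ^^ (n + M - 1)) (rodrigues n))"
proof -
  have "leg M (int n + 1) = (pderiv ^^ (n + M - 1)) (pderiv (pderiv (rodrigues (Suc n))))"
    using leg_int[of M "Suc n"] assms by (cases "n + M") (simp_all add: funpow_swap1 add.commute)
  also have "\<dots> = smult (2 * real n + 1) ((pderiv ^^ (n + M - 1)) (rodrigues n))
      + (pderiv ^^ (n + M - 1)) (if n = 0 then 0 else rodrigues (n - 1))"
    unfolding pderiv_pderiv_rodrigues by (simp add: higher_pderiv_add higher_pderiv_smult)
  also have "(pderiv ^^ (n + M - 1)) (if n = 0 then 0 else rodrigues (n - 1)) = leg M (int n - 1)"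
    by (cases n) (simp_all add: leg_def)
  finally show ?thesis by simp
qed

lemma leg_recurrence:
  assumes "k \<ge> 0"
  shows "smult (2 * of_int k + 1) ([:0, 1:] * leg M k)
    = smult (of_int k + 1 - real M) (leg M (k + 1)) + smult (of_int k + real M) (leg M (k - 1))"
proof -
  obtain n where k: "k = int n"
    using assms zero_le_imp_eq_int by blast
  let ?D = "(pderiv ^^ (n + M - 1)) (rodrigues n)"
  have diff: "smult (real (n + M)) (leg M (k + 1) - leg M (k - 1))
      = smult (real (n + M)) (smult (2 * real n + 1) ?D)"
    using leg_succ_diff_pred[of n M]
    by (cases "n + M = 0") (simp add: k, simp only: k not_False_eq_True simp_thms)
  have "smult (2 * real n + 1) ([:0, 1:] * leg M k)
      = smult (2 * real n + 1) (leg M (k + 1)) - smult (real (n + M)) (smult (2 * real n + 1) ?D)"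
    unfolding k leg_succ by (simp add: smult_add_right mult.commute)
  also have "\<dots> = smult (real n + 1 - real M) (leg M (k + 1)) + smult (real n + real M) (leg M (k - 1))"
    unfolding diff[symmetric] by (rule poly_ext) (simp add: algebra_simps)
  finally show ?thesis
    by (simp add: k)
qed

definition eigval :: "int \<Rightarrow> real" where
  "eigval k = of_int k * (of_int k + 1)"

lemma legendre_op_leg: "legendre_op M (leg M k) = smult (eigval k) (leg M k)"
proof (cases "k < 0")
  case False
  then obtain n where k: "k = int n"
    by (metis linorder_not_less zero_le_imp_eq_int)
  define N where "N = n + M"
  let ?V = "rodrigues n" and ?y = "leg M k" and ?x = "[:0, 1:] :: real poly"
  have y: "(pderiv ^^ N) ?V = ?y"
    by (simp add: leg_def N_def k)
  have derivs: "(pderiv ^^ Suc N) ?V = pderiv ?y" "(pderiv ^^ N) (pderiv ?V) = pderiv ?y"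
    "(pderiv ^^ Suc N) (pderiv ?V) = pderiv (pderiv ?y)"
    by (simp_all add: y[symmetric] funpow_swap1)
  have low: "smult (real N) ((pderiv ^^ (N - 1)) (pderiv ?V)) = smult (real N) ?y"
    by (cases N) (simp_all add: y[symmetric] funpow_swap1)
  have "?x * (?x * pderiv ?V) - pderiv ?V = [:-1, 0, 1:] * pderiv ?V"
    by (rule poly_ext) (simp add: algebra_simps)
  then have "(pderiv ^^ Suc N) (?x * (?x * pderiv ?V) - pderiv ?V)
      = (pderiv ^^ Suc N) (smult (2 * real n) (?x * ?V))"
    by (simp only: rodrigues_ode)
  then have "?x * (?x * pderiv (pderiv ?y) + smult (real (Suc N)) (pderiv ?y))
        + smult (real (Suc N)) (?x * pderiv ?y + smult (real N) ?y) - pderiv (pderiv ?y)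
      = smult (2 * real n) (?x * pderiv ?y + smult (real (Suc N)) ?y)"
    by (simp only: higher_pderiv_diff higher_pderiv_smult higher_pderiv_x_mult derivs low y diff_Suc_1)
  from arg_cong[OF this, of poly] show ?thesis
    by (intro poly_ext) (simp add: fun_eq_iff poly_legendre_op eigval_def k N_def algebra_simps)
qed (simp add: leg_def)

lemma poly_pderiv_parity:
  fixes q :: "real poly"
  assumes "\<And>z. poly q (- z) = a * poly q z"
  shows "poly (pderiv q) (- z) = - a * poly (pderiv q) z"
proof -
  have "pcompose q [:0, -1:] = smult a q"
    by (rule poly_ext) (simp add: poly_pcompose assms)
  then have "poly (pderiv (pcompose q [:0, -1:])) z = poly (pderiv (smult a q)) z"
    by simp
  then show ?thesis
    by (simp add: pderiv_pcompose poly_pcompose pderiv_smult pderiv_pCons)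
qed

lemma leg_parity: "poly (leg M k) (- z) = (-1) ^ (nat k + M) * poly (leg M k) z"
proof -
  have "poly ((pderiv ^^ n) (rodrigues j)) (- z) = (-1) ^ n * poly ((pderiv ^^ n) (rodrigues j)) z" for n j z
  proof (induction n arbitrary: z)
    case 0
    then show ?case by (simp add: rodrigues_def)
  next
    case (Suc n)
    show ?case
      using poly_pderiv_parity[OF Suc] by simp
  qed
  then show ?thesis
    by (simp add: leg_def)
qed

lemma leg_in_stream_polys:
  assumes "\<gg> = sdiff_S2 \<or> \<gg> = sdiff_RP2 \<and> odd k"
  shows "leg M k \<in> stream_polys \<gg> M"
proof -
  have "stream c M (leg M k) (- p) = - stream c M (leg M k) p" if "odd k" for c p
  proof (cases "k < 0")
    case False
    then have "odd (nat k)"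
      using that by (simp add: even_nat_iff)
    then have "(-1) ^ M * (-1) ^ (nat k + M) = (-1 :: real)"
      by (simp add: power_add)
    then show ?thesis
      using stream_antipodal[OF leg_parity, of c M M k p] by simp
  qed (simp add: leg_def)
  then show ?thesis
    using assms by (auto simp: stream_polys_def stream_functions_def)
qed

lemma leg_eq_0:
  assumes "M \<noteq> 0" "k \<ge> -1" "eigval k = 0"
  shows "leg M k = 0"
proof -
  have "real_of_int k = 0 \<or> real_of_int k + 1 = 0"
    using assms(3) by (simp add: eigval_def)
  then consider "k = -1" | "k = 0"
    by linarith
  then show ?thesis
  proof cases
    case 2
    obtain n where "M = Suc n"
      using assms(1) not0_implies_Suc by blast
    then show ?thesis
      by (simp add: 2 leg_def rodrigues_def funpow_swap1)
  qed (simp add: leg_def)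
qed

section \<open>The covariant derivative in the Legendre basis\<close>

definition leg_up :: "nat \<Rightarrow> int \<Rightarrow> real" where
  "leg_up M k = (of_int k + 1 - real M) / (2 * of_int k + 1)"

definition leg_down :: "nat \<Rightarrow> int \<Rightarrow> real" where
  "leg_down M k = (of_int k + real M) / (2 * of_int k + 1)"

lemma x_mult_poly_leg:
  assumes "k \<ge> 0"
  shows "z * poly (leg M k) z = leg_up M k * poly (leg M (k + 1)) z + leg_down M k * poly (leg M (k - 1)) z"
proof -
  have "(2 * of_int k + 1) * (z * poly (leg M k) z)
      = (of_int k + 1 - real M) * poly (leg M (k + 1)) z + (of_int k + real M) * poly (leg M (k - 1)) z"
    using arg_cong[OF leg_recurrence[OF assms, of M], of "\<lambda>p. poly p z"] by (simp add: mult.left_commute)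
  moreover have "2 * of_int k + 1 \<noteq> (0::real)"
    using assms by linarith
  ultimately show ?thesis
    by (simp add: leg_up_def leg_down_def divide_simps) (simp add: algebra_simps)
qed

definition leg_sum :: "nat \<Rightarrow> int set \<Rightarrow> (int \<Rightarrow> real) \<Rightarrow> real poly" where
  "leg_sum M J a = (\<Sum>k\<in>J. smult (a k) (leg M k))"

lemma legendre_op_leg_sum: "legendre_op M (leg_sum M J a) = leg_sum M J (\<lambda>k. a k * eigval k)"
  by (simp add: leg_sum_def legendre_op_sum legendre_op_smult legendre_op_leg)

text \<open>Up to a constant, the angular velocity of the field of degree 3 and order 0.\<close>

abbreviation profile :: "real poly" where
  "profile \<equiv> [:-1, 0, 5:]"

abbreviation neighbours :: "int \<Rightarrow> int set" where
  "neighbours k \<equiv> {k - 2, k, k + 2}"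

definition profile_coeff :: "nat \<Rightarrow> int \<Rightarrow> int \<Rightarrow> real" where
  "profile_coeff M k j =
     (if j = k + 2 then 5 * leg_up M k * leg_up M (k + 1)
      else if j = k then 5 * (leg_up M k * leg_down M (k + 1) + leg_down M k * leg_up M (k - 1)) - 1
      else if j = k - 2 then 5 * leg_down M k * leg_down M (k - 1)
      else 0)"

lemma profile_mult_leg:
  assumes "k \<ge> 1"
  shows "profile * leg M k = leg_sum M (neighbours k) (profile_coeff M k)"
proof (rule poly_ext)
  fix z
  have "poly (profile * leg M k) z = 5 * (z * (z * poly (leg M k) z)) - poly (leg M k) z"
    by (simp add: algebra_simps)
  also have "z * poly (leg M k) z = leg_up M k * poly (leg M (k + 1)) z + leg_down M k * poly (leg M (k - 1)) z"
    using assms by (intro x_mult_poly_leg) simp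
  also have "z * \<dots> = leg_up M k * (z * poly (leg M (k + 1)) z) + leg_down M k * (z * poly (leg M (k - 1)) z)"
    by (simp add: algebra_simps)
  also have "z * poly (leg M (k + 1)) z
      = leg_up M (k + 1) * poly (leg M (k + 2)) z + leg_down M (k + 1) * poly (leg M k) z"
    using x_mult_poly_leg[of "k + 1" z M] assms by (simp add: add.assoc)
  also have "z * poly (leg M (k - 1)) z
      = leg_up M (k - 1) * poly (leg M k) z + leg_down M (k - 1) * poly (leg M (k - 2)) z"
    using x_mult_poly_leg[of "k - 1" z M] assms by simp
  finally show "poly (profile * leg M k) z = poly (leg_sum M (neighbours k) (profile_coeff M k)) z"
    by (simp add: leg_sum_def profile_coeff_def algebra_simps)
qed

lemma smult_sum_right: "smult a (\<Sum>i\<in>A. f i) = (\<Sum>i\<in>A. smult a (f i))"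
  by (induction A rule: infinite_finite_induct) (simp_all add: smult_add_right)

definition inv_profile :: "nat \<Rightarrow> int \<Rightarrow> real poly" where
  "inv_profile M k = leg_sum M (neighbours k) (\<lambda>j. profile_coeff M k j / eigval j)"

lemma legendre_op_inv_profile:
  assumes "M \<noteq> 0" "k \<ge> 1"
  shows "legendre_op M (inv_profile M k) = profile * leg M k"
  unfolding inv_profile_def legendre_op_leg_sum profile_mult_leg[OF assms(2)]
  unfolding leg_sum_def
proof (rule sum.cong[OF refl])
  fix j assume "j \<in> neighbours k"
  then have "eigval j = 0 \<Longrightarrow> leg M j = 0"
    using assms by (intro leg_eq_0) auto
  then show "smult (profile_coeff M k j / eigval j * eigval j) (leg M j) = smult (profile_coeff M k j) (leg M j)"
    by (cases "eigval j = 0") simp_all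
qed

lemma inv_profile_in_stream_polys:
  assumes "\<And>j. j \<in> neighbours k \<Longrightarrow> leg M j \<in> stream_polys \<gg> M"
  shows "inv_profile M k \<in> stream_polys \<gg> M"
  unfolding inv_profile_def leg_sum_def by (intro stream_polys_sum stream_polys_smult assms) auto

text \<open>The sign \<open>\<epsilon>\<close> is that of the Lie bracket, the only difference between the covariant derivatives of the
  mode along the zonal flow and of the flow along the mode.\<close>

definition nabla_coeff :: "real \<Rightarrow> nat \<Rightarrow> real \<Rightarrow> int \<Rightarrow> int \<Rightarrow> real" where
  "nabla_coeff \<epsilon> M \<mu> k j = profile_coeff M k j * (\<epsilon> + (eigval k - \<mu>) / eigval j)"

lemma profile_inv_profile_combination:
  assumes "k \<ge> 1"
  shows "smult \<epsilon> (profile * leg M k) + smult (eigval k - \<mu>) (inv_profile M k)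
    = leg_sum M (neighbours k) (nabla_coeff \<epsilon> M \<mu> k)"
  unfolding profile_mult_leg[OF assms] inv_profile_def leg_sum_def smult_sum_right sum.distrib[symmetric]
  by (rule sum.cong[OF refl]) (simp add: nabla_coeff_def smult_add_left[symmetric] algebra_simps)

definition neighbour_sum :: "nat \<Rightarrow> int set \<Rightarrow> (int \<Rightarrow> int \<Rightarrow> real) \<Rightarrow> real poly" where
  "neighbour_sum M J w = (\<Sum>k\<in>J. leg_sum M (neighbours k) (w k))"

lemma profile_mult_leg_sum: "profile * leg_sum M J a = (\<Sum>k\<in>J. smult (a k) (profile * leg M k))"
  unfolding leg_sum_def sum_distrib_left mult_smult_right by (rule refl)

lemma legendre_op_inv_profile_sum:
  assumes "M \<noteq> 0" "\<And>k. k \<in> J \<Longrightarrow> k \<ge> 1"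
  shows "legendre_op M (\<Sum>k\<in>J. smult (a k) (inv_profile M k)) = profile * leg_sum M J a"
  unfolding profile_mult_leg_sum legendre_op_smult legendre_op_sum
  by (rule sum.cong[OF refl]) (simp only: legendre_op_inv_profile[OF assms(1,2)])

lemma profile_inv_profile_sum_combination:
  assumes "\<And>k. k \<in> J \<Longrightarrow> k \<ge> 1"
  shows "smult \<epsilon> (profile * leg_sum M J a) - smult \<mu> (\<Sum>k\<in>J. smult (a k) (inv_profile M k))
      + (\<Sum>k\<in>J. smult (a k * eigval k) (inv_profile M k))
    = neighbour_sum M J (\<lambda>k j. a k * nabla_coeff \<epsilon> M \<mu> k j)"
proof -
  have "smult \<epsilon> (profile * leg_sum M J a) - smult \<mu> (\<Sum>k\<in>J. smult (a k) (inv_profile M k))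
      + (\<Sum>k\<in>J. smult (a k * eigval k) (inv_profile M k))
      = (\<Sum>k\<in>J. smult (a k) (smult \<epsilon> (profile * leg M k) + smult (eigval k - \<mu>) (inv_profile M k)))"
    unfolding profile_mult_leg_sum
    by (rule poly_ext) (simp add: poly_sum sum_distrib_left sum.distrib sum_subtractf algebra_simps)
  then show ?thesis
    by (simp only: profile_inv_profile_combination[OF assms] neighbour_sum_def leg_sum_def smult_sum_right
        smult_smult cong: sum.cong)
qed

lemma nabla_zonal_leg_sum:
  assumes f: "legendre_op 0 f = smult \<mu> f" "pderiv f = smult \<kappa> profile"
    and J: "finite J" "J \<noteq> {}" "\<And>k. k \<in> J \<Longrightarrow> k \<ge> 1"
    and leg: "\<And>k j. k \<in> J \<Longrightarrow> j \<in> neighbours k \<Longrightarrow> leg M j \<in> stream_polys \<gg> M"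
  shows "nabla \<gg> (sfield 1 0 f) (sfield c M (leg_sum M J a))
      \<simeq> sfield (\<i> * c) M (smult (real M / 2 * \<kappa>) (neighbour_sum M J (\<lambda>k j. a k * nabla_coeff 1 M \<mu> k j)))"
    and "nabla \<gg> (sfield c M (leg_sum M J a)) (sfield 1 0 f)
      \<simeq> sfield (\<i> * c) M (smult (real M / 2 * \<kappa>) (neighbour_sum M J (\<lambda>k j. a k * nabla_coeff (-1) M \<mu> k j)))"
proof -
  define r s where "r = (\<Sum>k\<in>J. smult (a k) (inv_profile M k))"
    and "s = (\<Sum>k\<in>J. smult (a k * eigval k) (inv_profile M k))"
  have inverse: "M = 0 \<or> legendre_op M (smult \<kappa> (\<Sum>k\<in>J. smult (b k) (inv_profile M k)))
      = pderiv f * leg_sum M J b" for b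
    using legendre_op_inv_profile_sum[of M J b, OF _ J(3)] by (metis f(2) legendre_op_smult mult_smult_left)
  have r: "M = 0 \<or> legendre_op M (smult \<kappa> r) = pderiv f * leg_sum M J a"
    and s: "M = 0 \<or> legendre_op M (smult \<kappa> s) = pderiv f * legendre_op M (leg_sum M J a)"
    unfolding r_def s_def legendre_op_leg_sum by (rule inverse)+
  have mem: "smult \<kappa> r \<in> stream_polys \<gg> M" "smult \<kappa> s \<in> stream_polys \<gg> M"
    unfolding r_def s_def
    by (intro stream_polys_smult stream_polys_sum inv_profile_in_stream_polys leg J(1,2); assumption)+
  have expansion: "smult \<epsilon> (profile * leg_sum M J a) - smult \<mu> r + s
      = neighbour_sum M J (\<lambda>k j. a k * nabla_coeff \<epsilon> M \<mu> k j)" for \<epsilon>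
    unfolding r_def s_def using J(3) by (rule profile_inv_profile_sum_combination)
  have combination: "smult (real M / 2) (smult \<epsilon> (pderiv f * leg_sum M J a) - smult \<mu> (smult \<kappa> r) + smult \<kappa> s)
      = smult (real M / 2 * \<kappa>) (neighbour_sum M J (\<lambda>k j. a k * nabla_coeff \<epsilon> M \<mu> k j))" for \<epsilon>
    unfolding expansion[symmetric] f(2) by (rule poly_ext) (simp add: algebra_simps)
  show "nabla \<gg> (sfield 1 0 f) (sfield c M (leg_sum M J a))
      \<simeq> sfield (\<i> * c) M (smult (real M / 2 * \<kappa>) (neighbour_sum M J (\<lambda>k j. a k * nabla_coeff 1 M \<mu> k j)))"
    using nabla_zonal_stream(1)[OF f(1) r mem(1) s mem(2), of c] combination[of 1] by simp
  show "nabla \<gg> (sfield c M (leg_sum M J a)) (sfield 1 0 f)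
      \<simeq> sfield (\<i> * c) M (smult (real M / 2 * \<kappa>) (neighbour_sum M J (\<lambda>k j. a k * nabla_coeff (-1) M \<mu> k j)))"
    using nabla_zonal_stream(2)[OF f(1) r mem(1) s mem(2), of c] combination[of "-1"] by simp
qed

section \<open>The basis fields\<close>

lemma islimpt_S2_diff_poles:
  assumes "p \<in> S2"
  shows "p islimpt (S2 - poles)"
proof -
  have "poles \<subseteq> {axis 3 1, - axis 3 1}"
  proof
    fix q assume "q \<in> poles"
    then have "q$1 * q$1 + q$2 * q$2 = 0" "q$3 = 1 \<or> q$3 = -1"
      by (auto simp: poles_def S2_iff_coords)
    then show "q \<in> {axis 3 1, - axis 3 1}"
      by (auto simp: vec3_eq_iff axis_def sum_squares_eq_zero_iff)
  qed
  then have "finite poles"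
    using finite_subset by blast
  have "connected S2"
    unfolding S2_def by (rule connected_sphere) simp
  moreover have "axis 3 1 \<in> S2" "- axis 3 1 \<in> S2"
    by (simp_all add: S2_def)
  moreover have "axis 3 1 \<noteq> (- axis 3 1 :: vec)"
    by (simp add: vec3_eq_iff axis_def)
  ultimately have "connected S2 \<and> S2 \<noteq> {x}" for x
    by (metis singletonD)
  then have "p islimpt S2"
    using connected_imp_perfect assms by blast
  then have "p islimpt (poles \<union> (S2 - poles))"
    by (rule islimpt_subset) auto
  then show ?thesis
    using islimpt_Un_finite[OF \<open>finite poles\<close>] by blast
qed

lemma spherical_coordinates_off_poles:
  assumes "\<And>\<theta> \<phi>. 0 < \<theta> \<Longrightarrow> \<theta> < pi \<Longrightarrow> W \<theta> \<phi> = F (sph \<theta> \<phi>)" "q \<in> S2 - poles"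
  shows "W (arccos (q$3)) (Arg (Complex (q$1) (q$2))) = F q"
proof -
  have "-1 < q$3" "q$3 < 1"
    using S2_coord_bounds[of q 3] assms(2) by (auto simp: poles_def less_le)
  then have "0 < arccos (q$3)" "arccos (q$3) < pi"
    using arccos_lt_bounded by blast+
  then show ?thesis
    using assms S2_eq_sph[of q] by auto
qed

lemma field_of_sph_eq:
  assumes W: "\<And>\<theta> \<phi>. 0 < \<theta> \<Longrightarrow> \<theta> < pi \<Longrightarrow> W \<theta> \<phi> = F (sph \<theta> \<phi>)" and F: "continuous_on S2 F"
  shows "field_of_sph W \<simeq> F"
  unfolding eq_S2_def
proof
  fix p assume p: "p \<in> S2"
  note off = spherical_coordinates_off_poles[of W F, OF W]
  let ?W = "\<lambda>q. W (arccos (q$3)) (Arg (Complex (q$1) (q$2)))" and ?at = "at p within (S2 - poles)"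
  show "field_of_sph W p = F p"
  proof (cases "p \<in> poles")
    case False
    then show ?thesis
      using off p by (simp add: field_of_sph_def)
  next
    case True
    have "(F \<longlongrightarrow> F p) ?at"
      using F p unfolding continuous_on_def by (meson Diff_subset tendsto_within_subset)
    then have "(?W \<longlongrightarrow> F p) ?at"
      by (rule Lim_transform_eventually) (auto simp: eventually_at_filter off intro!: always_eventually)
    then have "Lim ?at ?W = F p"
      using islimpt_S2_diff_poles[OF p] by (intro tendsto_Lim) (simp_all add: trivial_limit_within)
    then show ?thesis
      using True by (simp add: field_of_sph_def)
  qed
qed

lemma sgrad_sph_eq:
  assumes f: "real_polynomial_function f"
    and h: "\<And>\<theta> \<phi>. 0 < \<theta> \<Longrightarrow> \<theta> < pi \<Longrightarrow> h \<theta> \<phi> = f (sph \<theta> \<phi>)" and \<theta>: "0 < \<theta>" "\<theta> < pi"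
  shows "sgrad_sph h \<theta> \<phi> = sgrad f (sph \<theta> \<phi>)"
proof -
  let ?p = "sph \<theta> \<phi>"
  note deriv = has_vector_derivative_compose_sph[of f "\<lambda>p v. gradient f p \<bullet> v", OF has_derivative_gradient[OF f],
      folded has_real_derivative_iff_has_vector_derivative]
  have "h \<theta> = (\<lambda>t. f (sph \<theta> t))"
    using h \<theta> by auto
  then have d\<phi>: "deriv (\<lambda>t. h \<theta> t) \<phi> = gradient f ?p \<bullet> dph \<theta> \<phi>"
    using deriv(2) by (simp add: DERIV_imp_deriv)
  have "((\<lambda>t. h t \<phi>) has_real_derivative gradient f ?p \<bullet> dth \<theta> \<phi>) (at \<theta>)"
    by (rule has_field_derivative_transform_within_open[OF deriv(1), of "{0<..<pi}"]) (use h \<theta> in auto)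
  then have d\<theta>: "deriv (\<lambda>t. h t \<phi>) \<theta> = gradient f ?p \<bullet> dth \<theta> \<phi>"
    by (rule DERIV_imp_deriv)
  have "dth \<theta> \<phi> \<times> dph \<theta> \<phi> = sin \<theta> *\<^sub>R ?p"
  proof -
    have "cos \<phi> * cos \<phi> + sin \<phi> * sin \<phi> = 1"
      using sin_cos_squared_add[of \<phi>] by (simp add: power2_eq_square)
    then have "cos \<phi> * (cos \<phi> * (cos \<theta> * sin \<theta>)) + cos \<theta> * (sin \<phi> * (sin \<phi> * sin \<theta>)) = cos \<theta> * sin \<theta>"
      by algebra
    then show ?thesis
      by (simp add: vec3_eq_iff cross_components dth_def dph_def sph_def algebra_simps)
  qed
  then have "(gradient f ?p \<bullet> dph \<theta> \<phi>) *\<^sub>R dth \<theta> \<phi> - (gradient f ?p \<bullet> dth \<theta> \<phi>) *\<^sub>R dph \<theta> \<phi>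
      = sin \<theta> *\<^sub>R sgrad f ?p"
    by (simp add: Lagrange[symmetric] sgrad_def cross_mult_right)
  then show ?thesis
    unfolding sgrad_sph_def d\<phi> d\<theta> using sin_gt_zero[OF \<theta>] by simp
qed

lemma stream_sph:
  "stream c M q (sph \<theta> \<phi>) = Re (c * cis (real M * \<phi>)) * (sin \<theta> ^ M * poly q (cos \<theta>))"
proof -
  have "Complex (sph \<theta> \<phi> $ 1) (sph \<theta> \<phi> $ 2) = of_real (sin \<theta>) * cis \<phi>"
    by (simp add: sph_def complex_eq_iff)
  then have "c * Complex (sph \<theta> \<phi> $ 1) (sph \<theta> \<phi> $ 2) ^ M = of_real (sin \<theta> ^ M) * (c * cis (real M * \<phi>))"
    by (simp add: power_mult_distrib Complex.DeMoivre mult_ac)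
  then show ?thesis
    unfolding stream_def
    by (simp only: Re_complex_of_real Im_complex_of_real times_complex.sel(1)[of "of_real _"])
      (simp add: sph_def)
qed

lemma e_eq_sfield:
  fixes m :: int
  defines "M \<equiv> nat \<bar>m\<bar>"
  assumes Y: "\<And>\<theta> \<phi>. 0 < \<theta> \<Longrightarrow> \<theta> < pi \<Longrightarrow>
      Ylm l m \<theta> \<phi> = of_real (K * (sin \<theta> ^ M * poly q (cos \<theta>))) * cis (of_int m * \<phi>)"
  defines "C \<equiv> K / sqrt (real l * (real l + 1))"
  shows "e l m \<simeq>\<^sub>C csfield (of_real C) (- (\<i> * of_real (sgn (of_int m) * C))) M q"
proof -
  have trig: "cos (of_int m * \<phi>) = cos (real M * \<phi>)"
    "sin (of_int m * \<phi>) = sgn (of_int m) * sin (real M * \<phi>)" for \<phi>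
    by (cases m rule: int_cases2; simp add: M_def sgn_if)+
  have "Re (Ylm l m \<theta> \<phi>) / sqrt (real l * (real l + 1)) = stream (of_real C) M q (sph \<theta> \<phi>)"
    "Im (Ylm l m \<theta> \<phi>) / sqrt (real l * (real l + 1))
      = stream (- (\<i> * of_real (sgn (of_int m) * C))) M q (sph \<theta> \<phi>)"
    if "0 < \<theta>" "\<theta> < pi" for \<theta> \<phi>
    unfolding Y[OF that] stream_sph by (simp_all add: trig C_def)
  then show ?thesis
    unfolding e_def eq_C_def fst_conv snd_conv
    by (intro conjI field_of_sph_eq sgrad_sph_eq sgrad_continuous_on real_polynomial_function_stream; simp)+
qed

lemma higher_deriv_poly: "(deriv ^^ n) (poly p) = poly ((pderiv ^^ n) p)" for p :: "real poly"
proof (induction n)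
  case (Suc n)
  have "deriv (poly q) = poly (pderiv q)" for q :: "real poly"
    using poly_DERIV DERIV_imp_deriv by blast
  then show ?case
    using Suc by simp
qed simp

lemma assocP_eq:
  "assocP l m z = (1 - z^2) powr (of_int m / 2) * poly ((pderiv ^^ nat (int l + m)) (rodrigues l)) z"
proof -
  have "(\<lambda>t::real. (t^2 - 1)^l) = poly ([:-1, 0, 1:] ^ l)"
    by (simp add: fun_eq_iff poly_power power2_eq_square)
  then show ?thesis
    by (simp add: assocP_def higher_deriv_poly rodrigues_def higher_pderiv_smult)
qed

lemma one_minus_cos_squared_powr:
  assumes "0 < \<theta>" "\<theta> < pi"
  shows "(1 - (cos \<theta>)^2) powr (real M / 2) = sin \<theta> ^ M"
    "(1 - (cos \<theta>)^2) powr (- (real M / 2)) = 1 / sin \<theta> ^ M"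
proof -
  have sin: "sin \<theta> > 0"
    using assms by (rule sin_gt_zero)
  have "1 - (cos \<theta>)^2 = sin \<theta> powr 2"
    using sin by (simp add: sin_squared_eq)
  then show "(1 - (cos \<theta>)^2) powr (real M / 2) = sin \<theta> ^ M"
    using sin by (simp only: powr_powr) (simp add: powr_realpow)
  then show "(1 - (cos \<theta>)^2) powr (- (real M / 2)) = 1 / sin \<theta> ^ M"
    by (simp add: powr_minus_divide)
qed

lemma rodrigues_root: "j < n \<Longrightarrow> poly ((pderiv ^^ j) (rodrigues n)) 1 = 0"
proof (induction n arbitrary: j)
  case (Suc n)
  show ?case
  proof (cases j)
    case 0
    then show ?thesis by (simp add: rodrigues_def)
  next
    case (Suc i)
    then have "i < n" "i - 1 < n"
      using Suc.prems by auto
    moreover have "(pderiv ^^ j) (rodrigues (Suc n)) = (pderiv ^^ i) ([:0, 1:] * rodrigues n)"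
      by (simp only: Suc funpow_Suc_right o_apply pderiv_rodrigues_Suc)
    ultimately show ?thesis
      unfolding higher_pderiv_x_mult using Suc.IH by simp
  qed
qed simp

lemma poly_eqI_pderiv:
  fixes p q :: "'a::{idom, ring_char_0} poly"
  assumes "pderiv p = pderiv q" "poly p x = poly q x"
  shows "p = q"
proof -
  have "pderiv (p - q) = 0"
    using assms(1) by (simp add: pderiv_diff)
  then obtain b where "p - q = [:b:]"
    by (metis pderiv_eq_0_iff degree_eq_zeroE)
  moreover have "poly (p - q) x = 0"
    using assms(2) by simp
  ultimately show ?thesis by simp
qed

lemma pderiv_weighted_leg:
  "pderiv ([:-1, 0, 1:] ^ Suc M * leg (Suc M) (int l))
    = smult ((real l - real M) * (real l + real M + 1)) ([:-1, 0, 1:] ^ M * leg M (int l))"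
proof -
  let ?X = "[:-1, 0, 1:] :: real poly" and ?y = "leg M (int l)"
  have "?X * pderiv (pderiv ?y) + smult (2 * (real M + 1)) ([:0, 1:] * pderiv ?y)
      = smult ((real l - real M) * (real l + real M + 1)) ?y"
    using arg_cong[OF legendre_op_leg[of M "int l"], of poly]
    by (intro poly_ext) (simp add: fun_eq_iff poly_legendre_op eigval_def algebra_simps)
  moreover have "pderiv (?X ^ Suc M * pderiv ?y)
      = ?X ^ M * (?X * pderiv (pderiv ?y) + smult (2 * (real M + 1)) ([:0, 1:] * pderiv ?y))"
    unfolding pderiv_mult pderiv_power_Suc
    by (rule poly_ext) (simp add: pderiv_pCons algebra_simps)
  moreover have "leg (Suc M) (int l) = pderiv ?y"
    by (simp add: leg_def)
  ultimately show ?thesis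
    by simp
qed

text \<open>Reduces negative azimuthal orders to positive ones.\<close>

lemma leg_reflection:
  assumes "M \<le> l"
  shows "\<exists>c\<noteq>0. [:-1, 0, 1:] ^ M * leg M (int l) = smult c ((pderiv ^^ (l - M)) (rodrigues l))"
  using assms
proof (induction M)
  case 0
  then show ?case
    by (intro exI[of _ 1]) (simp add: leg_def)
next
  case (Suc M)
  then obtain c where c: "c \<noteq> 0" "[:-1, 0, 1:] ^ M * leg M (int l) = smult c ((pderiv ^^ (l - M)) (rodrigues l))"
    by auto
  define a where "a = (real l - real M) * (real l + real M + 1)"
  have "l - M = Suc (l - Suc M)"
    using Suc.prems by simp
  then have "pderiv ([:-1, 0, 1:] ^ Suc M * leg (Suc M) (int l))
      = pderiv (smult (a * c) ((pderiv ^^ (l - Suc M)) (rodrigues l)))"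
    unfolding pderiv_weighted_leg c a_def[symmetric] by (simp add: pderiv_smult)
  moreover have "poly ([:-1, 0, 1:] ^ Suc M * leg (Suc M) (int l)) 1
      = poly (smult (a * c) ((pderiv ^^ (l - Suc M)) (rodrigues l))) 1"
    using Suc.prems by (simp add: rodrigues_root)
  ultimately have "[:-1, 0, 1:] ^ Suc M * leg (Suc M) (int l)
      = smult (a * c) ((pderiv ^^ (l - Suc M)) (rodrigues l))"
    by (rule poly_eqI_pderiv)
  moreover have "a * c \<noteq> 0"
    using Suc.prems c by (simp add: a_def)
  ultimately show ?case
    by blast
qed

lemma Ylm_nonneg_order:
  assumes "M \<le> l" "0 < \<theta>" "\<theta> < pi"
  shows "Ylm l (int M) \<theta> \<phi> = of_real (sqrt (fact (l - M) / fact (l + M) * (2 * real l + 1) / (4 * pi))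
      * (sin \<theta> ^ M * poly (leg M (int l)) (cos \<theta>))) * cis (of_int (int M) * \<phi>)"
proof -
  have "nat (int l - int M) = l - M" "nat (int l + int M) = l + M"
    using assms(1) by auto
  then show ?thesis
    by (simp add: Ylm_def assocP_eq one_minus_cos_squared_powr[OF assms(2,3)] leg_def)
qed

lemma Ylm_neg_order:
  assumes "M \<le> l"
  obtains K where "K \<noteq> 0" "\<And>\<theta> \<phi>. 0 < \<theta> \<Longrightarrow> \<theta> < pi \<Longrightarrow> Ylm l (- int M) \<theta> \<phi>
      = of_real (K * (sin \<theta> ^ M * poly (leg M (int l)) (cos \<theta>))) * cis (of_int (- int M) * \<phi>)"
proof -
  obtain c where c: "c \<noteq> 0" "[:-1, 0, 1:] ^ M * leg M (int l) = smult c ((pderiv ^^ (l - M)) (rodrigues l))"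
    using leg_reflection[OF assms] by blast
  let ?N = "sqrt (fact (l + M) / fact (l - M) * (2 * real l + 1) / (4 * pi))"
  have orders: "nat (int l + int M) = l + M" "nat (int l - int M) = l - M"
    using assms by auto
  have assocP: "assocP l (- int M) (cos \<theta>) = (-1) ^ M / c * (sin \<theta> ^ M * poly (leg M (int l)) (cos \<theta>))"
    if "0 < \<theta>" "\<theta> < pi" for \<theta>
  proof -
    have "(cos \<theta>)^2 - 1 = (-1) * (sin \<theta> * sin \<theta>)"
      using sin_cos_squared_add[of \<theta>] by (simp add: power2_eq_square)
    then have "((cos \<theta>)^2 - 1) ^ M = (-1) ^ M * (sin \<theta> ^ M * sin \<theta> ^ M)"
      by (simp only: power_mult_distrib)
    moreover have "((cos \<theta>)^2 - 1) ^ M * poly (leg M (int l)) (cos \<theta>)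
        = c * poly ((pderiv ^^ (l - M)) (rodrigues l)) (cos \<theta>)"
      using arg_cong[OF c(2), of "\<lambda>p. poly p (cos \<theta>)"] by (simp add: poly_power power2_eq_square)
    ultimately have "poly ((pderiv ^^ (l - M)) (rodrigues l)) (cos \<theta>)
        = (-1) ^ M / c * (sin \<theta> ^ M * sin \<theta> ^ M) * poly (leg M (int l)) (cos \<theta>)"
      using c(1) by (simp add: field_simps)
    then show ?thesis
      using one_minus_cos_squared_powr(2)[OF that, of M] sin_gt_zero[OF that] by (simp add: assocP_eq orders)
  qed
  show ?thesis
  proof (rule that)
    show "?N * ((-1) ^ M / c) \<noteq> 0"
      using c(1) by (simp add: add_nonneg_eq_0_iff)
    show "Ylm l (- int M) \<theta> \<phi> = of_real (?N * ((-1) ^ M / c) * (sin \<theta> ^ M * poly (leg M (int l)) (cos \<theta>)))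
        * cis (of_int (- int M) * \<phi>)" if "0 < \<theta>" "\<theta> < pi" for \<theta> \<phi>
      unfolding Ylm_def assocP[OF that] by (simp add: orders)
  qed
qed

lemma e_eq_sfield_leg:
  assumes "1 \<le> l" "- int l \<le> m" "m \<le> int l"
  obtains C d where "C \<noteq> 0" "e l m \<simeq>\<^sub>C csfield (of_real C) d (nat \<bar>m\<bar>) (leg (nat \<bar>m\<bar>) (int l))"
proof -
  define M where "M = nat \<bar>m\<bar>"
  have "M \<le> l"
    using assms by (auto simp: M_def)
  obtain K where "K \<noteq> 0" and Y: "\<And>\<theta> \<phi>. 0 < \<theta> \<Longrightarrow> \<theta> < pi \<Longrightarrow> Ylm l m \<theta> \<phi>
      = of_real (K * (sin \<theta> ^ M * poly (leg M (int l)) (cos \<theta>))) * cis (of_int m * \<phi>)"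
  proof (cases "m \<ge> 0")
    case True
    then have "m = int M"
      by (simp add: M_def)
    moreover have "sqrt (fact (l - M) / fact (l + M) * (2 * real l + 1) / (4 * pi)) \<noteq> 0"
      by (simp add: add_nonneg_eq_0_iff)
    ultimately show ?thesis
      using that Ylm_nonneg_order[OF \<open>M \<le> l\<close>] by blast
  next
    case False
    then have "m = - int M"
      by (simp add: M_def)
    then show ?thesis
      using that Ylm_neg_order[OF \<open>M \<le> l\<close>] by metis
  qed
  moreover have "K / sqrt (real l * (real l + 1)) \<noteq> 0"
    using \<open>K \<noteq> 0\<close> assms(1) by simp
  ultimately show ?thesis
    using that e_eq_sfield[OF Y[unfolded M_def]] by blast
qed

section \<open>Inner products of the basis fields\<close>

lemma ip_eigenfunctions_orthogonal:
  assumes f: "real_polynomial_function f" "\<And>p. p \<in> S2 \<Longrightarrow> laplace_S2 f p = \<mu> * f p"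
    and g: "real_polynomial_function g" "\<And>p. p \<in> S2 \<Longrightarrow> laplace_S2 g p = \<nu> * g p"
    and "\<mu> \<noteq> \<nu>"
  shows "ip (sgrad f) (sgrad g) = 0"
proof -
  let ?I = "sphere_integral (\<lambda>p. f p * g p)"
  have f_side: "ip (sgrad f) (sgrad g) = \<mu> * ?I"
    unfolding ip_sgrad_sgrad[OF f(1) g(1)] sphere_integral_cmult[symmetric]
    by (rule sphere_integral_cong) (simp add: f(2))
  moreover have "ip (sgrad f) (sgrad g) = \<nu> * ?I"
    unfolding ip_commute[of "sgrad f"] ip_sgrad_sgrad[OF g(1) f(1)] sphere_integral_cmult[symmetric]
    by (rule sphere_integral_cong) (simp add: g(2))
  ultimately have "?I = 0"
    using assms(5) by simp
  then show ?thesis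
    by (simp add: f_side)
qed

lemma eigval_inj:
  assumes "eigval k = eigval l" "k + l \<ge> 0"
  shows "k = l"
proof -
  have "(of_int k - of_int l) * (of_int k + of_int l + 1) = (0::real)"
    using assms(1) by (simp add: eigval_def algebra_simps)
  then have "of_int (k - l) = (0::real) \<or> of_int (k + l + 1) = (0::real)"
    by simp
  then show ?thesis
    using assms(2) by (simp only: of_int_eq_0_iff) linarith
qed

lemma ip_leg_orthogonal:
  assumes "k \<noteq> l" "k + l \<ge> 0"
  shows "ip (sfield c M (leg M k)) (sfield d N (leg N l)) = 0"
proof (rule ip_eigenfunctions_orthogonal)
  show "eigval k \<noteq> eigval l"
    using assms eigval_inj by blast
qed (simp_all add: laplace_S2_stream legendre_op_leg stream_smult)

lemma ip_zonal_sfield_eq_0: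
  assumes "M \<noteq> 0"
  shows "ip (sfield 1 0 f) (sfield c M q) = 0"
proof -
  have "(\<lambda>p. stream 1 0 (legendre_op 0 f) p * stream c M q p) = stream c M (legendre_op 0 f * q)"
    by (simp add: fun_eq_iff stream_def)
  then show ?thesis
    by (simp add: ip_sgrad_sgrad laplace_S2_stream sphere_integral_stream_eq_0[OF assms])
qed

lemma ip_zonal_self:
  assumes "pderiv Q = legendre_op 0 f * f"
  shows "ip (sfield 1 0 f) (sfield 1 0 f) = 2 * pi * (poly Q 1 - poly Q (-1))"
proof -
  have "ip (sfield 1 0 f) (sfield 1 0 f) = sphere_integral (\<lambda>p. poly (pderiv Q) (p$3))"
    by (simp add: ip_sgrad_sgrad laplace_S2_stream assms) (simp add: stream_def)
  then show ?thesis
    by (simp only: sphere_integral_poly_height)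
qed

lemma leg_nonzero:
  assumes "M \<le> l"
  shows "leg M (int l) \<noteq> 0"
proof -
  have "degree (rodrigues l) = 2 * l" "rodrigues l \<noteq> 0"
    by (simp_all add: rodrigues_def degree_power_eq)
  moreover have "l - M + (l + M) = 2 * l"
    using assms by simp
  ultimately have "coeff (rodrigues l) (l - M + (l + M)) \<noteq> 0"
    by (metis leading_coeff_0_iff)
  moreover have "pochhammer (of_nat (Suc (l - M))) (l + M) \<noteq> (0::real)"
    by (intro less_imp_neq[symmetric] pochhammer_pos) simp
  ultimately have "coeff (leg M (int l)) (l - M) \<noteq> 0"
    by (simp only: leg_int coeff_higher_pderiv mult_eq_0_iff) simp
  then show ?thesis
    by (metis coeff_0)
qed

lemma ip_leg_pos:
  assumes "M \<le> l" "l \<noteq> 0" "C \<noteq> 0"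
  shows "ip (sfield (of_real C) M (leg M (int l))) (sfield (of_real C) M (leg M (int l))) > 0"
proof -
  let ?f = "stream (of_real C) M (leg M (int l))" and ?sq = "\<lambda>p. stream (of_real C) M (leg M (int l)) p ^ 2"
  have "ip (sgrad ?f) (sgrad ?f) = eigval (int l) * sphere_integral ?sq"
    by (simp add: ip_sgrad_sgrad laplace_S2_stream legendre_op_leg stream_smult power2_eq_square mult.assoc
        sphere_integral_cmult)
  moreover have "eigval (int l) > 0"
    using assms(2) by (simp add: eigval_def)
  moreover have sq: "continuous_on S2 ?sq"
    by (intro continuous_intros continuous_on_real_polynomial_function) simp
  moreover have "sphere_integral ?sq \<noteq> 0"
  proof
    assume "sphere_integral ?sq = 0"
    then have zero: "?f p = 0" if "p \<in> S2" for p
      using sphere_integral_eq_0_imp[OF sq _ _ that] by simp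
    have "poly (leg M (int l)) x = 0" if "x \<in> {-1<..<1}" for x
      using zero[of "sph (arccos x) 0"] that assms(3) sin_arccos_nonzero[of x] by (auto simp: stream_sph)
    then have "{-1<..<1} \<subseteq> {x. poly (leg M (int l)) x = 0}"
      by auto
    moreover have "infinite {-1<..<1::real}"
      by simp
    ultimately show False
      using poly_roots_finite[OF leg_nonzero[OF assms(1)]] finite_subset by blast
  qed
  ultimately show ?thesis
    using sphere_integral_nonneg[OF sq] by (simp add: less_le)
qed

lemma ip_sfield_smult: "ip (sfield c M (smult a q)) Y = a * ip (sfield c M q) Y"
  by (simp add: stream_smult sgrad_cmult ip_scaleR_left)

lemma ip_sfield_sum:
  assumes "continuous_on S2 Y"
  shows "ip (sfield c M (\<Sum>j\<in>A. q j)) Y = (\<Sum>j\<in>A. ip (sfield c M (q j)) Y)"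
proof (induction A rule: infinite_finite_induct)
  case (insert j A)
  have "ip (\<lambda>p. sfield c M (q j) p + sfield c M (\<Sum>j\<in>A. q j) p) Y
      = ip (sfield c M (q j)) Y + ip (sfield c M (\<Sum>j\<in>A. q j)) Y"
    by (intro ip_add_left sgrad_continuous_on real_polynomial_function_stream assms)
  then show ?case
    using insert by (simp add: stream_add sgrad_add)
qed simp_all

lemma ip_leg_sum_leg:
  assumes "finite A" "l \<in> A" "\<And>j. j \<in> A \<Longrightarrow> j + l \<ge> 0"
  shows "ip (sfield c M (leg_sum M A a)) (sfield d N (leg N l))
    = a l * ip (sfield c M (leg M l)) (sfield d N (leg N l))"
proof -
  have "ip (sfield c M (leg_sum M A a)) (sfield d N (leg N l))
      = (\<Sum>j\<in>A. a j * ip (sfield c M (leg M j)) (sfield d N (leg N l)))"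
    by (simp add: leg_sum_def ip_sfield_sum sgrad_continuous_on ip_sfield_smult)
  also have "\<dots> = (\<Sum>j\<in>A. if j = l then a l * ip (sfield c M (leg M l)) (sfield d N (leg N l)) else 0)"
    by (rule sum.cong[OF refl]) (simp add: ip_leg_orthogonal assms(3))
  finally show ?thesis
    using assms(1,2) by simp
qed

lemma leg_3: "leg 0 3 = [:0, -3/2, 0, 5/2:]"
proof -
  have "[:-1, 0, 1:] ^ 3 = [:-1, 0, 3, 0, -3, 0, 1 :: real:]"
    by (simp add: power3_eq_cube)
  then show ?thesis
    by (simp add: leg_def rodrigues_def numeral_3_eq_3 fact_numeral pderiv_pCons pderiv_smult)
qed

lemma e_3_0:
  obtains f \<kappa> where "legendre_op 0 f = smult 12 f" "pderiv f = smult \<kappa> profile" "\<kappa>\<^sup>2 = 21 / (64 * pi)"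
    "ip (sfield 1 0 f) (sfield 1 0 f) = 1" "e 3 0 \<simeq>\<^sub>C real_zonal f"
proof -
  define C where "C = sqrt (7 / (4 * pi)) / sqrt (real 3 * (real 3 + 1))"
  have C: "C\<^sup>2 = 7 / (48 * pi)"
    by (simp add: C_def power_divide)
  let ?f = "smult C (leg 0 3)"
  have "Ylm 3 0 \<theta> \<phi>
      = of_real (sqrt (7 / (4 * pi)) * (sin \<theta> ^ nat \<bar>0\<bar> * poly (leg 0 3) (cos \<theta>))) * cis (of_int 0 * \<phi>)"
    if "0 < \<theta>" "\<theta> < pi" for \<theta> \<phi>
    using Ylm_nonneg_order[OF _ that, of 0 3] by simp
  then have "e 3 0 \<simeq>\<^sub>C csfield (of_real C) 0 0 (leg 0 3)"
    using e_eq_sfield[where m = 0 and l = 3 and K = "sqrt (7 / (4 * pi))" and q = "leg 0 3"]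
    by (simp add: C_def)
  moreover have "stream (of_real C) 0 (leg 0 3) = stream 1 0 ?f" "stream 0 0 (leg 0 3) = (\<lambda>p. 0)"
    by (simp_all add: fun_eq_iff stream_def)
  ultimately have e: "e 3 0 \<simeq>\<^sub>C real_zonal ?f"
    by simp
  have eigen: "legendre_op 0 ?f = smult 12 ?f"
    by (simp add: legendre_op_smult legendre_op_leg eigval_def mult.commute)
  have deriv: "pderiv ?f = smult (C * 3 / 2) profile"
    by (simp add: pderiv_smult leg_3 pderiv_pCons)
  have \<kappa>: "(C * 3 / 2)\<^sup>2 = 21 / (64 * pi)"
    using C by (simp add: power_mult_distrib power_divide)
  have "pderiv (smult (C\<^sup>2) [:0, 0, 0, 9, 0, -18, 0, 75/7:]) = legendre_op 0 ?f * ?f"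
    unfolding eigen by (simp add: leg_3 pderiv_smult pderiv_pCons power2_eq_square)
  then have norm: "ip (sfield 1 0 ?f) (sfield 1 0 ?f) = 1"
    by (simp only: ip_zonal_self) (simp add: C)
  show ?thesis
    by (rule that[OF eigen deriv \<kappa> norm e])
qed

section \<open>The curvature\<close>

lemma nabla_zero_sfield:
  assumes "0 \<in> stream_polys \<gg> M"
  shows "nabla \<gg> (\<lambda>p. 0) (sfield c M q) \<simeq> (\<lambda>p. 0)" "nabla \<gg> (sfield c M q) (\<lambda>p. 0) \<simeq> (\<lambda>p. 0)"
  using nabla_zonal_stream[where f = 0 and \<mu> = 0 and r = 0 and s = 0 and q = q and c = c, OF _ _ assms _ assms]
  by simp_all

lemma cbr_real_zonal:
  "cbr (real_zonal f) (csfield c d M q) \<simeq>\<^sub>C csfield (\<i> * c) (\<i> * d) M (smult (real M) (pderiv f * q))"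
proof -
  have "br (\<lambda>p. 0) (sfield c M q) \<simeq> (\<lambda>p. 0)" for c
    using br_zonal_sfield[of 0 c M q] by simp
  then have "cbr (real_zonal f) (csfield c d M q)
      \<simeq>\<^sub>C (br (sfield 1 0 f) (sfield c M q), br (sfield 1 0 f) (sfield d M q))"
    unfolding cbr_def by (intro cbil_real_left)
  also have "\<dots> \<simeq>\<^sub>C csfield (\<i> * c) (\<i> * d) M (smult (real M) (pderiv f * q))"
    by (simp add: eq_C_def br_zonal_sfield)
  finally show ?thesis .
qed

lemma cnabla_real_zonal_leg_sum:
  assumes f: "legendre_op 0 f = smult \<mu> f" "pderiv f = smult \<kappa> profile"
    and J: "finite J" "J \<noteq> {}" "\<And>k. k \<in> J \<Longrightarrow> k \<ge> 1"
    and leg: "\<And>k j. k \<in> J \<Longrightarrow> j \<in> neighbours k \<Longrightarrow> leg M j \<in> stream_polys \<gg> M"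
  shows "cnabla \<gg> (real_zonal f) (csfield c d M (leg_sum M J a)) \<simeq>\<^sub>C csfield (\<i> * c) (\<i> * d) M
      (smult (real M / 2 * \<kappa>) (neighbour_sum M J (\<lambda>k j. a k * nabla_coeff 1 M \<mu> k j)))"
    and "cnabla \<gg> (csfield c d M (leg_sum M J a)) (real_zonal f) \<simeq>\<^sub>C csfield (\<i> * c) (\<i> * d) M
      (smult (real M / 2 * \<kappa>) (neighbour_sum M J (\<lambda>k j. a k * nabla_coeff (-1) M \<mu> k j)))"
proof -
  note nabla = nabla_zonal_leg_sum[where a = a, OF f J leg]
  obtain k where "k \<in> J"
    using J(2) by blast
  then have "0 \<in> stream_polys \<gg> M"
    using stream_polys_0[OF leg[of k k]] by simp
  note zero = nabla_zero_sfield[OF this]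
  let ?q = "leg_sum M J a"
  have "cnabla \<gg> (real_zonal f) (csfield c d M ?q)
      \<simeq>\<^sub>C (nabla \<gg> (sfield 1 0 f) (sfield c M ?q), nabla \<gg> (sfield 1 0 f) (sfield d M ?q))"
    unfolding cnabla_eq_cbil by (intro cbil_real_left zero)
  then show "cnabla \<gg> (real_zonal f) (csfield c d M ?q) \<simeq>\<^sub>C csfield (\<i> * c) (\<i> * d) M
      (smult (real M / 2 * \<kappa>) (neighbour_sum M J (\<lambda>k j. a k * nabla_coeff 1 M \<mu> k j)))"
    by (rule eq_C_trans) (simp only: eq_C_def fst_conv snd_conv nabla(1) simp_thms)
  have "cnabla \<gg> (csfield c d M ?q) (real_zonal f)
      \<simeq>\<^sub>C (nabla \<gg> (sfield c M ?q) (sfield 1 0 f), nabla \<gg> (sfield d M ?q) (sfield 1 0 f))"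
    unfolding cnabla_eq_cbil by (intro cbil_real_right zero)
  then show "cnabla \<gg> (csfield c d M ?q) (real_zonal f) \<simeq>\<^sub>C csfield (\<i> * c) (\<i> * d) M
      (smult (real M / 2 * \<kappa>) (neighbour_sum M J (\<lambda>k j. a k * nabla_coeff (-1) M \<mu> k j)))"
    by (rule eq_C_trans) (simp only: eq_C_def fst_conv snd_conv nabla(2) simp_thms)
qed

lemma cnabla_real_zonal_self:
  assumes eigen: "legendre_op 0 f = smult \<mu> f" and zero: "0 \<in> stream_polys \<gg> 0"
  shows "cnabla \<gg> (real_zonal f) (real_zonal f) \<simeq>\<^sub>C (\<lambda>p. 0, \<lambda>p. 0)"
proof -
  have "cnabla \<gg> (real_zonal f) (real_zonal f)
      \<simeq>\<^sub>C (nabla \<gg> (sfield 1 0 f) (sfield 1 0 f), nabla \<gg> (sfield 1 0 f) (\<lambda>p. 0))"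
    unfolding cnabla_eq_cbil
    using nabla_zero_sfield(1)[OF zero, where c = 1 and q = f] nabla_zero_sfield(1)[OF zero, where q = 0]
    by (intro cbil_real_left) simp_all
  also have "\<dots> \<simeq>\<^sub>C (\<lambda>p. 0, \<lambda>p. 0)"
    using nabla_zonal_stream(1)[OF eigen _ zero _ zero, of f 1]
      nabla_zero_sfield(2)[OF zero, where c = 1 and q = f]
    by (simp add: eq_C_def)
  finally show ?thesis .
qed

lemma cnabla_zero_right:
  assumes "0 \<in> stream_polys \<gg> M"
  shows "cnabla \<gg> (csfield c d M q) (\<lambda>p. 0, \<lambda>p. 0) \<simeq>\<^sub>C (\<lambda>p. 0, \<lambda>p. 0)"
proof -
  note zero = nabla_zero_sfield(2)[OF assms]
  have "cnabla \<gg> (csfield c d M q) (\<lambda>p. 0, \<lambda>p. 0)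
      \<simeq>\<^sub>C (nabla \<gg> (sfield c M q) (\<lambda>p. 0), nabla \<gg> (sfield d M q) (\<lambda>p. 0))"
    unfolding cnabla_eq_cbil by (intro cbil_real_right zero)
  also have "\<dots> \<simeq>\<^sub>C (\<lambda>p. 0, \<lambda>p. 0)"
    by (simp add: eq_C_def zero)
  finally show ?thesis .
qed

text \<open>The contribution to R(u, v) u, up to a constant, of passing from degree l through degree k to degree j.\<close>

definition curv_coeff :: "nat \<Rightarrow> real \<Rightarrow> int \<Rightarrow> int \<Rightarrow> int \<Rightarrow> real" where
  "curv_coeff M \<mu> l k j = nabla_coeff (-1) M \<mu> l k * nabla_coeff 1 M \<mu> k j
     - 2 * profile_coeff M l k * nabla_coeff (-1) M \<mu> k j"

lemma cbr_real_zonal_leg: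
  assumes "pderiv f = smult \<kappa> profile" "l \<ge> 1"
  shows "cbr (real_zonal f) (csfield c d M (leg M l))
    \<simeq>\<^sub>C csfield (\<i> * c) (\<i> * d) M (leg_sum M (neighbours l) (\<lambda>k. real M * \<kappa> * profile_coeff M l k))"
proof -
  have "smult (real M) (pderiv f * leg M l) = leg_sum M (neighbours l) (\<lambda>k. real M * \<kappa> * profile_coeff M l k)"
    by (simp only: assms(1) mult_smult_left profile_mult_leg[OF assms(2)] smult_smult smult_sum_right mult.assoc
        leg_sum_def)
  then show ?thesis
    by (metis cbr_real_zonal)
qed

lemma cnabla_leg_real_zonal:
  assumes f: "legendre_op 0 f = smult \<mu> f" "pderiv f = smult \<kappa> profile" and l: "l \<ge> 1"
    and leg: "\<And>j. j \<in> neighbours l \<Longrightarrow> leg M j \<in> stream_polys \<gg> M"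
  shows "cnabla \<gg> (csfield c d M (leg M l)) (real_zonal f) \<simeq>\<^sub>C csfield (\<i> * c) (\<i> * d) M
    (leg_sum M (neighbours l) (\<lambda>k. real M / 2 * \<kappa> * nabla_coeff (-1) M \<mu> l k))"
proof -
  have "cnabla \<gg> (csfield c d M (leg_sum M {l} (\<lambda>k. 1))) (real_zonal f) \<simeq>\<^sub>C csfield (\<i> * c) (\<i> * d) M
      (smult (real M / 2 * \<kappa>) (neighbour_sum M {l} (\<lambda>k j. 1 * nabla_coeff (-1) M \<mu> k j)))"
    by (rule cnabla_real_zonal_leg_sum(2)[OF f]) (use l leg in auto)
  moreover have "smult (real M / 2 * \<kappa>) (neighbour_sum M {l} (\<lambda>k j. 1 * nabla_coeff (-1) M \<mu> k j))
      = leg_sum M (neighbours l) (\<lambda>k. real M / 2 * \<kappa> * nabla_coeff (-1) M \<mu> l k)"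
    by (simp add: neighbour_sum_def leg_sum_def smult_add_right)
  moreover have "leg_sum M {l} (\<lambda>k. 1) = leg M l"
    by (simp add: leg_sum_def)
  ultimately show ?thesis
    by (simp only:)
qed

lemma cR_real_zonal_leg:
  assumes f: "legendre_op 0 f = smult \<mu> f" "pderiv f = smult \<kappa> profile" and l: "l \<ge> 3"
    and leg: "\<And>i. even (i - l) \<Longrightarrow> leg M i \<in> stream_polys \<gg> M"
  shows "cR \<gg> (real_zonal f) (csfield c d M (leg M l)) (real_zonal f) \<simeq>\<^sub>C csfield c d M
    (smult ((real M * \<kappa>)\<^sup>2 / 4) (neighbour_sum M (neighbours l) (curv_coeff M \<mu> l)))"
proof -
  let ?u = "real_zonal f" and ?v = "csfield c d M (leg M l)" and ?S = "leg_sum M (neighbours l)"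
  let ?N = "\<lambda>\<epsilon> a. smult (real M / 2 * \<kappa>) (neighbour_sum M (neighbours l) (\<lambda>k j. a k * nabla_coeff \<epsilon> M \<mu> k j))"
  define a b where "a k = real M / 2 * \<kappa> * nabla_coeff (-1) M \<mu> l k"
    and "b k = real M * \<kappa> * profile_coeff M l k" for k
  have zero: "0 \<in> stream_polys \<gg> N" for N
    using stream_polys_0[OF leg[of l]] by simp
  have second: "cnabla \<gg> ?u (csfield c' d' M (?S a)) \<simeq>\<^sub>C csfield (\<i> * c') (\<i> * d') M (?N 1 a)"
    "cnabla \<gg> (csfield c' d' M (?S a)) ?u \<simeq>\<^sub>C csfield (\<i> * c') (\<i> * d') M (?N (-1) a)" for c' d' a
    using l by (intro cnabla_real_zonal_leg_sum[OF f] leg; auto)+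
  have vu: "cnabla \<gg> ?v ?u \<simeq>\<^sub>C csfield (\<i> * c) (\<i> * d) M (?S a)"
    unfolding a_def using l by (intro cnabla_leg_real_zonal[OF f] leg) auto
  have uv: "cbr ?u ?v \<simeq>\<^sub>C csfield (\<i> * c) (\<i> * d) M (?S b)"
    unfolding b_def using l by (intro cbr_real_zonal_leg[OF f(2)]) simp
  have "cnabla \<gg> ?u (cnabla \<gg> ?v ?u) \<simeq>\<^sub>C csfield (- c) (- d) M (?N 1 a)"
    using eq_C_trans[OF eq_C_cnabla[OF eq_C_refl vu] second(1)] by simp
  moreover have "cnabla \<gg> (cbr ?u ?v) ?u \<simeq>\<^sub>C csfield (- c) (- d) M (?N (-1) b)"
    using eq_C_trans[OF eq_C_cnabla[OF uv eq_C_refl] second(2)] by simp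
  moreover have "cnabla \<gg> ?v (cnabla \<gg> ?u ?u) \<simeq>\<^sub>C (\<lambda>p. 0, \<lambda>p. 0)"
    by (rule eq_C_trans[OF eq_C_cnabla[OF eq_C_refl cnabla_real_zonal_self[OF f(1) zero]]
          cnabla_zero_right[OF zero]])
  ultimately have "cR \<gg> ?u ?v ?u \<simeq>\<^sub>C csfield c d M (?N 1 a - ?N (-1) b)"
    by (simp add: cR_def eq_C_def eq_S2_def cadd_def cneg_def fadd_def fscale_def sfield_phase_uminus sfield_diff)
  also have "?N 1 a - ?N (-1) b = smult ((real M * \<kappa>)\<^sup>2 / 4) (neighbour_sum M (neighbours l) (curv_coeff M \<mu> l))"
    unfolding neighbour_sum_def leg_sum_def smult_sum_right sum_subtractf[symmetric] smult_smult
      smult_diff_left[symmetric]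
    by (intro sum.cong refl arg_cong2[where f = smult])
       (simp add: a_def b_def curv_coeff_def power2_eq_square algebra_simps)
  finally show ?thesis .
qed

lemma ip_neighbour_sum_leg:
  assumes "l \<ge> 3"
  shows "ip (sfield c M (neighbour_sum M (neighbours l) w)) (sfield d M (leg M l))
    = (\<Sum>k\<in>neighbours l. w k l) * ip (sfield c M (leg M l)) (sfield d M (leg M l))"
proof -
  have "ip (sfield c M (leg_sum M (neighbours k) (w k))) (sfield d M (leg M l))
      = w k l * ip (sfield c M (leg M l)) (sfield d M (leg M l))" if "k \<in> neighbours l" for k
    by (rule ip_leg_sum_leg) (use assms that in auto)
  then show ?thesis
    by (simp only: neighbour_sum_def ip_sfield_sum[OF sgrad_continuous_on[OF real_polynomial_function_stream]]
        sum_distrib_right cong: sum.cong)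
qed

lemma profile_coeff_products:
  assumes "l \<ge> 3"
  shows "profile_coeff M (int l) (int l + 2) * profile_coeff M (int l + 2) (int l) = 25 * cA l (int M)"
    "profile_coeff M (int l) (int l) * profile_coeff M (int l) (int l) = 25 * cD l (int M)"
    "profile_coeff M (int l) (int l - 2) * profile_coeff M (int l - 2) (int l) = 25 * cBc l (int M)"
proof -
  have nonzero: "2 * real l + 1 \<noteq> 0" "2 * real l + 3 \<noteq> 0" "2 * real l + 5 \<noteq> 0"
    "2 * real l - 1 \<noteq> 0" "2 * real l - 3 \<noteq> 0"
    using assms by auto
  have denominators: "2 * (real l + 1) + 1 = 2 * real l + 3" "2 * (real l + 2) + 1 = 2 * real l + 5"
    "2 * (real l - 1) + 1 = 2 * real l - 1" "2 * (real l - 2) + 1 = 2 * real l - 3"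
    by auto
  note defs = profile_coeff_def leg_up_def leg_down_def denominators add.commute[of 1] power2_eq_square
  show "profile_coeff M (int l) (int l + 2) * profile_coeff M (int l + 2) (int l) = 25 * cA l (int M)"
    by (simp add: defs cA_def) (use nonzero in \<open>simp add: divide_simps, algebra\<close>)
  show "profile_coeff M (int l) (int l - 2) * profile_coeff M (int l - 2) (int l) = 25 * cBc l (int M)"
    by (simp add: defs cBc_def) (use nonzero in \<open>simp add: divide_simps, algebra\<close>)
  define Z where "Z = ((real l)^2 - (real M)^2) / ((2 * real l + 1) * (2 * real l - 1))
            + ((real l + 1)^2 - (real M)^2) / ((2 * real l + 3) * (2 * real l + 1)) - 1/5"
  have "profile_coeff M (int l) (int l) = 5 * Z"
    by (simp add: Z_def defs) (use nonzero in \<open>simp add: divide_simps, algebra\<close>)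
  moreover have "cD l (int M) = Z\<^sup>2"
    by (simp add: cD_def Z_def)
  ultimately show "profile_coeff M (int l) (int l) * profile_coeff M (int l) (int l) = 25 * cD l (int M)"
    by (simp add: power2_eq_square)
qed

lemma curv_coeff_diagonal:
  fixes \<mu> :: real
  assumes "eigval l \<noteq> 0" "eigval k \<noteq> 0"
  shows "curv_coeff M \<mu> l k l = profile_coeff M l k * profile_coeff M k l
    * (2 * (\<mu> / eigval l + 1) + (\<mu> / eigval l - 1)\<^sup>2 * (eigval l / eigval k) - 3 * (eigval k / eigval l))"
proof -
  have "(-1 + (y - \<mu>) / x) * (1 + (x - \<mu>) / y) - 2 * (-1 + (x - \<mu>) / y)
    = 2 * (\<mu> / y + 1) + (\<mu> / y - 1)\<^sup>2 * (y / x) - 3 * (x / y)" if "x \<noteq> 0" "y \<noteq> 0" for x y :: real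
    using that by (simp add: divide_simps power2_eq_square) (simp add: algebra_simps)
  note scalar = this[OF assms(2,1)]
  have "P * w * (P' * x) - 2 * P * (P' * y) = P * P' * (w * x - 2 * y)" for P P' w x y :: real
    by (simp add: algebra_simps)
  then show ?thesis
    unfolding curv_coeff_def nabla_coeff_def by (simp only: scalar)
qed

lemma curv_formula_eq_sum:
  assumes l: "l \<ge> 3" and \<kappa>: "\<kappa>\<^sup>2 = 21 / (64 * pi)" and M: "M = nat \<bar>m\<bar>"
  shows "(real M * \<kappa>)\<^sup>2 / 4 * (\<Sum>k\<in>neighbours (int l). curv_coeff M 12 (int l) k (int l)) = curv_formula l m"
proof -
  let ?y = "eigval (int l)"
  have eig: "?y = real l * (real l + 1)" "eigval (int l + 2) = (real l + 2) * (real l + 3)"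
    "eigval (int l - 2) = (real l - 2) * (real l - 1)"
    by (simp_all add: eigval_def add.assoc)
  have nonzero: "?y \<noteq> 0" "eigval (int l + 2) \<noteq> 0" "eigval (int l - 2) \<noteq> 0"
    using l by (auto simp: eig)
  have m: "real M ^ 2 = (of_int m)\<^sup>2"
    by (simp add: M)
  then have coeffs: "cA l (int M) = cA l m" "cBc l (int M) = cBc l m" "cD l (int M) = cD l m"
    by (simp_all add: cA_def cBc_def cD_def)
  have ratios: "eigval (int l + 2) / ?y = 1 / r1 l" "?y / eigval (int l + 2) = r1 l"
    "eigval (int l - 2) / ?y = 1 / r2 l" "?y / eigval (int l - 2) = r2 l" "?y / ?y = 1"
    using nonzero by (simp_all add: r1_def r2_def eig)
  let ?i = "12 / ?y" and ?j = "(12 / ?y - 1)\<^sup>2"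
  have diagonal: "curv_coeff M 12 (int l) (int l + 2) (int l)
      = 25 * cA l m * (2 * (?i + 1) + ?j * r1 l - 3 * (1 / r1 l))"
    "curv_coeff M 12 (int l) (int l) (int l) = 25 * cD l m * (2 * (?i + 1) + ?j - 3)"
    "curv_coeff M 12 (int l) (int l - 2) (int l) = 25 * cBc l m * (2 * (?i + 1) + ?j * r2 l - 3 * (1 / r2 l))"
    unfolding curv_coeff_diagonal[OF nonzero(1) nonzero(1)] curv_coeff_diagonal[OF nonzero(1) nonzero(2)]
      curv_coeff_diagonal[OF nonzero(1) nonzero(3)] profile_coeff_products[OF l] coeffs ratios
    by simp_all
  have collect: "25 * B * (2 * (i + 1) + j * t - 3 * t')
        + (25 * D * (2 * (i + 1) + j - 3) + 25 * A * (2 * (i + 1) + j * s - 3 * s'))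
      = - 200 * (3 * ((A * s' + B * t' + D) / 8) - 2 * (i + 1) * ((A + B + D) / 8) - j * ((A * s + B * t + D) / 8))"
    for A B D i j s t s' t' :: real
    by (simp add: field_simps)
  have "gamma_lm l m = (cA l m * (1 / r1 l) + cBc l m * (1 / r2 l) + cD l m) / 8"
    by (simp add: gamma_lm_def)
  then have "(\<Sum>k\<in>neighbours (int l). curv_coeff M 12 (int l) k (int l))
      = - 200 * (3 * gamma_lm l m - 2 * (?i + 1) * varrho l m - ?j * vartheta l m)"
    by (simp only: varrho_def vartheta_def collect[symmetric] diagonal[symmetric]) simp
  moreover have "(real M * \<kappa>)\<^sup>2 / 4 * (- 200 * x) = - (525 * (of_int m)\<^sup>2 / (32 * pi)) * x" for x
    by (simp add: power_mult_distrib \<kappa> m field_simps)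
  ultimately show ?thesis
    by (simp only: curv_formula_def eig(1)[symmetric])
qed

lemma herm_csfield_proportional:
  assumes "\<And>c c'. ip (sfield c M T) (sfield c' M q) = K * ip (sfield c M q) (sfield c' M q)"
  shows "herm (csfield c d M T) (csfield c d M q)
    = of_real (K * Re (herm (csfield c d M q) (csfield c d M q)))"
  by (simp add: herm_def assms complex_eq_iff ip_commute[of "sfield d M q" "sfield c M q"] algebra_simps)

lemma herm_cR_real_zonal_leg:
  fixes c d :: complex
  assumes f: "legendre_op 0 f = smult 12 f" "pderiv f = smult \<kappa> profile" and \<kappa>: "\<kappa>\<^sup>2 = 21 / (64 * pi)"
    and l: "l \<ge> 3" and M: "M = nat \<bar>m\<bar>"
    and leg: "\<And>i. even (i - int l) \<Longrightarrow> leg M i \<in> stream_polys \<gg> M"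
  defines "v \<equiv> csfield c d M (leg M (int l))"
  shows "herm (cR \<gg> (real_zonal f) v (real_zonal f)) v = of_real (curv_formula l m * Re (herm v v))"
proof -
  define T where "T = smult ((real M * \<kappa>)\<^sup>2 / 4) (neighbour_sum M (neighbours (int l)) (curv_coeff M 12 (int l)))"
  have "cR \<gg> (real_zonal f) v (real_zonal f) \<simeq>\<^sub>C csfield c d M T"
    unfolding v_def T_def using l leg by (intro cR_real_zonal_leg[OF f]) auto
  then have "herm (cR \<gg> (real_zonal f) v (real_zonal f)) v = herm (csfield c d M T) v"
    by (rule eq_C_herm) simp
  moreover have "ip (sfield c M T) (sfield c' M (leg M (int l)))
      = curv_formula l m * ip (sfield c M (leg M (int l))) (sfield c' M (leg M (int l)))" for c c'
    using l by (simp add: T_def ip_sfield_smult ip_neighbour_sum_leg curv_formula_eq_sum[OF l \<kappa> M, symmetric]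
        del: sum.insert)
  then have "herm (csfield c d M T) v = of_real (curv_formula l m * Re (herm v v))"
    unfolding v_def by (rule herm_csfield_proportional)
  ultimately show ?thesis by simp
qed

lemma herm_csfield_leg_pos:
  fixes C :: real and d :: complex
  assumes "M \<le> l" "l \<noteq> 0" "C \<noteq> 0"
  defines "v \<equiv> csfield (of_real C) d M (leg M (int l))"
  shows "Re (herm v v) > 0"
  using ip_leg_pos[OF assms(1-3)]
    ip_self_nonneg[OF sgrad_continuous_on[OF real_polynomial_function_stream], of d M "leg M (int l)"]
  by (simp add: v_def herm_def add_pos_nonneg)

lemma sec_curv_real_zonal_leg:
  assumes f: "legendre_op 0 f = smult 12 f" "pderiv f = smult \<kappa> profile" "\<kappa>\<^sup>2 = 21 / (64 * pi)"
    and unit: "ip (sfield 1 0 f) (sfield 1 0 f) = 1"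
    and l: "l \<ge> 3" and M: "M = nat \<bar>m\<bar>" "M \<le> l" and C: "C \<noteq> 0"
    and leg: "\<And>i. even (i - int l) \<Longrightarrow> leg M i \<in> stream_polys \<gg> M"
  shows "sec_curv \<gg> (real_zonal f) (csfield (of_real C) d M (leg M (int l))) = of_real (curv_formula l m)"
proof -
  let ?v = "csfield (of_real C) d M (leg M (int l))"
  have num: "herm (cR \<gg> (real_zonal f) ?v (real_zonal f)) ?v = of_real (curv_formula l m * Re (herm ?v ?v))"
    by (rule herm_cR_real_zonal_leg[OF f l M(1) leg])
  show ?thesis
  proof (cases "M = 0")
    case True
    then have "curv_formula l m = 0"
      using M(1) by (simp add: curv_formula_def)
    then show ?thesis
      using num by (simp add: sec_curv_def)
  next
    case False
    have "herm (real_zonal f) ?v = 0"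
      by (simp add: herm_def ip_zonal_sfield_eq_0[OF False] complex_eq_iff)
    moreover have "Re (herm (real_zonal f) (real_zonal f)) = 1"
      by (simp add: herm_def unit)
    moreover have "Re (herm ?v ?v) > 0"
      using l by (intro herm_csfield_leg_pos M(2) C) simp
    ultimately show ?thesis
      unfolding sec_curv_def num by simp
  qed
qed

lemma eq_C_sec_curv:
  assumes "u \<simeq>\<^sub>C u'" "v \<simeq>\<^sub>C v'"
  shows "sec_curv \<gg> u v = sec_curv \<gg> u' v'"
  using eq_C_herm[OF eq_C_cR[OF assms assms(1)] assms(2)] eq_C_herm[OF assms(1,1)] eq_C_herm[OF assms(2,2)]
    eq_C_herm[OF assms] by (simp add: sec_curv_def)

lemma sec_curv_e:
  assumes l: "l \<ge> 3" and m: "- int l \<le> m" "m \<le> int l"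
    and \<gg>: "\<gg> = sdiff_S2 \<or> \<gg> = sdiff_RP2 \<and> odd l"
  shows "sec_curv \<gg> (e 3 0) (e l m) = of_real (curv_formula l m)"
proof -
  define M where "M = nat \<bar>m\<bar>"
  have "M \<le> l"
    using m by (auto simp: M_def)
  obtain f \<kappa> where f: "legendre_op 0 f = smult 12 f" "pderiv f = smult \<kappa> profile" "\<kappa>\<^sup>2 = 21 / (64 * pi)"
    "ip (sfield 1 0 f) (sfield 1 0 f) = 1" and u: "e 3 0 \<simeq>\<^sub>C real_zonal f"
    by (rule e_3_0)
  obtain C d where "C \<noteq> 0" and v: "e l m \<simeq>\<^sub>C csfield (of_real C) d M (leg M (int l))"
    using e_eq_sfield_leg[of l m] l m unfolding M_def by auto
  have "leg M i \<in> stream_polys \<gg> M" if "even (i - int l)" for i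
    using \<gg> that by (intro leg_in_stream_polys) auto
  then show ?thesis
    unfolding eq_C_sec_curv[OF u v]
    by (rule sec_curv_real_zonal_leg[OF f l M_def \<open>M \<le> l\<close> \<open>C \<noteq> 0\<close>])
qed

theorem theorem5:
  fixes l :: nat and m :: int
  assumes "l \<ge> 3" and "- int l \<le> m" and "m \<le> int l" and "(l, m) \<noteq> (3, 0)"
  shows "sec_curv sdiff_S2 (e 3 0) (e l m) = complex_of_real (curv_formula l m) \<and>
         (odd l \<longrightarrow> sec_curv sdiff_RP2 (e 3 0) (e l m) = complex_of_real (curv_formula l m))"
  using sec_curv_e[OF assms(1-3)] by blast

end
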